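(* Let $(R,\mathfrak m,k)$ be a commutative Noetherian local ring and let $M$ be a finitely generated $R$-module which has finite reducing Gorenstein dimension, i.e. $\operatorname{red\text{-}G\text{-}dim}_R(M)<\infty$. Then $$\operatorname{G\text{-}dim}_R(M)=\sup\{i\in\mathbb Z:\ \operatorname{Ext}^i_R(M,R)\neq 0\}.$$ In particular, $M$ has finite Gorenstein dimension if and only if $\operatorname{Ext}^i_R(M,R)=0$ for all $i\gg 0$.
   Context: All modules are finitely generated. $\operatorname{G\text{-}dim}_R$ denotes the Gorenstein dimension of Auslander–Bridger. For a finitely generated module $X$, $\Omega X$ denotes the first syzygy, i.e. the kernel of a minimal free cover $F\twoheadrightarrow X$ (well defined up to isomorphism), $\Omega^0X=X$ and $\Omega^{n}X=\Omega(\Omega^{n-1}X)$; $X^{\oplus a}$ is the direct sum of $a$ copies of $X$. For a homological invariant $\mathrm H$ (a map from isomorphism classes of finitely generated $R$-modules to $\mathbb Z\cup\{\pm\infty\}$), a reducing $\mathrm H$-sequence of $M$ is a finite sequence of modules $K_0,\dots,K_r$ ($r\ge 0$) with $K_0=M$, $\mathrm H(K_r)<\infty$, and, for each $i=1,\dots,r$, positive integers $a_i,b_i,n_i$ and a short exact sequence $0\to K_{i-1}^{\oplus a_i}\to K_i\to \Omega^{n_i}K_{i-1}^{\oplus b_i}\to 0$. The reducing invariant $\operatorname{red\text{-}H}(M)$ is the infimum of the lengths $r$ of reducing $\mathrm H$-sequences of $M$ (so $\operatorname{red\text{-}H}(M)=0$ iff $\mathrm H(M)<\infty$, and $\operatorname{red\text{-}H}(M)<\infty$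 iff a reducing $\mathrm H$-sequence exists). Reducing Gorenstein dimension is this with $\mathrm H=\operatorname{G\text{-}dim}_R$. *)

theory Defs
  imports "HOL-Algebra.Algebra" "HOL-Library.Extended_Real"
begin

definition mod_hom :: "'a ring \<Rightarrow> ('a,'b) module \<Rightarrow> ('a,'c) module \<Rightarrow> ('b \<Rightarrow> 'c) \<Rightarrow> bool" where
  "mod_hom R M N f \<longleftrightarrow>
     f \<in> carrier M \<rightarrow> carrier N \<and>
     (\<forall>x\<in>carrier M. \<forall>y\<in>carrier M. f (x \<oplus>\<^bsub>M\<^esub> y) = f x \<oplus>\<^bsub>N\<^esub> f y) \<and>
     (\<forall>a\<in>carrier R. \<forall>x\<in>carrier M. f (a \<odot>\<^bsub>M\<^esub> x) = a \<odot>\<^bsub>N\<^esub> f x)"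

definition mod_iso :: "'a ring \<Rightarrow> ('a,'b) module \<Rightarrow> ('a,'c) module \<Rightarrow> bool" where
  "mod_iso R M N \<longleftrightarrow> (\<exists>f. mod_hom R M N f \<and> bij_betw f (carrier M) (carrier N))"

definition gen_by :: "'a ring \<Rightarrow> ('a,'b) module \<Rightarrow> nat \<Rightarrow> (nat \<Rightarrow> 'b) \<Rightarrow> bool" where
  "gen_by R M n g \<longleftrightarrow> g \<in> {..<n} \<rightarrow> carrier M \<and>
     (\<forall>x\<in>carrier M. \<exists>c\<in>{..<n} \<rightarrow> carrier R. x = finsum M (\<lambda>i. c i \<odot>\<^bsub>M\<^esub> g i) {..<n})"

definition fin_gen :: "'a ring \<Rightarrow> ('a,'b) module \<Rightarrow> bool" where
  "fin_gen R M \<longleftrightarrow> (\<exists>n g. gen_by R M n g)"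

definition exact_at :: "('a,'b) module \<Rightarrow> ('a,'c) module \<Rightarrow> ('a,'d) module
    \<Rightarrow> ('b \<Rightarrow> 'c) \<Rightarrow> ('c \<Rightarrow> 'd) \<Rightarrow> bool" where
  "exact_at A B C f g \<longleftrightarrow> {y \<in> carrier B. g y = \<zero>\<^bsub>C\<^esub>} = f ` carrier A"

definition ses :: "'a ring \<Rightarrow> ('a,'b) module \<Rightarrow> ('a,'c) module \<Rightarrow> ('a,'d) module
    \<Rightarrow> ('b \<Rightarrow> 'c) \<Rightarrow> ('c \<Rightarrow> 'd) \<Rightarrow> bool" where
  "ses R A B C f g \<longleftrightarrow> mod_hom R A B f \<and> mod_hom R B C g \<and> inj_on f (carrier A) \<and>
     g ` carrier B = carrier C \<and> exact_at A B C f g"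

definition free_mod :: "'a ring \<Rightarrow> nat \<Rightarrow> ('a, nat \<Rightarrow> 'a) module" where
  "free_mod R n =
    \<lparr>carrier = {..<n} \<rightarrow>\<^sub>E carrier R, monoid.mult = (\<lambda>_ _. undefined), monoid.one = undefined,
     ring.zero = (\<lambda>i\<in>{..<n}. \<zero>\<^bsub>R\<^esub>),
     ring.add = (\<lambda>v w. \<lambda>i\<in>{..<n}. v i \<oplus>\<^bsub>R\<^esub> w i),
     smult = (\<lambda>a v. \<lambda>i\<in>{..<n}. a \<otimes>\<^bsub>R\<^esub> v i)\<rparr>"

definition self_mod :: "'a ring \<Rightarrow> ('a, 'a) module" where
  "self_mod R = \<lparr>carrier = carrier R, monoid.mult = monoid.mult R, monoid.one = monoid.one R, ring.zero = ring.zero R,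
     ring.add = add R, smult = monoid.mult R\<rparr>"

definition dsum_pow :: "'a ring \<Rightarrow> ('a,'b) module \<Rightarrow> nat \<Rightarrow> ('a, nat \<Rightarrow> 'b) module" where
  "dsum_pow R Y0 a =
    \<lparr>carrier = {..<a} \<rightarrow>\<^sub>E carrier Y0, monoid.mult = (\<lambda>_ _. undefined), monoid.one = undefined,
     ring.zero = (\<lambda>i\<in>{..<a}. \<zero>\<^bsub>Y0\<^esub>),
     ring.add = (\<lambda>v w. \<lambda>i\<in>{..<a}. v i \<oplus>\<^bsub>Y0\<^esub> w i),
     smult = (\<lambda>r v. \<lambda>i\<in>{..<a}. smult Y0 r (v i))\<rparr>"

definition dual_mod :: "'a ring \<Rightarrow> ('a,'b) module \<Rightarrow> ('a, 'b \<Rightarrow> 'a) module" where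
  "dual_mod R Y0 =
    \<lparr>carrier = {f. mod_hom R Y0 (self_mod R) f \<and> f \<in> extensional (carrier Y0)},
     monoid.mult = (\<lambda>_ _. undefined), monoid.one = undefined,
     ring.zero = (\<lambda>x\<in>carrier Y0. \<zero>\<^bsub>R\<^esub>),
     ring.add = (\<lambda>f g. \<lambda>x\<in>carrier Y0. f x \<oplus>\<^bsub>R\<^esub> g x),
     smult = (\<lambda>r f. \<lambda>x\<in>carrier Y0. r \<otimes>\<^bsub>R\<^esub> f x)\<rparr>"

definition free_res :: "'a ring \<Rightarrow> ('a,'b) module \<Rightarrow> (nat \<Rightarrow> nat)
    \<Rightarrow> (nat \<Rightarrow> (nat \<Rightarrow> 'a) \<Rightarrow> (nat \<Rightarrow> 'a)) \<Rightarrow> ((nat \<Rightarrow> 'a) \<Rightarrow> 'b) \<Rightarrow> bool" where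
  "free_res R M ns d eps \<longleftrightarrow>
     mod_hom R (free_mod R (ns 0)) M eps \<and> eps ` carrier (free_mod R (ns 0)) = carrier M \<and>
     (\<forall>j\<ge>1. mod_hom R (free_mod R (ns j)) (free_mod R (ns (j - 1))) (d j)) \<and>
     exact_at (free_mod R (ns 1)) (free_mod R (ns 0)) M (d 1) eps \<and>
     (\<forall>j\<ge>1. exact_at (free_mod R (ns (j + 1))) (free_mod R (ns j)) (free_mod R (ns (j - 1)))
                (d (j + 1)) (d j))"

text \<open>Ext^i_R(M,R) is nonzero: the i-th cohomology of Hom_R(F,R) for a free resolution F of M
  does not vanish, i.e. there is a cocycle f in Hom(F_i,R) (f o d_(i+1) = 0) which is not a
  coboundary (f is not of the form g o d_i; for i = 0: f is nonzero).\<close>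
definition ext_nonzero :: "'a ring \<Rightarrow> ('a,'b) module \<Rightarrow> nat \<Rightarrow> bool" where
  "ext_nonzero R M i \<longleftrightarrow>
     (\<exists>ns d eps. free_res R M ns d eps \<and>
       (\<exists>f\<in>carrier (dual_mod R (free_mod R (ns i))).
          (\<forall>v\<in>carrier (free_mod R (ns (i + 1))). f (d (i + 1) v) = \<zero>\<^bsub>R\<^esub>) \<and>
          (if i = 0 then f \<noteq> \<zero>\<^bsub>dual_mod R (free_mod R (ns 0))\<^esub>
           else \<not> (\<exists>g\<in>carrier (dual_mod R (free_mod R (ns (i - 1)))).
                     \<forall>v\<in>carrier (free_mod R (ns i)). f v = g (d i v)))))"

text \<open>sup { i in Z : Ext^i_R(M,R) <> 0 } (Ext in negative degrees vanishes; sup {} = -oo).\<close>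
definition ext_sup :: "'a ring \<Rightarrow> ('a,'b) module \<Rightarrow> ereal" where
  "ext_sup R M = Sup {ereal (real i) | i. ext_nonzero R M i}"

definition tot_refl :: "'a ring \<Rightarrow> ('a,'b) module \<Rightarrow> bool" where
  "tot_refl R G \<longleftrightarrow> module R G \<and> fin_gen R G \<and>
     bij_betw (\<lambda>x. \<lambda>f\<in>carrier (dual_mod R G). f x) (carrier G)
              (carrier (dual_mod R (dual_mod R G))) \<and>
     (\<forall>i>0. \<not> ext_nonzero R G i) \<and> (\<forall>i>0. \<not> ext_nonzero R (dual_mod R G) i)"

text \<open>An exact sequence 0 -> G_n --d n--> ... --d 1--> G_0 --eps--> M -> 0 with all G_j totally
  reflexive. (Carrier type nat => 'a is large enough to hold an isomorphic copy of every
  finitely generated R-module.)\<close>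
definition gres :: "'a ring \<Rightarrow> ('a,'b) module \<Rightarrow> nat \<Rightarrow> (nat \<Rightarrow> ('a, nat \<Rightarrow> 'a) module)
    \<Rightarrow> (nat \<Rightarrow> (nat \<Rightarrow> 'a) \<Rightarrow> (nat \<Rightarrow> 'a)) \<Rightarrow> ((nat \<Rightarrow> 'a) \<Rightarrow> 'b) \<Rightarrow> bool" where
  "gres R M n G d eps \<longleftrightarrow>
     (\<forall>j\<le>n. tot_refl R (G j)) \<and>
     mod_hom R (G 0) M eps \<and> eps ` carrier (G 0) = carrier M \<and>
     (\<forall>j\<in>{1..n}. mod_hom R (G j) (G (j - 1)) (d j)) \<and>
     (if n = 0 then inj_on eps (carrier (G 0))
      else exact_at (G 1) (G 0) M (d 1) eps \<and>
           (\<forall>j. 1 \<le> j \<and> j < n \<longrightarrow> exact_at (G (j + 1)) (G j) (G (j - 1)) (d (j + 1)) (d j)) \<and>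
           inj_on (d n) (carrier (G n)))"

text \<open>G-dim_R(M) (Auslander-Bridger), with the convention G-dim 0 = -oo and inf {} = +oo.\<close>
definition gdim :: "'a ring \<Rightarrow> ('a,'b) module \<Rightarrow> ereal" where
  "gdim R M = (if carrier M = {\<zero>\<^bsub>M\<^esub>} then -\<infinity>
               else Inf {ereal (real n) | n. \<exists>G d eps. gres R M n G d eps})"

definition min_cover :: "'a ring \<Rightarrow> ('a,'b) module \<Rightarrow> nat \<Rightarrow> ((nat \<Rightarrow> 'a) \<Rightarrow> 'b) \<Rightarrow> bool" where
  "min_cover R M n eps \<longleftrightarrow> mod_hom R (free_mod R n) M eps \<and>
     eps ` carrier (free_mod R n) = carrier M \<and> (\<forall>m<n. \<not> (\<exists>g. gen_by R M m g))"

definition ker_mod :: "'a ring \<Rightarrow> nat \<Rightarrow> ('a,'b) module \<Rightarrow> ((nat \<Rightarrow> 'a) \<Rightarrow> 'b)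
    \<Rightarrow> ('a, nat \<Rightarrow> 'a) module" where
  "ker_mod R n M eps =
     (free_mod R n)\<lparr>carrier := {v \<in> carrier (free_mod R n). eps v = \<zero>\<^bsub>M\<^esub>}\<rparr>"

definition syzygy :: "'a ring \<Rightarrow> ('a,'b) module \<Rightarrow> ('a,'c) module \<Rightarrow> bool" where
  "syzygy R M N \<longleftrightarrow> module R N \<and> (\<exists>n eps. min_cover R M n eps \<and> mod_iso R N (ker_mod R n M eps))"

fun syz_pow :: "nat \<Rightarrow> 'a ring \<Rightarrow> ('a,'b) module \<Rightarrow> ('a, nat \<Rightarrow> 'a) module \<Rightarrow> bool" where
  "syz_pow 0 R M N = (module R N \<and> mod_iso R M N)"
| "syz_pow (Suc k) R M N = (\<exists>K. syz_pow k R M K \<and> syzygy R K N)"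

definition red_seq :: "'a ring \<Rightarrow> ('a,'b) module \<Rightarrow> nat \<Rightarrow> (nat \<Rightarrow> ('a, nat \<Rightarrow> 'a) module) \<Rightarrow> bool" where
  "red_seq R M r K \<longleftrightarrow>
     mod_iso R (K 0) M \<and> gdim R (K r) < \<infinity> \<and>
     (\<forall>i\<le>r. module R (K i) \<and> fin_gen R (K i)) \<and>
     (\<forall>i\<in>{1..r}.
        (\<exists>a b n Y f g. a > 0 \<and> b > 0 \<and> n > 0 \<and> syz_pow n R (K (i - 1)) Y \<and>
           ses R (dsum_pow R (K (i - 1)) a) (K i) (dsum_pow R Y b) f g))"

definition red_gdim :: "'a ring \<Rightarrow> ('a,'b) module \<Rightarrow> enat" where
  "red_gdim R M = Inf {enat r | r. \<exists>K. red_seq R M r K}"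

end

theory Submission
  imports Defs
begin

text \<open>For a step \<open>0 \<rightarrow> K\<^sup>a \<rightarrow> L \<rightarrow> (\<Omega>\<^sup>n K)\<^sup>b \<rightarrow> 0\<close> of a reducing sequence, vanishing of
  \<open>Ext\<^sup>i(K,R)\<close> for large \<open>i\<close> passes from \<open>K\<close> to \<open>L\<close>, so it suffices to see that finite Gorenstein
  dimension passes back from \<open>L\<close> to \<open>K\<close>. Taking high syzygies one may assume that \<open>L\<close> is totally
  reflexive and \<open>Ext\<^sup>i(K,R) = 0\<close> for all \<open>i > 0\<close>. As \<open>\<Omega>\<^sup>n K\<close> is torsionless, \<open>K\<close> is then reflexive,
  and hence so are its syzygies. Dualizing the sequence and the free covers gives, in terms of
  vanishing ranges of \<open>Ext(-,R)\<close>, that a range for \<open>K\<^sup>*\<close> is inherited by \<open>(\<Omega>\<^sup>n K)\<^sup>*\<close> and that a range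
  for \<open>(\<Omega>\<^sup>n K)\<^sup>*\<close> yields one longer by one for \<open>K\<^sup>*\<close>; by induction \<open>K\<close> is totally reflexive.

  Direct powers, isomorphic copies and different choices of free covers are all handled by one
  relation: \<open>U\<close> is a stable summand of \<open>V\<close> if the identity of \<open>U\<close> is a sum of maps each of which
  factors through \<open>V\<close> or through a finite free module. This relation is inherited by kernels of
  free covers and by duals, and it transports vanishing of \<open>Ext\<close> and total reflexivity.\<close>

section \<open>Modules and homomorphisms\<close>

text \<open>Only the vanishing of Ext is followed, never Ext as a module. Ext^1(U,R) = 0 means that
  functionals on the kernel of a free cover of U extend to the free module, and higher degrees are
  reached by passing to that kernel; the long exact sequence becomes three implications between
  vanishing statements. Since \<open>ext_nonzero\<close> asks for a nonzero class in some
  resolution, independence of the resolution has to come early; it is the case U = V of the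
  transport along stable summands. Kernels of free covers have carrier type
  \<open>nat \<Rightarrow> 'a\<close>, while duals and direct powers do not. Inductions therefore
  run in that type, and general statements are reduced to it by one explicit syzygy. The equality in
  the theorem rests on one fact: if a module has some finite resolution by totally reflexive modules
  and Ext vanishes above degree s, then its s-th syzygy is already totally reflexive. This shortens
  a resolution to the length prescribed by Ext. It also makes the descent along a reducing sequence
  independent of the Gorenstein dimension of the last module: a vanishing bound c for the first
  module serves for all of them.\<close>

locale noeth_cring = cring R + noetherian_ring R for R :: "'a ring" (structure)

lemma mod_homD:
  assumes "mod_hom R A B f"
  shows "x \<in> carrier A \<Longrightarrow> f x \<in> carrier B"
    and "x \<in> carrier A \<Longrightarrow> y \<in> carrier A \<Longrightarrow> f (x \<oplus>\<^bsub>A\<^esub> y) = f x \<oplus>\<^bsub>B\<^esub> f y"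
    and "a \<in> carrier R \<Longrightarrow> x \<in> carrier A \<Longrightarrow> f (a \<odot>\<^bsub>A\<^esub> x) = a \<odot>\<^bsub>B\<^esub> f x"
  using assms unfolding mod_hom_def by auto

lemma mod_homI:
  assumes "\<And>x. x \<in> carrier A \<Longrightarrow> f x \<in> carrier B"
    and "\<And>x y. x \<in> carrier A \<Longrightarrow> y \<in> carrier A \<Longrightarrow> f (x \<oplus>\<^bsub>A\<^esub> y) = f x \<oplus>\<^bsub>B\<^esub> f y"
    and "\<And>a x. a \<in> carrier R \<Longrightarrow> x \<in> carrier A \<Longrightarrow> f (a \<odot>\<^bsub>A\<^esub> x) = a \<odot>\<^bsub>B\<^esub> f x"
  shows "mod_hom R A B f"
  using assms unfolding mod_hom_def by auto

lemma mod_hom_comp: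
  "mod_hom R A B f \<Longrightarrow> mod_hom R B C g \<Longrightarrow> mod_hom R A C (\<lambda>x. g (f x))"
  unfolding mod_hom_def by (auto simp: Pi_iff)

lemma mod_hom_id: "mod_hom R A A (\<lambda>x. x)"
  unfolding mod_hom_def by auto

definition free_cover :: "'a ring \<Rightarrow> ('a,'b) module \<Rightarrow> nat \<Rightarrow> ((nat \<Rightarrow> 'a) \<Rightarrow> 'b) \<Rightarrow> bool" where
  "free_cover R U n e \<longleftrightarrow> mod_hom R (free_mod R n) U e \<and> e ` carrier (free_mod R n) = carrier U"

text \<open>Surjectivity of Hom(B,R) -> Hom(A,R). For the inclusion of the kernel of a free cover of
  U this is Ext^1(U,R) = 0.\<close>

definition homs_extend :: "'a ring \<Rightarrow> ('a,'b) module \<Rightarrow> ('a,'c) module \<Rightarrow> ('b \<Rightarrow> 'c) \<Rightarrow> bool" where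
  "homs_extend R A B i \<longleftrightarrow> (\<forall>f. mod_hom R A (self_mod R) f \<longrightarrow>
     (\<exists>g. mod_hom R B (self_mod R) g \<and> (\<forall>x\<in>carrier A. g (i x) = f x)))"

definition unit_vec :: "'a ring \<Rightarrow> nat \<Rightarrow> nat \<Rightarrow> nat \<Rightarrow> 'a" where
  "unit_vec R n i = (\<lambda>j\<in>{..<n}. if j = i then \<one>\<^bsub>R\<^esub> else \<zero>\<^bsub>R\<^esub>)"

context noeth_cring
begin

abbreviation "lin A B f \<equiv> mod_hom R A B f"
abbreviation "free n \<equiv> free_mod R n"
abbreviation "self \<equiv> self_mod R"
abbreviation "dual A \<equiv> dual_mod R A"
abbreviation "ker n A e \<equiv> ker_mod R n A e"
abbreviation "ext A i \<equiv> ext_nonzero R A i"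

text \<open>The premise on the scalar \<open>\<zero>\<close> stands in for additive inverses: minus
  one times x is the inverse of x.\<close>

lemma modI:
  assumes "\<And>x y. x \<in> carrier M \<Longrightarrow> y \<in> carrier M \<Longrightarrow> x \<oplus>\<^bsub>M\<^esub> y \<in> carrier M"
    and "\<zero>\<^bsub>M\<^esub> \<in> carrier M"
    and "\<And>x y z. x \<in> carrier M \<Longrightarrow> y \<in> carrier M \<Longrightarrow> z \<in> carrier M \<Longrightarrow> (x \<oplus>\<^bsub>M\<^esub> y) \<oplus>\<^bsub>M\<^esub> z = x \<oplus>\<^bsub>M\<^esub> (y \<oplus>\<^bsub>M\<^esub> z)"
    and "\<And>x y. x \<in> carrier M \<Longrightarrow> y \<in> carrier M \<Longrightarrow> x \<oplus>\<^bsub>M\<^esub> y = y \<oplus>\<^bsub>M\<^esub> x"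
    and "\<And>x. x \<in> carrier M \<Longrightarrow> \<zero>\<^bsub>M\<^esub> \<oplus>\<^bsub>M\<^esub> x = x"
    and sc: "\<And>a x. a \<in> carrier R \<Longrightarrow> x \<in> carrier M \<Longrightarrow> a \<odot>\<^bsub>M\<^esub> x \<in> carrier M"
    and ld: "\<And>a b x. a \<in> carrier R \<Longrightarrow> b \<in> carrier R \<Longrightarrow> x \<in> carrier M \<Longrightarrow>
      (a \<oplus> b) \<odot>\<^bsub>M\<^esub> x = a \<odot>\<^bsub>M\<^esub> x \<oplus>\<^bsub>M\<^esub> b \<odot>\<^bsub>M\<^esub> x"
    and "\<And>a x y. a \<in> carrier R \<Longrightarrow> x \<in> carrier M \<Longrightarrow> y \<in> carrier M \<Longrightarrow>
      a \<odot>\<^bsub>M\<^esub> (x \<oplus>\<^bsub>M\<^esub> y) = a \<odot>\<^bsub>M\<^esub> x \<oplus>\<^bsub>M\<^esub> a \<odot>\<^bsub>M\<^esub> y"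
    and "\<And>a b x. a \<in> carrier R \<Longrightarrow> b \<in> carrier R \<Longrightarrow> x \<in> carrier M \<Longrightarrow>
      (a \<otimes> b) \<odot>\<^bsub>M\<^esub> x = a \<odot>\<^bsub>M\<^esub> (b \<odot>\<^bsub>M\<^esub> x)"
    and one: "\<And>x. x \<in> carrier M \<Longrightarrow> \<one> \<odot>\<^bsub>M\<^esub> x = x"
    and null: "\<And>x. x \<in> carrier M \<Longrightarrow> \<zero> \<odot>\<^bsub>M\<^esub> x = \<zero>\<^bsub>M\<^esub>"
  shows "module R M"
proof (rule moduleI)
  show "abelian_group M"
  proof (rule abelian_groupI)
    fix x assume x: "x \<in> carrier M"
    have "(\<ominus> \<one>) \<odot>\<^bsub>M\<^esub> x \<oplus>\<^bsub>M\<^esub> x = (\<ominus> \<one> \<oplus> \<one>) \<odot>\<^bsub>M\<^esub> x"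
      using ld[of "\<ominus> \<one>" \<one> x] one[OF x] x by simp
    then show "\<exists>y\<in>carrier M. y \<oplus>\<^bsub>M\<^esub> x = \<zero>\<^bsub>M\<^esub>"
      using sc[OF _ x] null[OF x] by (metis a_inv_closed l_neg one_closed)
  qed (use assms in auto)
qed (use assms is_cring in auto)

lemmas module_abelian_group = module.axioms(2)[of R]
lemmas module_abelian_monoid = module_abelian_group[THEN abelian_group.axioms(1)]

lemmas mzero [simp] = module_abelian_monoid[THEN abelian_monoid.zero_closed]
lemmas madd [simp] = module_abelian_monoid[THEN abelian_monoid.a_closed]
lemmas madd0 [simp] = module_abelian_monoid[THEN abelian_monoid.r_zero]
lemmas m0add [simp] = module_abelian_monoid[THEN abelian_monoid.l_zero]
lemmas madd_assoc = module_abelian_monoid[THEN abelian_monoid.a_assoc]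
lemmas madd_comm = module_abelian_monoid[THEN abelian_monoid.a_comm]
lemmas madd_lcomm = module_abelian_monoid[THEN abelian_monoid.a_lcomm]
lemmas mneg [simp] = module_abelian_group[THEN abelian_group.a_inv_closed]
lemmas madd_neg [simp] = module_abelian_group[THEN abelian_group.r_neg]
lemmas mneg_add [simp] = module_abelian_group[THEN abelian_group.l_neg]
lemmas mneg_dist = module_abelian_group[THEN abelian_group.minus_add]
lemmas msmult [simp] = module.smult_closed[of R]
lemmas mone [simp] = module.smult_one[of R]
lemmas mnull [simp] = module.smult_l_null[of R]
lemmas msmult0 [simp] = module.smult_r_null[of R]
lemmas msmult_add = module.smult_r_distr[of R]
lemmas madd_smult = module.smult_l_distr[of R]
lemmas msmult_smult = module.smult_assoc1[of R]
lemmas msmult_neg = module.smult_r_minus[of R]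

lemma mneg_smult: "module R M \<Longrightarrow> x \<in> carrier M \<Longrightarrow> (\<ominus> \<one>) \<odot>\<^bsub>M\<^esub> x = \<ominus>\<^bsub>M\<^esub> x"
  by (simp add: module.smult_l_minus)

lemma mcancel:
  assumes "module R M" "x \<in> carrier M" "y \<in> carrier M" "x \<oplus>\<^bsub>M\<^esub> (\<ominus>\<^bsub>M\<^esub> y) = \<zero>\<^bsub>M\<^esub>"
  shows "x = y"
proof -
  have "x = x \<oplus>\<^bsub>M\<^esub> ((\<ominus>\<^bsub>M\<^esub> y) \<oplus>\<^bsub>M\<^esub> y)" using assms by simp
  also have "\<dots> = (x \<oplus>\<^bsub>M\<^esub> (\<ominus>\<^bsub>M\<^esub> y)) \<oplus>\<^bsub>M\<^esub> y" using assms(1-3) by (simp add: madd_assoc)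
  finally show ?thesis using assms by simp
qed

lemma madd_cancel:
  assumes "module R M" "x \<in> carrier M" "y \<in> carrier M"
  shows "x \<oplus>\<^bsub>M\<^esub> (y \<oplus>\<^bsub>M\<^esub> (\<ominus>\<^bsub>M\<^esub> x)) = y" "(x \<oplus>\<^bsub>M\<^esub> (\<ominus>\<^bsub>M\<^esub> y)) \<oplus>\<^bsub>M\<^esub> y = x"
    "x \<oplus>\<^bsub>M\<^esub> ((\<ominus>\<^bsub>M\<^esub> x) \<oplus>\<^bsub>M\<^esub> y) = y" 
proof -
  show "x \<oplus>\<^bsub>M\<^esub> (y \<oplus>\<^bsub>M\<^esub> (\<ominus>\<^bsub>M\<^esub> x)) = y" using assms by (subst madd_lcomm) auto
  show "(x \<oplus>\<^bsub>M\<^esub> (\<ominus>\<^bsub>M\<^esub> y)) \<oplus>\<^bsub>M\<^esub> y = x" using assms by (subst madd_assoc) auto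
  show "x \<oplus>\<^bsub>M\<^esub> ((\<ominus>\<^bsub>M\<^esub> x) \<oplus>\<^bsub>M\<^esub> y) = y" using assms by (subst madd_assoc[symmetric]) auto
qed

lemma hom_zero [simp]:
  assumes "lin A B f" "module R A" "module R B"
  shows "f \<zero>\<^bsub>A\<^esub> = \<zero>\<^bsub>B\<^esub>"
proof -
  have "f \<zero>\<^bsub>A\<^esub> = f (\<zero> \<odot>\<^bsub>A\<^esub> \<zero>\<^bsub>A\<^esub>)" using assms by simp
  also have "\<dots> = \<zero> \<odot>\<^bsub>B\<^esub> f \<zero>\<^bsub>A\<^esub>" using assms(2) by (subst mod_homD(3)[OF assms(1)]) auto
  finally show ?thesis using assms mod_homD(1)[OF assms(1)] by simp
qed

lemma hom_neg:
  assumes "lin A B f" "module R A" "module R B" "x \<in> carrier A"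
  shows "f (\<ominus>\<^bsub>A\<^esub> x) = \<ominus>\<^bsub>B\<^esub> f x"
  using mod_homD(3)[OF assms(1), of "\<ominus> \<one>" x] assms mod_homD(1)[OF assms(1)]
  by (simp add: mneg_smult)

lemma hom_diff:
  assumes "lin A B f" "module R A" "module R B" "x \<in> carrier A" "y \<in> carrier A"
  shows "f (x \<oplus>\<^bsub>A\<^esub> (\<ominus>\<^bsub>A\<^esub> y)) = f x \<oplus>\<^bsub>B\<^esub> (\<ominus>\<^bsub>B\<^esub> f y)"
  using assms by (simp add: mod_homD(2)[OF assms(1)] hom_neg[OF assms(1)])

lemma hom_finsum:
  assumes "lin A B f" "module R A" "module R B" "finite I" "\<And>i. i \<in> I \<Longrightarrow> h i \<in> carrier A"
  shows "f (finsum A h I) = finsum B (\<lambda>i. f (h i)) I"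
  using assms(4,5)
proof (induct I rule: finite_induct)
  case empty
  interpret A: module R A by fact
  interpret B: module R B by fact
  show ?case using assms(1-3) by simp
next
  case (insert x I)
  interpret A: module R A by fact
  interpret B: module R B by fact
  have "f (finsum A h (insert x I)) = f (h x \<oplus>\<^bsub>A\<^esub> finsum A h I)"
    using insert by (subst A.finsum_insert) auto
  also have "\<dots> = f (h x) \<oplus>\<^bsub>B\<^esub> f (finsum A h I)"
    using insert by (intro mod_homD(2)[OF assms(1)]) auto
  also have "\<dots> = finsum B (\<lambda>i. f (h i)) (insert x I)"
    using insert mod_homD(1)[OF assms(1)] by (subst B.finsum_insert) auto
  finally show ?case .
qed

lemma hom_add:
  assumes "lin A B f" "lin A B g" "module R B"
  shows "lin A B (\<lambda>x. f x \<oplus>\<^bsub>B\<^esub> g x)"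
  using assms(3) mod_homD[OF assms(1)] mod_homD[OF assms(2)]
  by (intro mod_homI) (simp_all add: msmult_add madd_assoc madd_lcomm)

lemma hom_minus:
  assumes "lin A B f" "module R B"
  shows "lin A B (\<lambda>x. \<ominus>\<^bsub>B\<^esub> f x)"
  using assms(2) mod_homD[OF assms(1)] by (intro mod_homI) (simp_all add: msmult_neg mneg_dist)

lemma hom_sub:
  assumes "lin A B f" "lin A B g" "module R B"
  shows "lin A B (\<lambda>x. f x \<oplus>\<^bsub>B\<^esub> (\<ominus>\<^bsub>B\<^esub> g x))"
  using assms by (intro hom_add hom_minus)

lemma hom_smult:
  assumes "lin A B f" "module R B" "a \<in> carrier R"
  shows "lin A B (\<lambda>x. a \<odot>\<^bsub>B\<^esub> f x)"
  using assms(2,3) mod_homD[OF assms(1)]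
  by (intro mod_homI) (simp_all add: msmult_add msmult_smult[symmetric] m_comm)

lemma hom_const0: "module R B \<Longrightarrow> lin A B (\<lambda>x. \<zero>\<^bsub>B\<^esub>)"
  by (intro mod_homI) simp_all

lemma hom_cong:
  assumes "lin A B f" "module R A" "\<And>x. x \<in> carrier A \<Longrightarrow> g x = f x"
  shows "lin A B g"
  using mod_homD[OF assms(1)] assms(2,3) by (intro mod_homI) simp_all

lemma hom_restrict:
  assumes "lin A B f" "module R A"
  shows "lin A B (restrict f (carrier A))"
  by (rule hom_cong[OF assms]) simp

section \<open>The ring as a module, direct powers, duals and kernels\<close>

lemma self_mod_simps [simp]:
  "carrier (self) = carrier R" "\<zero>\<^bsub>self\<^esub> = \<zero>" "x \<oplus>\<^bsub>self\<^esub> y = x \<oplus> y"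
  "a \<odot>\<^bsub>self\<^esub> x = a \<otimes> x"
  by (simp_all add: self_mod_def)

lemma module_self [simp]: "module R (self)"
  by (rule modI) (auto simp: a_assoc a_comm a_lcomm l_distr r_distr m_assoc)

lemma dsum_pow_simps:
  "carrier (dsum_pow R Y n) = {..<n} \<rightarrow>\<^sub>E carrier Y"
  "\<zero>\<^bsub>dsum_pow R Y n\<^esub> = (\<lambda>i\<in>{..<n}. \<zero>\<^bsub>Y\<^esub>)"
  "v \<oplus>\<^bsub>dsum_pow R Y n\<^esub> w = (\<lambda>i\<in>{..<n}. v i \<oplus>\<^bsub>Y\<^esub> w i)"
  "a \<odot>\<^bsub>dsum_pow R Y n\<^esub> v = (\<lambda>i\<in>{..<n}. a \<odot>\<^bsub>Y\<^esub> v i)"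
  by (simp_all add: dsum_pow_def)

lemma module_dsum_pow [simp]:
  assumes "module R Y" shows "module R (dsum_pow R Y n)"
  using assms
  by (intro modI)
     (auto simp: dsum_pow_simps fun_eq_iff PiE_iff extensional_def madd_assoc madd_comm madd_lcomm
        msmult_add madd_smult msmult_smult)

lemma free_mod_eq: "free n = dsum_pow R (self) n"
  by (simp add: free_mod_def dsum_pow_def self_mod_def)

lemma free_mod_simps:
  "carrier (free n) = {..<n} \<rightarrow>\<^sub>E carrier R"
  "\<zero>\<^bsub>free n\<^esub> = (\<lambda>i\<in>{..<n}. \<zero>)"
  "v \<oplus>\<^bsub>free n\<^esub> w = (\<lambda>i\<in>{..<n}. v i \<oplus> w i)"
  "a \<odot>\<^bsub>free n\<^esub> v = (\<lambda>i\<in>{..<n}. a \<otimes> v i)"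
  by (simp_all add: free_mod_def)

lemma module_free [simp]: "module R (free n)"
  by (simp add: free_mod_eq)

lemma dual_simps:
  "f \<in> carrier (dual Y) \<longleftrightarrow> lin Y (self) f \<and> f \<in> extensional (carrier Y)"
  "\<zero>\<^bsub>dual Y\<^esub> = (\<lambda>x\<in>carrier Y. \<zero>)"
  "f \<oplus>\<^bsub>dual Y\<^esub> g = (\<lambda>x\<in>carrier Y. f x \<oplus> g x)"
  "a \<odot>\<^bsub>dual Y\<^esub> f = (\<lambda>x\<in>carrier Y. a \<otimes> f x)"
  by (simp_all add: dual_mod_def)

lemma dual_memI: "lin Y (self) f \<Longrightarrow> module R Y \<Longrightarrow> restrict f (carrier Y) \<in> carrier (dual Y)"
  by (auto simp: dual_simps intro: hom_restrict)

lemma dual_memD: "f \<in> carrier (dual Y) \<Longrightarrow> lin Y (self) f"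
  by (auto simp: dual_simps)

lemma dual_eqI:
  assumes "f \<in> carrier (dual Y)" "g \<in> carrier (dual Y)" "\<And>x. x \<in> carrier Y \<Longrightarrow> f x = g x"
  shows "f = g"
  using assms by (auto simp: dual_simps intro: extensionalityI)

lemma module_dual [simp]:
  assumes "module R Y" shows "module R (dual Y)"
proof -
  have c: "f x \<in> carrier R" if "f \<in> carrier (dual Y)" "x \<in> carrier Y" for f x
    using mod_homD(1)[OF dual_memD[OF that(1)] that(2)] by simp
  show ?thesis
  proof (rule modI)
    fix f g assume "f \<in> carrier (dual Y)" "g \<in> carrier (dual Y)"
    then show "f \<oplus>\<^bsub>dual Y\<^esub> g \<in> carrier (dual Y)"
      using dual_memI[OF hom_add[OF dual_memD dual_memD]] assms by (simp add: dual_simps(3))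
  next
    show "\<zero>\<^bsub>dual Y\<^esub> \<in> carrier (dual Y)"
      using dual_memI[OF hom_const0] assms by (simp add: dual_simps(2))
  next
    fix a f assume "a \<in> carrier R" "f \<in> carrier (dual Y)"
    then show "a \<odot>\<^bsub>dual Y\<^esub> f \<in> carrier (dual Y)"
      using dual_memI[OF hom_smult[OF dual_memD]] assms by (simp add: dual_simps(4))
  next
    fix f assume "f \<in> carrier (dual Y)"
    then show "\<zero>\<^bsub>dual Y\<^esub> \<oplus>\<^bsub>dual Y\<^esub> f = f" "\<one> \<odot>\<^bsub>dual Y\<^esub> f = f"
      using c by (auto simp: dual_simps(2-4) fun_eq_iff dual_simps(1) extensional_def)
  qed (auto simp: dual_simps(2-4) c fun_eq_iff a_assoc a_comm a_lcomm l_distr r_distr m_assoc)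
qed

lemma ker_mod_simps:
  "carrier (ker n U e) = {v \<in> carrier (free n). e v = \<zero>\<^bsub>U\<^esub>}"
  "\<zero>\<^bsub>ker n U e\<^esub> = \<zero>\<^bsub>free n\<^esub>"
  "v \<oplus>\<^bsub>ker n U e\<^esub> w = v \<oplus>\<^bsub>free n\<^esub> w"
  "a \<odot>\<^bsub>ker n U e\<^esub> v = a \<odot>\<^bsub>free n\<^esub> v"
  by (simp_all add: ker_mod_def)

lemma module_ker [simp]:
  assumes "lin (free n) U e" "module R U"
  shows "module R (ker n U e)"
  using assms mod_homD[OF assms(1)]
  by (intro modI) (auto simp: ker_mod_simps madd_assoc madd_comm madd_lcomm msmult_add madd_smult msmult_smult)

lemma hom_ker_iff:
  "lin A (ker n U e) f \<longleftrightarrow>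
     lin A (free n) f \<and> (\<forall>x\<in>carrier A. e (f x) = \<zero>\<^bsub>U\<^esub>)"
  by (auto simp: mod_hom_def ker_mod_simps)

lemma hom_from_ker:
  "lin (free n) B f \<Longrightarrow> lin (ker n U e) B f"
  by (auto simp: mod_hom_def ker_mod_simps)

lemma hom_incl: "lin (ker n U e) (free n) (\<lambda>v. v)"
  by (auto simp: mod_hom_def ker_mod_simps)

lemma ses_ker:
  "free_cover R U n e \<Longrightarrow> ses R (ker n U e) (free n) U (\<lambda>v. v) e"
  unfolding ses_def free_cover_def by (auto simp: hom_incl exact_at_def ker_mod_simps)

section \<open>Free modules: universal property and lifting\<close>

lemma unit_vec_carrier [simp]: "unit_vec R n i \<in> carrier (free n)"
  by (auto simp: unit_vec_def free_mod_simps)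

lemma free_expand:
  assumes "v \<in> carrier (free n)"
  shows "v = finsum (free n) (\<lambda>i. v i \<odot>\<^bsub>free n\<^esub> unit_vec R n i) {..<n}"
proof -
  interpret F: module R "free n" by simp
  have vi: "v i \<in> carrier R" if "i < n" for i using assms that by (auto simp: free_mod_simps)
  have *: "finite I \<Longrightarrow> I \<subseteq> {..<n} \<Longrightarrow>
     finsum (free n) (\<lambda>i. v i \<odot>\<^bsub>free n\<^esub> unit_vec R n i) I = (\<lambda>j\<in>{..<n}. if j \<in> I then v j else \<zero>)" for I
  proof (induct I rule: finite_induct)
    case empty then show ?case by (simp add: free_mod_simps)
  next
    case (insert a I)
    have "finsum (free n) (\<lambda>i. v i \<odot>\<^bsub>free n\<^esub> unit_vec R n i) (insert a I) =
       v a \<odot>\<^bsub>free n\<^esub> unit_vec R n a \<oplus>\<^bsub>free n\<^esub> finsum (free n) (\<lambda>i. v i \<odot>\<^bsub>free n\<^esub> unit_vec R n i) I"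
      using insert vi by (subst F.finsum_insert) auto
    also have "\<dots> = v a \<odot>\<^bsub>free n\<^esub> unit_vec R n a \<oplus>\<^bsub>free n\<^esub> (\<lambda>j\<in>{..<n}. if j \<in> I then v j else \<zero>)"
      by (subst insert.hyps(3)) (use insert.prems in auto)
    also have "\<dots> = (\<lambda>j\<in>{..<n}. if j \<in> insert a I then v j else \<zero>)"
      using insert vi by (auto simp: free_mod_simps unit_vec_def fun_eq_iff)
    finally show ?case .
  qed
  show ?thesis
    using assms by (subst *) (auto simp: free_mod_simps fun_eq_iff PiE_iff extensional_def)
qed

lemma free_hom:
  assumes M: "module R M" and g: "\<And>i. i < n \<Longrightarrow> g i \<in> carrier M"
  shows "lin (free n) M (\<lambda>v. finsum M (\<lambda>i. v i \<odot>\<^bsub>M\<^esub> g i) {..<n})"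
    and "i < n \<Longrightarrow> finsum M (\<lambda>j. unit_vec R n i j \<odot>\<^bsub>M\<^esub> g j) {..<n} = g i"
proof -
  interpret M: module R M by fact
  have c: "v \<in> carrier (free n) \<Longrightarrow> i < n \<Longrightarrow> v i \<in> carrier R" for v i
    by (auto simp: free_mod_simps)
  show "lin (free n) M (\<lambda>v. finsum M (\<lambda>i. v i \<odot>\<^bsub>M\<^esub> g i) {..<n})"
  proof (rule mod_homI)
    fix v w assume v: "v \<in> carrier (free n)" and w: "w \<in> carrier (free n)"
    show "finsum M (\<lambda>i. v i \<odot>\<^bsub>M\<^esub> g i) {..<n} \<in> carrier M" using c[OF v] g by (auto intro!: M.finsum_closed)
    have "finsum M (\<lambda>i. (v \<oplus>\<^bsub>free n\<^esub> w) i \<odot>\<^bsub>M\<^esub> g i) {..<n} = finsum M (\<lambda>i. v i \<odot>\<^bsub>M\<^esub> g i \<oplus>\<^bsub>M\<^esub> w i \<odot>\<^bsub>M\<^esub> g i) {..<n}"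
      using c[OF v] c[OF w] g by (intro M.finsum_cong') (auto simp: free_mod_simps madd_smult[OF M])
    then show "finsum M (\<lambda>i. (v \<oplus>\<^bsub>free n\<^esub> w) i \<odot>\<^bsub>M\<^esub> g i) {..<n} =
       finsum M (\<lambda>i. v i \<odot>\<^bsub>M\<^esub> g i) {..<n} \<oplus>\<^bsub>M\<^esub> finsum M (\<lambda>i. w i \<odot>\<^bsub>M\<^esub> g i) {..<n}"
      using c[OF v] c[OF w] g by (subst M.finsum_addf[symmetric]) auto
    fix a assume a: "a \<in> carrier R"
    show "finsum M (\<lambda>i. (a \<odot>\<^bsub>free n\<^esub> v) i \<odot>\<^bsub>M\<^esub> g i) {..<n} = a \<odot>\<^bsub>M\<^esub> finsum M (\<lambda>i. v i \<odot>\<^bsub>M\<^esub> g i) {..<n}"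
      using c[OF v] g a by (subst M.finsum_smult_ldistr) (auto intro!: M.finsum_cong' simp: free_mod_simps msmult_smult[OF M])
  qed
  assume i: "i < n"
  have "finsum M (\<lambda>j. unit_vec R n i j \<odot>\<^bsub>M\<^esub> g j) {..<n} = finsum M (\<lambda>j. if i = j then g j else \<zero>\<^bsub>M\<^esub>) {..<n}"
    using g M by (intro M.finsum_cong') (auto simp: unit_vec_def)
  also have "\<dots> = g i" using i g by (subst M.finsum_singleton) auto
  finally show "finsum M (\<lambda>j. unit_vec R n i j \<odot>\<^bsub>M\<^esub> g j) {..<n} = g i" .
qed

lemma free_hom_ex:
  assumes "module R M" "\<And>i. i < n \<Longrightarrow> g i \<in> carrier M"
  obtains h where "lin (free n) M h" "\<And>i. i < n \<Longrightarrow> h (unit_vec R n i) = g i"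
  by (rule that[OF free_hom[where g = g]]) (use assms in auto)

lemma free_hom_eqI:
  assumes "lin (free n) M f" "lin (free n) M h" "module R M"
    and "\<And>i. i < n \<Longrightarrow> f (unit_vec R n i) = h (unit_vec R n i)" "v \<in> carrier (free n)"
  shows "f v = h v"
proof -
  interpret M: module R M by fact
  have c: "i < n \<Longrightarrow> v i \<in> carrier R" for i using assms(5) by (auto simp: free_mod_simps)
  have "f v = finsum M (\<lambda>i. f (v i \<odot>\<^bsub>free n\<^esub> unit_vec R n i)) {..<n}"
    using c by (subst free_expand[OF assms(5)], subst hom_finsum[OF assms(1) _ assms(3)]) auto
  also have "\<dots> = finsum M (\<lambda>i. h (v i \<odot>\<^bsub>free n\<^esub> unit_vec R n i)) {..<n}"
    using c assms(4) mod_homD[OF assms(1)] mod_homD[OF assms(2)] assms(3) by (intro M.finsum_cong') auto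
  also have "\<dots> = h v"
    using c by (subst (2) free_expand[OF assms(5)], subst hom_finsum[OF assms(2) _ assms(3)]) auto
  finally show ?thesis .
qed

text \<open>Projectivity of free modules, with surjectivity of \<open>p\<close> weakened to hitting
  the images of the basis vectors. In this form it also lifts into a submodule embedded by
  \<open>p\<close>.\<close>

lemma free_lift:
  assumes f: "lin (free n) Y f" and p: "lin Z Y p"
    and "module R Y" "module R Z" and s: "\<And>i. i < n \<Longrightarrow> f (unit_vec R n i) \<in> p ` carrier Z"
  obtains h where "lin (free n) Z h" "\<And>v. v \<in> carrier (free n) \<Longrightarrow> p (h v) = f v"
proof -
  have "\<exists>z. \<forall>i. i < n \<longrightarrow> z i \<in> carrier Z \<and> p (z i) = f (unit_vec R n i)"
    using s by (intro choice) (metis imageE)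
  then obtain z where z: "\<And>i. i < n \<Longrightarrow> z i \<in> carrier Z" "\<And>i. i < n \<Longrightarrow> p (z i) = f (unit_vec R n i)" by blast
  obtain h where h: "lin (free n) Z h" "\<And>i. i < n \<Longrightarrow> h (unit_vec R n i) = z i"
    using free_hom_ex[OF assms(4)] z(1) by metis
  have "p (h v) = f v" if "v \<in> carrier (free n)" for v
    using free_hom_eqI[OF mod_hom_comp[OF h(1) p] f assms(3) _ that] h(2) z(2) by simp
  with h(1) show ?thesis using that by blast
qed

lemma free_lift_cover:
  assumes "lin (free n) Y f" "lin Z Y p" "p ` carrier Z = carrier Y" "module R Y" "module R Z"
  obtains h where "lin (free n) Z h" "\<And>v. v \<in> carrier (free n) \<Longrightarrow> p (h v) = f v"
  using free_lift[OF assms(1,2,4,5)] assms(3) mod_homD(1)[OF assms(1)] unit_vec_carrier by metis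

end

section \<open>Finite generation over a Noetherian ring\<close>

text \<open>Concatenation of coordinates keeps the direct sum of two free modules inside the family
  of the \<open>free_mod R n\<close>.\<close>

definition join :: "nat \<Rightarrow> nat \<Rightarrow> (nat \<Rightarrow> 'a) \<Rightarrow> (nat \<Rightarrow> 'a) \<Rightarrow> nat \<Rightarrow> 'a" where
  "join p q u w = (\<lambda>i\<in>{..<p + q}. if i < p then u i else w (i - p))"

definition fst_part :: "nat \<Rightarrow> nat \<Rightarrow> (nat \<Rightarrow> 'a) \<Rightarrow> nat \<Rightarrow> 'a" where
  "fst_part p q v = restrict v {..<p}"

definition snd_part :: "nat \<Rightarrow> nat \<Rightarrow> (nat \<Rightarrow> 'a) \<Rightarrow> nat \<Rightarrow> 'a" where
  "snd_part p q v = (\<lambda>i\<in>{..<q}. v (p + i))"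

context noeth_cring
begin

lemma hom_fst_part: "lin (free (p + q)) (free p) (fst_part p q)"
  by (rule mod_homI) (auto simp: free_mod_simps fst_part_def fun_eq_iff PiE_iff)

lemma hom_snd_part: "lin (free (p + q)) (free q) (snd_part p q)"
  by (rule mod_homI) (auto simp: free_mod_simps snd_part_def fun_eq_iff PiE_iff)

lemma hom_join:
  assumes "lin A (free p) f" "lin A (free q) g"
  shows "lin A (free (p + q)) (\<lambda>x. join p q (f x) (g x))"
  using mod_homD[OF assms(1)] mod_homD[OF assms(2)]
  by (intro mod_homI) (auto simp: free_mod_simps join_def fun_eq_iff PiE_iff)

lemma join_carrier [simp]:
  "u \<in> carrier (free p) \<Longrightarrow> w \<in> carrier (free q) \<Longrightarrow> join p q u w \<in> carrier (free (p + q))"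
  by (auto simp: free_mod_simps join_def PiE_iff)

lemma fst_join [simp]: "u \<in> carrier (free p) \<Longrightarrow> fst_part p q (join p q u w) = u"
  by (auto simp: free_mod_simps join_def fst_part_def fun_eq_iff PiE_iff extensional_def)

lemma snd_join [simp]: "w \<in> carrier (free q) \<Longrightarrow> snd_part p q (join p q u w) = w"
  by (auto simp: free_mod_simps join_def snd_part_def fun_eq_iff PiE_iff extensional_def)

lemma join_parts: "v \<in> carrier (free (p + q)) \<Longrightarrow> join p q (fst_part p q v) (snd_part p q v) = v"
  by (auto simp: free_mod_simps join_def fst_part_def snd_part_def fun_eq_iff PiE_iff extensional_def)

text \<open>The universal property of the quotient by a kernel, with the quotient given as a
  surjection instead of by cosets. Any choice of preimages works because \<open>f\<close> is
  constant on the fibres of \<open>p\<close>.\<close>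

lemma hom_factor:
  assumes p: "lin A C p" "p ` carrier A = carrier C" and f: "lin A B f"
    and m: "module R A" "module R B" "module R C"
    and z: "\<And>x. x \<in> carrier A \<Longrightarrow> p x = \<zero>\<^bsub>C\<^esub> \<Longrightarrow> f x = \<zero>\<^bsub>B\<^esub>"
  obtains h where "lin C B h" "\<And>x. x \<in> carrier A \<Longrightarrow> h (p x) = f x"
proof -
  define s where "s = inv_into (carrier A) p"
  have s: "s y \<in> carrier A" "p (s y) = y" if "y \<in> carrier C" for y
    using that p(2) by (auto simp: s_def inv_into_into f_inv_into_f)
  have *: "f x = f y" if "x \<in> carrier A" "y \<in> carrier A" "p x = p y" for x y
  proof -
    have "p (x \<oplus>\<^bsub>A\<^esub> (\<ominus>\<^bsub>A\<^esub> y)) = \<zero>\<^bsub>C\<^esub>"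
      using that hom_diff[OF p(1) m(1,3) that(1,2)] mod_homD(1)[OF p(1)] m by simp
    then have "f x \<oplus>\<^bsub>B\<^esub> (\<ominus>\<^bsub>B\<^esub> f y) = \<zero>\<^bsub>B\<^esub>"
      using z[of "x \<oplus>\<^bsub>A\<^esub> (\<ominus>\<^bsub>A\<^esub> y)"] that hom_diff[OF f m(1,2) that(1,2)] m by simp
    then show ?thesis using mcancel[OF m(2)] mod_homD(1)[OF f] that by blast
  qed
  have hp: "f (s (p x)) = f x" if "x \<in> carrier A" for x
    using that s mod_homD(1)[OF p(1)] by (intro *) auto
  have "lin C B (\<lambda>y. f (s y))"
  proof (rule mod_homI)
    fix x y assume xy: "x \<in> carrier C" "y \<in> carrier C"
    show "f (s x) \<in> carrier B" using mod_homD(1)[OF f] s xy by simp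
    have "f (s (x \<oplus>\<^bsub>C\<^esub> y)) = f (s (p (s x \<oplus>\<^bsub>A\<^esub> s y)))"
      using mod_homD(2)[OF p(1)] s xy by simp
    also have "\<dots> = f (s x) \<oplus>\<^bsub>B\<^esub> f (s y)"
      using hp s xy m mod_homD(2)[OF f] by simp
    finally show "f (s (x \<oplus>\<^bsub>C\<^esub> y)) = f (s x) \<oplus>\<^bsub>B\<^esub> f (s y)" .
    fix a assume a: "a \<in> carrier R"
    have "f (s (a \<odot>\<^bsub>C\<^esub> x)) = f (s (p (a \<odot>\<^bsub>A\<^esub> s x)))"
      using mod_homD(3)[OF p(1)] s xy a by simp
    also have "\<dots> = a \<odot>\<^bsub>B\<^esub> f (s x)"
      using hp s xy m a mod_homD(3)[OF f] by simp
    finally show "f (s (a \<odot>\<^bsub>C\<^esub> x)) = a \<odot>\<^bsub>B\<^esub> f (s x)" .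
  qed
  with hp show ?thesis using that by blast
qed

lemma fin_gen_iff_free_cover:
  assumes "module R M"
  shows "fin_gen R M \<longleftrightarrow> (\<exists>n e. free_cover R M n e)"
proof
  assume "fin_gen R M"
  then obtain n g where g: "gen_by R M n g" by (auto simp: fin_gen_def)
  then have gc: "\<And>i. i < n \<Longrightarrow> g i \<in> carrier M" by (auto simp: gen_by_def)
  interpret M: module R M by fact
  define e where "e = (\<lambda>v. finsum M (\<lambda>i. v i \<odot>\<^bsub>M\<^esub> g i) {..<n})"
  have h: "lin (free n) M e" using free_hom(1)[OF assms gc] by (simp add: e_def)
  have "x \<in> e ` carrier (free n)" if x: "x \<in> carrier M" for x
  proof -
    obtain c where c: "c \<in> {..<n} \<rightarrow> carrier R" "x = finsum M (\<lambda>i. c i \<odot>\<^bsub>M\<^esub> g i) {..<n}"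
      using g x by (auto simp: gen_by_def)
    have "e (restrict c {..<n}) = x"
      using c gc assms by (auto simp: e_def intro!: M.finsum_cong')
    moreover have "restrict c {..<n} \<in> carrier (free n)" using c by (auto simp: free_mod_simps)
    ultimately show ?thesis by blast
  qed
  then show "\<exists>n e. free_cover R M n e" using h mod_homD(1)[OF h] by (auto simp: free_cover_def)
next
  assume "\<exists>n e. free_cover R M n e"
  then obtain n e where e: "lin (free n) M e" "e ` carrier (free n) = carrier M"
    by (auto simp: free_cover_def)
  have "gen_by R M n (\<lambda>i. e (unit_vec R n i))"
    unfolding gen_by_def
  proof (intro conjI ballI)
    show "(\<lambda>i. e (unit_vec R n i)) \<in> {..<n} \<rightarrow> carrier M" using mod_homD(1)[OF e(1)] by simp
    fix x assume "x \<in> carrier M"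
    then obtain v where v: "v \<in> carrier (free n)" "x = e v" using e(2) by auto
    have c: "v i \<in> carrier R" if "i < n" for i using v that by (auto simp: free_mod_simps)
    interpret M: module R M by fact
    have "x = finsum M (\<lambda>i. e (v i \<odot>\<^bsub>free n\<^esub> unit_vec R n i)) {..<n}"
      using c assms by (subst v(2), subst free_expand[OF v(1)], subst hom_finsum[OF e(1)]) auto
    also have "\<dots> = finsum M (\<lambda>i. v i \<odot>\<^bsub>M\<^esub> e (unit_vec R n i)) {..<n}"
      using c mod_homD[OF e(1)] assms by (intro M.finsum_cong') auto
    finally show "\<exists>c\<in>{..<n} \<rightarrow> carrier R. x = finsum M (\<lambda>i. c i \<odot>\<^bsub>M\<^esub> e (unit_vec R n i)) {..<n}"
      using c by (intro bexI[of _ v]) auto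
  qed
  then show "fin_gen R M" by (auto simp: fin_gen_def)
qed

lemma free_coverE:
  assumes "fin_gen R M" "module R M"
  obtains n e where "free_cover R M n e" "lin (free n) M e" "e ` carrier (free n) = carrier M"
  using assms fin_gen_iff_free_cover free_cover_def by metis

section \<open>Submodules of free modules are finitely generated\<close>

lemma ideal_intro:
  assumes "I \<subseteq> carrier R" "\<zero> \<in> I" "\<And>a b. a \<in> I \<Longrightarrow> b \<in> I \<Longrightarrow> a \<oplus> b \<in> I"
    and m: "\<And>a x. a \<in> I \<Longrightarrow> x \<in> carrier R \<Longrightarrow> x \<otimes> a \<in> I"
  shows "ideal I R"
proof (rule idealI)
  show "ring R" by (rule ring_axioms)
  have "\<ominus> a \<in> I" if "a \<in> I" for a
    using m[OF that, of "\<ominus> \<one>"] that assms(1) by (auto simp: l_minus)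
  then show "subgroup I (add_monoid R)"
    using assms by (intro add.subgroupI) (auto simp: a_inv_def)
  fix a x assume "a \<in> I" "x \<in> carrier R"
  then show "x \<otimes> a \<in> I" "a \<otimes> x \<in> I" using m assms(1) m_comm[of a x] by auto
qed

lemma module_sub:
  assumes "module R M" "S \<subseteq> carrier M" "\<zero>\<^bsub>M\<^esub> \<in> S"
    and "\<And>v w. v \<in> S \<Longrightarrow> w \<in> S \<Longrightarrow> v \<oplus>\<^bsub>M\<^esub> w \<in> S"
    and "\<And>a v. a \<in> carrier R \<Longrightarrow> v \<in> S \<Longrightarrow> a \<odot>\<^bsub>M\<^esub> v \<in> S"
  shows "module R (M\<lparr>carrier := S\<rparr>)"
  using assms(3-5) subsetD[OF assms(2)]
  by (intro modI) (auto simp: madd_assoc[OF assms(1)] madd_comm[OF assms(1)] madd_lcomm[OF assms(1)]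
      msmult_add[OF assms(1)] madd_smult[OF assms(1)] msmult_smult[OF assms(1)] assms(1)
      m0add[OF assms(1)] mone[OF assms(1)] mnull[OF assms(1)])

text \<open>Induction on the rank. The last coordinates of the elements of S form an ideal; lifts to
  S of finitely many generators account for the last coordinate, and what remains after subtracting
  a combination of the lifts lies in rank n. The conclusion is phrased as a map from a free module
  because the next term of a free resolution is such a map.\<close>

lemma submodule_free_fg:
  assumes "S \<subseteq> carrier (free n)" "\<zero>\<^bsub>free n\<^esub> \<in> S"
    and "\<And>v w. v \<in> S \<Longrightarrow> w \<in> S \<Longrightarrow> v \<oplus>\<^bsub>free n\<^esub> w \<in> S"
    and "\<And>a v. a \<in> carrier R \<Longrightarrow> v \<in> S \<Longrightarrow> a \<odot>\<^bsub>free n\<^esub> v \<in> S"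
  shows "\<exists>m h. lin (free m) (free n) h \<and> h ` carrier (free m) = S"
  using assms
proof (induct n arbitrary: S)
  case 0
  then have "S = carrier (free 0)" by (auto simp: free_mod_simps)
  then show ?case using mod_hom_id by (intro exI[of _ 0] exI[of _ "\<lambda>x. x"]) auto
next
  case (Suc n)
  let ?F = "free (Suc n)"
  have SF: "v \<in> S \<Longrightarrow> v \<in> carrier ?F" for v using Suc.prems(1) by auto
  define I where "I = (\<lambda>v. v n) ` S"
  have cn: "v \<in> carrier ?F \<Longrightarrow> v n \<in> carrier R" for v by (auto simp: free_mod_simps)
  have "ideal I R"
  proof (rule ideal_intro)
    show "I \<subseteq> carrier R" using SF cn by (auto simp: I_def)
    show "\<zero> \<in> I" unfolding I_def using Suc.prems(2) by (intro image_eqI) (auto simp: free_mod_simps)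
    fix a assume "a \<in> I"
    then obtain v where v: "v \<in> S" "a = v n" by (auto simp: I_def)
    { fix b assume "b \<in> I"
      then obtain w where w: "w \<in> S" "b = w n" by (auto simp: I_def)
      show "a \<oplus> b \<in> I" unfolding I_def
        using v w by (intro image_eqI[OF _ Suc.prems(3)[OF v(1) w(1)]]) (auto simp: free_mod_simps) }
    fix x assume "x \<in> carrier R"
    then show "x \<otimes> a \<in> I" unfolding I_def
      using v by (intro image_eqI[OF _ Suc.prems(4)[OF _ v(1)]]) (auto simp: free_mod_simps)
  qed
  then obtain A where A: "A \<subseteq> carrier R" "finite A" "I = Idl A" using finetely_gen by blast
  obtain as where as: "set as = A" using finite_list[OF A(2)] by blast
  have "A \<subseteq> I" using genideal_self[OF A(1)] A(3) by simp
  then have "\<forall>i<length as. \<exists>v. v \<in> S \<and> v n = as ! i"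
    using nth_mem[of _ as] unfolding as I_def by (fastforce simp: subset_iff image_iff)
  then obtain g where g: "\<And>i. i < length as \<Longrightarrow> g i \<in> S" "\<And>i. i < length as \<Longrightarrow> g i n = as ! i" by metis
  let ?S = "?F\<lparr>carrier := S\<rparr>"
  have mS: "module R ?S" using Suc.prems by (intro module_sub) auto
  obtain h where h: "lin (free (length as)) ?S h"
      "\<And>i. i < length as \<Longrightarrow> h (unit_vec R (length as) i) = g i"
    using free_hom_ex[OF mS, of "length as" g] g(1) by auto
  have hS: "h c \<in> S" if "c \<in> carrier (free (length as))" for c
    using mod_homD(1)[OF h(1) that] by simp
  have h': "lin (free (length as)) ?F h"
    using mod_homD[OF h(1)] SF by (intro mod_homI) auto
  \<comment> \<open>The ideal of last coordinates reached by \<open>h\<close>. It contains the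
    generators of I, hence all of I, so the last coordinate of any element of S can be matched by
    some \<open>h c\<close>.\<close>
  define J where "J = (\<lambda>c. h c n) ` carrier (free (length as))"
  have "ideal J R"
  proof (rule ideal_intro)
    show "J \<subseteq> carrier R" using mod_homD(1)[OF h'] cn by (auto simp: J_def)
    have "h \<zero>\<^bsub>free (length as)\<^esub> n = \<zero>" using hom_zero[OF h'] by (simp add: free_mod_simps)
    then show "\<zero> \<in> J" unfolding J_def by (intro image_eqI[of _ _ "\<zero>\<^bsub>free (length as)\<^esub>"]) auto
    fix a assume "a \<in> J"
    then obtain v where v: "v \<in> carrier (free (length as))" "a = h v n" by (auto simp: J_def)
    { fix b assume "b \<in> J"
      then obtain w where w: "w \<in> carrier (free (length as))" "b = h w n" by (auto simp: J_def)
      have "h (v \<oplus>\<^bsub>free (length as)\<^esub> w) n = a \<oplus> b"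
        using v w mod_homD(2)[OF h' v(1) w(1)] by (simp add: free_mod_simps)
      then show "a \<oplus> b \<in> J" unfolding J_def
        using v w by (intro image_eqI[of _ _ "v \<oplus>\<^bsub>free (length as)\<^esub> w"]) auto }
    fix x assume x: "x \<in> carrier R"
    have "h (x \<odot>\<^bsub>free (length as)\<^esub> v) n = x \<otimes> a"
        using v x mod_homD(3)[OF h' x v(1)] by (simp add: free_mod_simps)
    then show "x \<otimes> a \<in> J" unfolding J_def
      using v x by (intro image_eqI[of _ _ "x \<odot>\<^bsub>free (length as)\<^esub> v"]) auto
  qed
  moreover have "A \<subseteq> J"
  proof
    fix a assume "a \<in> A"
    then obtain i where "i < length as" "a = as ! i" using as by (metis in_set_conv_nth)
    then show "a \<in> J" using g h unfolding J_def by (intro image_eqI[of _ _ "unit_vec R (length as) i"]) auto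
  qed
  ultimately have IJ: "I \<subseteq> J" using genideal_minimal A(3) by blast
  \<comment> \<open>The elements of S with last coordinate zero, viewed in rank n;
    \<open>?ext\<close> below puts the zero back.\<close>
  define S' where "S' = (\<lambda>v. fst_part n 1 v) ` {v \<in> S. v n = \<zero>}"
  have f1: "lin ?F (free n) (fst_part n 1)" using hom_fst_part[of n 1] by simp
  have z: "(v \<oplus>\<^bsub>?F\<^esub> w) n = v n \<oplus> w n" "(a \<odot>\<^bsub>?F\<^esub> v) n = a \<otimes> v n" "\<zero>\<^bsub>?F\<^esub> n = \<zero>" for a v w
    by (auto simp: free_mod_simps)
  have "\<exists>m k. lin (free m) (free n) k \<and> k ` carrier (free m) = S'"
  proof (rule Suc.hyps)
    show "S' \<subseteq> carrier (free n)" using mod_homD(1)[OF f1] SF by (auto simp: S'_def)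
    show "\<zero>\<^bsub>free n\<^esub> \<in> S'" unfolding S'_def
      using Suc.prems(2) z hom_zero[OF f1] by (intro image_eqI[of _ _ "\<zero>\<^bsub>?F\<^esub>"]) auto
  next
    fix v w assume "v \<in> S'" "w \<in> S'"
    then obtain v' w' where "v' \<in> S" "w' \<in> S" "v' n = \<zero>" "w' n = \<zero>" "v = fst_part n 1 v'" "w = fst_part n 1 w'"
      by (auto simp: S'_def)
    then show "v \<oplus>\<^bsub>free n\<^esub> w \<in> S'" unfolding S'_def
      using Suc.prems(3) z SF mod_homD(2)[OF f1] by (intro image_eqI[of _ _ "v' \<oplus>\<^bsub>?F\<^esub> w'"]) auto
  next
    fix a v assume a: "a \<in> carrier R" and "v \<in> S'"
    then obtain v' where "v' \<in> S" "v' n = \<zero>" "v = fst_part n 1 v'"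
      by (auto simp: S'_def)
    then show "a \<odot>\<^bsub>free n\<^esub> v \<in> S'" unfolding S'_def
      using Suc.prems(4) z SF a mod_homD(3)[OF f1] by (intro image_eqI[of _ _ "a \<odot>\<^bsub>?F\<^esub> v'"]) auto
  qed
  then obtain m k where k: "lin (free m) (free n) k" "k ` carrier (free m) = S'" by blast
  let ?ext = "\<lambda>w. join n 1 w \<zero>\<^bsub>free 1\<^esub>"
  have ext: "?ext (fst_part n 1 v) = v" if "v \<in> carrier ?F" "v n = \<zero>" for v
    using that by (auto simp: join_def fst_part_def free_mod_simps fun_eq_iff PiE_iff extensional_def less_Suc_eq)
  have h2: "lin (free m) ?F (\<lambda>v. ?ext (k v))"
    using hom_join[OF k(1) hom_const0[of "free 1"]] by simp
  have kS: "?ext (k v) \<in> S" if "v \<in> carrier (free m)" for v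
  proof -
    have "k v \<in> S'" using k(2) that by auto
    then show ?thesis using ext SF by (auto simp: S'_def)
  qed
  define l where "l = (\<lambda>v. ?ext (k (fst_part m (length as) v)) \<oplus>\<^bsub>?F\<^esub> h (snd_part m (length as) v))"
  have "lin (free (m + length as)) ?F l"
    unfolding l_def by (intro hom_add mod_hom_comp[OF hom_fst_part h2] mod_hom_comp[OF hom_snd_part h']) simp
  moreover have "l ` carrier (free (m + length as)) = S"
  proof
    show "l ` carrier (free (m + length as)) \<subseteq> S"
      using kS hS mod_homD(1)[OF hom_fst_part] mod_homD(1)[OF hom_snd_part] Suc.prems(3) by (auto simp: l_def)
    show "S \<subseteq> l ` carrier (free (m + length as))"
    proof
      fix v assume v: "v \<in> S"
      then have "v n \<in> J" using IJ by (auto simp: I_def)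
      then obtain c where c: "c \<in> carrier (free (length as))" "h c n = v n" by (auto simp: J_def)
      define u where "u = v \<oplus>\<^bsub>?F\<^esub> (\<ominus> \<one>) \<odot>\<^bsub>?F\<^esub> h c"
      have vc: "v \<in> carrier ?F" "h c \<in> carrier ?F" using SF v hS c by auto
      have "u \<in> S" using v hS c Suc.prems(3,4) by (auto simp: u_def)
      moreover have "u n = \<zero>" using z c cn vc by (simp add: u_def l_minus r_neg)
      ultimately have "fst_part n 1 u \<in> S'" "?ext (fst_part n 1 u) = u" using ext SF by (auto simp: S'_def)
      then obtain w where w: "w \<in> carrier (free m)" "?ext (k w) = u" using k(2) by force
      have "l (join m (length as) w c) = u \<oplus>\<^bsub>?F\<^esub> h c" using w c by (simp add: l_def)
      also have "\<dots> = v" using vc by (simp add: u_def mneg_smult madd_cancel)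
      finally show "v \<in> l ` carrier (free (m + length as))"
        using w c by (intro image_eqI[of _ _ "join m (length as) w c"]) auto
    qed
  qed
  ultimately show ?case by blast
qed

lemma kernel_free_fg:
  assumes "lin (free n) M e" "module R M"
  obtains m h where "lin (free m) (free n) h"
    "h ` carrier (free m) = {v \<in> carrier (free n). e v = \<zero>\<^bsub>M\<^esub>}"
proof -
  have "\<exists>m h. lin (free m) (free n) h \<and>
    h ` carrier (free m) = {v \<in> carrier (free n). e v = \<zero>\<^bsub>M\<^esub>}"
    using assms mod_homD[OF assms(1)] by (intro submodule_free_fg) auto
  with that show ?thesis by blast
qed

lemma fin_gen_quot:
  assumes "fin_gen R M" "module R M" "module R N" "lin M N f" "f ` carrier M = carrier N"
  shows "fin_gen R N"
proof -
  obtain n e where "free_cover R M n e" and e: "lin (free n) M e" "e ` carrier (free n) = carrier M"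
    by (rule free_coverE[OF assms(1,2)])
  then have "free_cover R N n (\<lambda>v. f (e v))"
    using mod_hom_comp[OF e(1) assms(4)] assms(5) by (auto simp: free_cover_def image_image[symmetric])
  then show ?thesis using fin_gen_iff_free_cover assms by blast
qed

text \<open>Pull N back to a free cover of M. The preimage is a submodule of a free module, hence an
  image of some free module, and the map from there lifts through the injection \<open>f\<close> to
  a cover of N.\<close>

lemma fin_gen_sub:
  assumes "fin_gen R M" "module R M" "module R N" "lin N M f" "inj_on f (carrier N)"
  shows "fin_gen R N"
proof -
  obtain n e where "free_cover R M n e" and e: "lin (free n) M e" "e ` carrier (free n) = carrier M"
    by (rule free_coverE[OF assms(1,2)])
  define S where "S = {v \<in> carrier (free n). e v \<in> f ` carrier N}"
  have "\<exists>m h. lin (free m) (free n) h \<and> h ` carrier (free m) = S"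
  proof (rule submodule_free_fg)
    show "S \<subseteq> carrier (free n)" by (auto simp: S_def)
    show "\<zero>\<^bsub>free n\<^esub> \<in> S"
      using hom_zero[OF e(1)] hom_zero[OF assms(4)] assms(2,3)
      by (auto simp: S_def intro!: image_eqI[of _ _ "\<zero>\<^bsub>N\<^esub>"])
  next
    fix v w assume "v \<in> S" "w \<in> S"
    then obtain x y where "x \<in> carrier N" "y \<in> carrier N" "e v = f x" "e w = f y"
      "v \<in> carrier (free n)" "w \<in> carrier (free n)" by (auto simp: S_def)
    then show "v \<oplus>\<^bsub>free n\<^esub> w \<in> S" unfolding S_def
      using mod_homD(2)[OF e(1)] mod_homD(2)[OF assms(4)] assms(3)
      by (auto intro!: image_eqI[of _ _ "x \<oplus>\<^bsub>N\<^esub> y"])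
  next
    fix a v assume a: "a \<in> carrier R" and "v \<in> S"
    then obtain x where "x \<in> carrier N" "e v = f x" "v \<in> carrier (free n)" by (auto simp: S_def)
    then show "a \<odot>\<^bsub>free n\<^esub> v \<in> S" unfolding S_def
      using mod_homD(3)[OF e(1)] mod_homD(3)[OF assms(4)] assms(3) a
      by (auto intro!: image_eqI[of _ _ "a \<odot>\<^bsub>N\<^esub> x"])
  qed
  then obtain m h where h: "lin (free m) (free n) h" "h ` carrier (free m) = S" by blast
  have hS: "\<And>v. v \<in> carrier (free m) \<Longrightarrow> e (h v) \<in> f ` carrier N" using h(2) by (auto simp: S_def)
  obtain k where k: "lin (free m) N k" "\<And>v. v \<in> carrier (free m) \<Longrightarrow> f (k v) = e (h v)"
    using free_lift[OF mod_hom_comp[OF h(1) e(1)] assms(4,2,3)] hS by auto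
  have "x \<in> k ` carrier (free m)" if x: "x \<in> carrier N" for x
  proof -
    have "f x \<in> carrier M" using mod_homD(1)[OF assms(4) x] .
    then obtain v where v: "v \<in> carrier (free n)" "e v = f x" using e(2) by force
    then have "v \<in> S" using x by (auto simp: S_def)
    then obtain u where u: "u \<in> carrier (free m)" "v = h u" using h(2) by auto
    then have "f (k u) = f x" using k(2) v by simp
    then have "k u = x" using inj_onD[OF assms(5)] mod_homD(1)[OF k(1)] u x by auto
    then show ?thesis using u by blast
  qed
  then have "free_cover R N m k" using k(1) mod_homD(1)[OF k(1)] by (auto simp: free_cover_def)
  then show ?thesis using fin_gen_iff_free_cover assms by blast
qed

lemma fin_gen_free [simp]: "fin_gen R (free n)"
  using fin_gen_iff_free_cover[of "free n"] mod_hom_id[of R "free n"] by (force simp: free_cover_def)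

lemma fin_gen_ker [simp]:
  assumes "lin (free n) M e" "module R M"
  shows "fin_gen R (ker n M e)"
  by (rule fin_gen_sub[OF fin_gen_free module_free module_ker[OF assms] hom_incl]) auto

lemma dual_val: "f \<in> carrier (dual M) \<Longrightarrow> x \<in> carrier M \<Longrightarrow> f x \<in> carrier R"
  using mod_homD(1)[OF dual_memD] by fastforce

text \<open>A functional is determined by its values on n generators of M, so the dual embeds in a
  free module of rank n.\<close>

lemma fin_gen_dual [simp]:
  assumes "fin_gen R M" "module R M"
  shows "fin_gen R (dual M)"
proof -
  obtain n e where "free_cover R M n e" and e: "lin (free n) M e" "e ` carrier (free n) = carrier M"
    by (rule free_coverE[OF assms(1,2)])
  have eu: "e (unit_vec R n i) \<in> carrier M" for i using mod_homD(1)[OF e(1)] by simp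
  show ?thesis
  proof (rule fin_gen_sub[OF fin_gen_free module_free module_dual[OF assms(2)]])
    show "lin (dual M) (free n) (\<lambda>f. \<lambda>i\<in>{..<n}. f (e (unit_vec R n i)))"
      using eu by (intro mod_homI) (auto simp: free_mod_simps dual_simps(3,4) fun_eq_iff intro: dual_val[OF _ eu])
    show "inj_on (\<lambda>f. \<lambda>i\<in>{..<n}. f (e (unit_vec R n i))) (carrier (dual M))"
    proof (rule inj_onI, rule dual_eqI)
      fix f g x assume f: "f \<in> carrier (dual M)" and g: "g \<in> carrier (dual M)"
        and eq: "(\<lambda>i\<in>{..<n}. f (e (unit_vec R n i))) = (\<lambda>i\<in>{..<n}. g (e (unit_vec R n i)))"
        and "x \<in> carrier M"
      then obtain v where v: "v \<in> carrier (free n)" "x = e v" using e(2) by auto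
      have "f (e (unit_vec R n i)) = g (e (unit_vec R n i))" if "i < n" for i
        using fun_cong[OF eq, of i] that by simp
      then show "f x = g x"
        using free_hom_eqI[OF mod_hom_comp[OF e(1) dual_memD[OF f]] mod_hom_comp[OF e(1) dual_memD[OF g]] _ _ v(1)] v(2)
        by simp
    qed
  qed
qed

end

section \<open>Free resolutions and Ext\<close>

lemma exact_atD:
  assumes "exact_at A B C f g"
  shows "y \<in> carrier B \<Longrightarrow> g y = \<zero>\<^bsub>C\<^esub> \<Longrightarrow> \<exists>x\<in>carrier A. y = f x"
    and "x \<in> carrier A \<Longrightarrow> f x \<in> carrier B"
    and "x \<in> carrier A \<Longrightarrow> g (f x) = \<zero>\<^bsub>C\<^esub>"
  using assms unfolding exact_at_def by blast+

context noeth_cring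
begin

text \<open>A resolution of the kernel of a cover, moved up one place, resolves the covered module,
  with the old augmentation as first differential. Together with the converse
  \<open>free_res_unglue\<close> this is the source of dimension shifting.\<close>

lemma free_res_glue:
  assumes "free_cover R M n e" and "free_res R (ker n M e) ns d \<eta>"
  shows "free_res R M (case_nat n ns) (\<lambda>j. if j = 1 then \<eta> else d (j - 1)) e"
  unfolding free_res_def
proof (intro conjI allI impI)
  note r = assms(2)[unfolded free_res_def hom_ker_iff]
  show "lin (free (case_nat n ns 0)) M e" "e ` carrier (free (case_nat n ns 0)) = carrier M"
    using assms(1) by (auto simp: free_cover_def)
  show "exact_at (free (case_nat n ns 1)) (free (case_nat n ns 0)) M (if 1 = (1::nat) then \<eta> else d (1 - 1)) e"
    using r by (simp add: exact_at_def ker_mod_simps)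
  fix j :: nat assume j: "1 \<le> j"
  show "lin (free (case_nat n ns j)) (free (case_nat n ns (j - 1))) (if j = 1 then \<eta> else d (j - 1))"
    using r j by (cases j; cases "j - 1") auto
  obtain k where k: "j = Suc k" using j by (cases j) auto
  show "exact_at (free (case_nat n ns (j + 1))) (free (case_nat n ns j)) (free (case_nat n ns (j - 1)))
    (if j + 1 = 1 then \<eta> else d (j + 1 - 1)) (if j = 1 then \<eta> else d (j - 1))"
  proof (cases k)
    case 0
    then show ?thesis using r k by (simp add: exact_at_def ker_mod_simps)
  next
    case (Suc l)
    have "\<And>j. 1 \<le> j \<Longrightarrow> exact_at (free (ns (j + 1))) (free (ns j)) (free (ns (j - 1))) (d (j + 1)) (d j)"
      using r by blast
    from this[of "Suc l"] show ?thesis using k Suc by simp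
  qed
qed

lemma free_res_unglue:
  assumes r: "free_res R M ns d e"
  shows "free_cover R M (ns 0) e" "free_res R (ker (ns 0) M e) (\<lambda>j. ns (Suc j)) (\<lambda>j. d (Suc j)) (d 1)"
proof -
  show "free_cover R M (ns 0) e" using r by (auto simp: free_res_def free_cover_def)
  have ex: "exact_at (free (ns 1)) (free (ns 0)) M (d 1) e" using r by (simp add: free_res_def)
  then have im: "d 1 ` carrier (free (ns 1)) = carrier (ker (ns 0) M e)"
    by (auto simp: exact_at_def ker_mod_simps)
  have h: "\<And>j. 1 \<le> j \<Longrightarrow> lin (free (ns j)) (free (ns (j - 1))) (d j)"
    and x: "\<And>j. 1 \<le> j \<Longrightarrow> exact_at (free (ns (j + 1))) (free (ns j)) (free (ns (j - 1))) (d (j + 1)) (d j)"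
    using r by (auto simp: free_res_def)
  show "free_res R (ker (ns 0) M e) (\<lambda>j. ns (Suc j)) (\<lambda>j. d (Suc j)) (d 1)"
    unfolding free_res_def hom_ker_iff
  proof (intro conjI allI impI)
    show "lin (free (ns (Suc 0))) (free (ns 0)) (d 1)" using h[of 1] by simp
    show "\<forall>x\<in>carrier (free (ns (Suc 0))). e (d 1 x) = \<zero>\<^bsub>M\<^esub>"
      using im by (auto simp: ker_mod_simps)
    show "d 1 ` carrier (free (ns (Suc 0))) = carrier (ker (ns 0) M e)" using im by simp
    show "exact_at (free (ns (Suc 1))) (free (ns (Suc 0))) (ker (ns 0) M e) (d (Suc 1)) (d 1)"
      using x[of 1] by (simp add: exact_at_def ker_mod_simps)
    fix j :: nat assume j: "1 \<le> j"
    show "lin (free (ns (Suc j))) (free (ns (Suc (j - 1)))) (d (Suc j))"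
      using h[of "Suc j"] j by simp
    show "exact_at (free (ns (Suc (j + 1)))) (free (ns (Suc j))) (free (ns (Suc (j - 1))))
      (d (Suc (j + 1))) (d (Suc j))"
      using x[of "Suc j"] j by simp
  qed
qed

lemma free_res_exists:
  assumes M: "fin_gen R M" "module R M"
  obtains ns d e where "free_res R M ns d e"
proof -
  obtain n e where "free_cover R M n e" and e: "lin (free n) M e" "e ` carrier (free n) = carrier M"
    by (rule free_coverE[OF M])
  \<comment> \<open>A state (a, b, f) is a differential from rank a to rank b. \<open>P\<close>
    makes the first one map onto the kernel of the augmentation, \<open>Q\<close> makes each later
    one map onto the kernel of its predecessor.\<close>
  define P where "P = (\<lambda>(j::nat) (a, b, f). lin (free a) (free b) f \<and>
    (j = 0 \<longrightarrow> b = n \<and> f ` carrier (free a) = {v \<in> carrier (free n). e v = \<zero>\<^bsub>M\<^esub>}))"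
  define Q where "Q = (\<lambda>(j::nat) (a, b, f) (a', b', f'). b' = a \<and>
    f' ` carrier (free a') = {v \<in> carrier (free a). f v = \<zero>\<^bsub>free b\<^esub>})"
  have "\<exists>t. \<forall>j. P j (t j) \<and> Q j (t j) (t (Suc j))"
  proof (rule dependent_nat_choice)
    obtain m h where "lin (free m) (free n) h"
      "h ` carrier (free m) = {v \<in> carrier (free n). e v = \<zero>\<^bsub>M\<^esub>}"
      by (rule kernel_free_fg[OF e(1) M(2)])
    then show "\<exists>x. P 0 x" by (intro exI[of _ "(m, n, h)"]) (simp add: P_def)
  next
    fix x j assume Px: "P j x"
    obtain a b f where x: "x = (a, b, f)" by (cases x) auto
    obtain m h where "lin (free m) (free a) h"
      "h ` carrier (free m) = {v \<in> carrier (free a). f v = \<zero>\<^bsub>free b\<^esub>}"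
      using Px x by (auto simp: P_def intro: kernel_free_fg[of a "free b" f])
    then show "\<exists>y. P (Suc j) y \<and> Q j x y" using x by (intro exI[of _ "(m, a, h)"]) (simp add: P_def Q_def)
  qed
  then obtain t where t: "\<And>j. P j (t j)" "\<And>j. Q j (t j) (t (Suc j))" by blast
  define ns where "ns = case_nat n (\<lambda>j. fst (t j))"
  define d where "d = (\<lambda>j. snd (snd (t (j - 1))))"
  have s: "fst (snd (t j)) = ns j" for j
    using t(1)[of 0] t(2)[of "j - 1"]
    by (cases j) (auto simp: P_def Q_def ns_def split: prod.splits)
  have tt: "t j = (ns (Suc j), ns j, d (Suc j))" for j
    using s[of j] by (simp add: ns_def d_def prod_eq_iff)
  have "free_res R M ns d e"
    unfolding free_res_def
  proof (intro conjI allI impI)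
    show "lin (free (ns 0)) M e" "e ` carrier (free (ns 0)) = carrier M" using e by (simp_all add: ns_def)
    show "exact_at (free (ns 1)) (free (ns 0)) M (d 1) e"
      using t(1)[of 0] unfolding tt by (auto simp: P_def exact_at_def)
    fix j :: nat assume "1 \<le> j"
    then obtain k where k: "j = Suc k" by (cases j) auto
    show "lin (free (ns j)) (free (ns (j - 1))) (d j)"
      using t(1)[of k] unfolding tt k by (auto simp: P_def)
    show "exact_at (free (ns (j + 1))) (free (ns j)) (free (ns (j - 1))) (d (j + 1)) (d j)"
      using t(2)[of k] unfolding tt k by (auto simp: Q_def exact_at_def)
  qed
  with that show ?thesis by blast
qed

text \<open>A cocycle of degree 0 vanishes on the kernel of the augmentation and hence descends to
  M: Ext^0(M,R) is Hom(M,R).\<close>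

lemma ext_nonzero_0:
  assumes M: "fin_gen R M" "module R M"
  shows "ext M 0 \<longleftrightarrow> (\<exists>h. lin M (self) h \<and> (\<exists>x\<in>carrier M. h x \<noteq> \<zero>))"
proof
  assume "ext M 0"
  then obtain ns d e f where r: "free_res R M ns d e" and f: "f \<in> carrier (dual (free (ns 0)))"
     "\<And>v. v \<in> carrier (free (ns 1)) \<Longrightarrow> f (d 1 v) = \<zero>" "f \<noteq> \<zero>\<^bsub>dual (free (ns 0))\<^esub>"
    by (auto simp: ext_nonzero_def)
  have e: "lin (free (ns 0)) M e" "e ` carrier (free (ns 0)) = carrier M"
    and ex: "exact_at (free (ns 1)) (free (ns 0)) M (d 1) e" using r by (auto simp: free_res_def)
  have "f x = \<zero>" if "x \<in> carrier (free (ns 0))" "e x = \<zero>\<^bsub>M\<^esub>" for x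
    using exact_atD(1)[OF ex, OF that] f(2) by auto
  then obtain h where h: "lin M (self) h" "\<And>x. x \<in> carrier (free (ns 0)) \<Longrightarrow> h (e x) = f x"
    using hom_factor[OF e dual_memD[OF f(1)]] M by auto
  obtain v where v: "v \<in> carrier (free (ns 0))" "f v \<noteq> \<zero>"
    using f(3) dual_eqI[OF f(1) mzero] by (auto simp: dual_simps(2))
  have "e v \<in> carrier M" "h (e v) \<noteq> \<zero>" using mod_homD(1)[OF e(1) v(1)] h(2)[OF v(1)] v(2) by auto
  with h(1) show "\<exists>h. lin M (self) h \<and> (\<exists>x\<in>carrier M. h x \<noteq> \<zero>)" by blast
next
  assume "\<exists>h. lin M (self) h \<and> (\<exists>x\<in>carrier M. h x \<noteq> \<zero>)"
  then obtain h x where h: "lin M (self) h" "x \<in> carrier M" "h x \<noteq> \<zero>" by blast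
  obtain ns d e where r: "free_res R M ns d e" by (rule free_res_exists[OF M])
  have e: "lin (free (ns 0)) M e" "e ` carrier (free (ns 0)) = carrier M"
    and d: "lin (free (ns 1)) (free (ns 0)) (d 1)"
    and ex: "exact_at (free (ns 1)) (free (ns 0)) M (d 1) e" using r by (force simp: free_res_def)+
  define f where "f = restrict (\<lambda>v. h (e v)) (carrier (free (ns 0)))"
  have "f \<in> carrier (dual (free (ns 0)))"
    unfolding f_def by (intro dual_memI mod_hom_comp[OF e(1) h(1)] module_free)
  moreover have "f (d 1 v) = \<zero>" if "v \<in> carrier (free (ns 1))" for v
  proof -
    have "d 1 v \<in> carrier (free (ns 0))" "e (d 1 v) = \<zero>\<^bsub>M\<^esub>"
      using that ex by (auto simp: exact_at_def)
    then show ?thesis using hom_zero[OF h(1)] M by (simp add: f_def)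
  qed
  moreover have "f \<noteq> \<zero>\<^bsub>dual (free (ns 0))\<^esub>"
  proof
    obtain v where v: "v \<in> carrier (free (ns 0))" "x = e v" using e(2) h(2) by auto
    assume "f = \<zero>\<^bsub>dual (free (ns 0))\<^esub>"
    then have "f v = \<zero>" using v by (simp add: dual_simps(2))
    then show False using v h(3) by (simp add: f_def)
  qed
  ultimately show "ext M 0" unfolding ext_nonzero_def using r
    by (intro exI[of _ ns] exI[of _ d] exI[of _ e] conjI bexI[of _ f]) auto
qed

text \<open>A cocycle of degree 1 amounts to a functional on the kernel of the cover, and it is a
  coboundary exactly when this functional extends to the free module. The choice of the cover is
  removed later, in \<open>ext_nonzero_1_iff\<close>.\<close>

lemma ext_nonzero_1:
  assumes M: "module R M"
  shows "ext M (Suc 0) \<longleftrightarrow>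
    (\<exists>n e. free_cover R M n e \<and> \<not> homs_extend R (ker n M e) (free n) (\<lambda>v. v))"
proof
  assume "ext M (Suc 0)"
  then obtain ns d e f where r: "free_res R M ns d e" and f: "f \<in> carrier (dual (free (ns 1)))"
     "\<And>v. v \<in> carrier (free (ns 2)) \<Longrightarrow> f (d 2 v) = \<zero>"
     and ng: "\<not> (\<exists>g\<in>carrier (dual (free (ns 0))). \<forall>v\<in>carrier (free (ns 1)). f v = g (d 1 v))"
    by (auto simp: ext_nonzero_def numeral_2_eq_2)
  note u = free_res_unglue[OF r]
  let ?K = "ker (ns 0) M e"
  have mK: "module R ?K" using u(1) M by (auto simp: free_cover_def)
  have e: "lin (free (ns 1)) ?K (d 1)" "d 1 ` carrier (free (ns 1)) = carrier ?K"
    and ex: "exact_at (free (ns 2)) (free (ns 1)) ?K (d 2) (d 1)"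
    using u(2) by (auto simp: free_res_def numeral_2_eq_2)
  have "f x = \<zero>" if "x \<in> carrier (free (ns 1))" "d 1 x = \<zero>\<^bsub>?K\<^esub>" for x
    using exact_atD(1)[OF ex, OF that] f(2) by auto
  then obtain h where h: "lin ?K (self) h" "\<And>x. x \<in> carrier (free (ns 1)) \<Longrightarrow> h (d 1 x) = f x"
    using hom_factor[OF e dual_memD[OF f(1)]] mK by auto
  have "\<not> homs_extend R ?K (free (ns 0)) (\<lambda>v. v)"
  proof
    assume "homs_extend R ?K (free (ns 0)) (\<lambda>v. v)"
    then obtain g where g: "lin (free (ns 0)) (self) g" "\<And>x. x \<in> carrier ?K \<Longrightarrow> g x = h x"
      using h(1) unfolding homs_extend_def by blast
    have "f v = restrict g (carrier (free (ns 0))) (d 1 v)" if v: "v \<in> carrier (free (ns 1))" for v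
      using mod_homD(1)[OF e(1) v] h(2)[OF v] g(2) by (auto simp: ker_mod_simps)
    then show False using ng dual_memI[OF g(1)] by auto
  qed
  then show "\<exists>n e. free_cover R M n e \<and> \<not> homs_extend R (ker n M e) (free n) (\<lambda>v. v)"
    using u(1) by blast
next
  assume "\<exists>n e. free_cover R M n e \<and> \<not> homs_extend R (ker n M e) (free n) (\<lambda>v. v)"
  then obtain n e h where c: "free_cover R M n e" and h: "lin (ker n M e) (self) h"
    and nh: "\<not> (\<exists>g. lin (free n) (self) g \<and> (\<forall>x\<in>carrier (ker n M e). g x = h x))"
    by (auto simp: homs_extend_def)
  let ?K = "ker n M e"
  have K: "fin_gen R ?K" "module R ?K" using c M by (auto simp: free_cover_def)
  obtain ns d \<eta> where r: "free_res R ?K ns d \<eta>" by (rule free_res_exists[OF K])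
  note rr = free_res_glue[OF c r]
  have e: "lin (free (ns 0)) ?K \<eta>" "\<eta> ` carrier (free (ns 0)) = carrier ?K"
    and ex: "exact_at (free (ns 1)) (free (ns 0)) ?K (d 1) \<eta>"
    using r by (auto simp: free_res_def)
  define f where "f = restrict (\<lambda>v. h (\<eta> v)) (carrier (free (ns 0)))"
  have "f \<in> carrier (dual (free (ns 0)))"
    unfolding f_def by (intro dual_memI mod_hom_comp[OF e(1) h(1)] module_free)
  moreover have "f (d 1 v) = \<zero>" if "v \<in> carrier (free (ns 1))" for v
  proof -
    have "d 1 v \<in> carrier (free (ns 0))" "\<eta> (d 1 v) = \<zero>\<^bsub>?K\<^esub>"
      using that ex by (auto simp: exact_at_def)
    then show ?thesis using hom_zero[OF h(1)] K by (simp add: f_def)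
  qed
  moreover have "\<not> (\<exists>g\<in>carrier (dual (free n)). \<forall>v\<in>carrier (free (ns 0)). f v = g (\<eta> v))"
  proof
    assume "\<exists>g\<in>carrier (dual (free n)). \<forall>v\<in>carrier (free (ns 0)). f v = g (\<eta> v)"
    then obtain g where g: "g \<in> carrier (dual (free n))"
      "\<And>v. v \<in> carrier (free (ns 0)) \<Longrightarrow> h (\<eta> v) = g (\<eta> v)" by (auto simp: f_def)
    have "g x = h x" if x: "x \<in> carrier ?K" for x
    proof -
      obtain v where "v \<in> carrier (free (ns 0))" "x = \<eta> v" using x e(2) by (metis imageE)
      then show ?thesis using g(2) by simp
    qed
    then show False using nh dual_memD[OF g(1)] by blast
  qed
  ultimately show "ext M (Suc 0)"
    unfolding ext_nonzero_def
    by (intro exI[of _ "case_nat n ns"] exI[of _ "\<lambda>j. if j = 1 then \<eta> else d (j - 1)"] exI[of _ e]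
        conjI[OF rr] bexI[of _ f]) auto
qed

text \<open>Cutting off or prepending the first free module moves cocycles and coboundaries by one
  place. The shift starts in degree 1, because in degree 0 there are no coboundaries to divide
  by.\<close>

lemma ext_nonzero_Suc:
  "ext M (Suc (Suc i)) \<longleftrightarrow> (\<exists>n e. free_cover R M n e \<and> ext (ker n M e) (Suc i))"
proof
  assume "ext M (Suc (Suc i))"
  then obtain ns d e where r: "free_res R M ns d e" and
    x: "\<exists>f\<in>carrier (dual (free (ns (Suc (Suc i))))).
          (\<forall>v\<in>carrier (free (ns (Suc (Suc i) + 1))). f (d (Suc (Suc i) + 1) v) = \<zero>\<^bsub>R\<^esub>) \<and>
          \<not> (\<exists>g\<in>carrier (dual (free (ns (Suc (Suc i) - 1)))).
                     \<forall>v\<in>carrier (free (ns (Suc (Suc i)))). f v = g (d (Suc (Suc i)) v))"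
    unfolding ext_nonzero_def by auto
  have "ext (ker (ns 0) M e) (Suc i)"
    unfolding ext_nonzero_def
    by (rule exI[of _ "\<lambda>j. ns (Suc j)"], rule exI[of _ "\<lambda>j. d (Suc j)"], rule exI[of _ "d 1"],
        rule conjI[OF free_res_unglue(2)[OF r]]) (use x in simp)
  then show "\<exists>n e. free_cover R M n e \<and> ext (ker n M e) (Suc i)"
    using free_res_unglue(1)[OF r] by blast
next
  assume "\<exists>n e. free_cover R M n e \<and> ext (ker n M e) (Suc i)"
  then obtain n e where c: "free_cover R M n e" and "ext (ker n M e) (Suc i)" by blast
  then obtain ns d \<eta> where r: "free_res R (ker n M e) ns d \<eta>" and
    x: "\<exists>f\<in>carrier (dual (free (ns (Suc i)))).
          (\<forall>v\<in>carrier (free (ns (Suc i + 1))). f (d (Suc i + 1) v) = \<zero>\<^bsub>R\<^esub>) \<and>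
          \<not> (\<exists>g\<in>carrier (dual (free (ns (Suc i - 1)))).
                     \<forall>v\<in>carrier (free (ns (Suc i))). f v = g (d (Suc i) v))"
    unfolding ext_nonzero_def by auto
  show "ext M (Suc (Suc i))"
    unfolding ext_nonzero_def
    by (rule exI[of _ "case_nat n ns"], rule exI[of _ "\<lambda>j. if j = 1 then \<eta> else d (j - 1)"], rule exI[of _ e],
        rule conjI[OF free_res_glue[OF c r]]) (use x in simp)
qed

end

section \<open>Stable summands and independence of the resolution\<close>

text \<open>These are the endomorphisms of U that factor through a direct sum of a power of V and a
  finite free module. Closing under sums expresses this without forming the direct sum, which would
  need a carrier type of its own.\<close>

inductive fac :: "'a ring \<Rightarrow> ('a,'b) module \<Rightarrow> ('a,'c) module \<Rightarrow> ('b \<Rightarrow> 'b) \<Rightarrow> bool" for R U V where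
  fac_thru: "mod_hom R U V \<alpha> \<Longrightarrow> mod_hom R V U \<beta> \<Longrightarrow> (\<And>x. x \<in> carrier U \<Longrightarrow> t x = \<beta> (\<alpha> x)) \<Longrightarrow> fac R U V t"
| fac_free: "mod_hom R U (free_mod R n) \<alpha> \<Longrightarrow> mod_hom R (free_mod R n) U \<beta> \<Longrightarrow>
    (\<And>x. x \<in> carrier U \<Longrightarrow> t x = \<beta> (\<alpha> x)) \<Longrightarrow> fac R U V t"
| fac_add: "fac R U V s \<Longrightarrow> fac R U V t \<Longrightarrow> (\<And>x. x \<in> carrier U \<Longrightarrow> u x = s x \<oplus>\<^bsub>U\<^esub> t x) \<Longrightarrow> fac R U V u"

definition stable_summand :: "'a ring \<Rightarrow> ('a,'b) module \<Rightarrow> ('a,'c) module \<Rightarrow> bool" where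
  "stable_summand R U V \<longleftrightarrow> fac R U V (\<lambda>x. x)"

context noeth_cring
begin

lemma fac_hom:
  assumes "fac R U V t" "module R U" shows "lin U U t"
  using assms
proof induct
  case (fac_thru \<alpha> \<beta> t)
  then show ?case by (auto intro: hom_cong[OF mod_hom_comp[OF fac_thru(1,2)]])
next
  case (fac_free n \<alpha> \<beta> t)
  then show ?case by (auto intro: hom_cong[OF mod_hom_comp[OF fac_free(1,2)]])
next
  case (fac_add s t u)
  then show ?case by (auto intro: hom_cong[OF hom_add])
qed

lemma fac_zero:
  assumes "module R U" "module R V" shows "fac R U V (\<lambda>x. \<zero>\<^bsub>U\<^esub>)"
  using assms by (intro fac_thru[OF hom_const0 hom_const0]) auto

text \<open>The rules only constrain values on the carrier, so adding the zero map through V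
  replaces \<open>t\<close> by any function that agrees with it there.\<close>

lemma fac_cong:
  assumes "fac R U V t" "module R U" "module R V" "\<And>x. x \<in> carrier U \<Longrightarrow> s x = t x" shows "fac R U V s"
  using mod_homD(1)[OF fac_hom[OF assms(1,2)]] assms by (intro fac_add[OF assms(1) fac_zero]) auto

lemma fac_comp:
  assumes "fac R V W t" "lin U V \<alpha>" "lin V U \<beta>" "module R V" "module R U"
  shows "fac R U W (\<lambda>x. \<beta> (t (\<alpha> x)))"
  using assms(1)
proof induct
  case (fac_thru \<gamma> \<delta> t)
  then show ?case using mod_homD(1)[OF assms(2)]
    by (intro fac.fac_thru[OF mod_hom_comp[OF assms(2) fac_thru(1)] mod_hom_comp[OF fac_thru(2) assms(3)]]) auto
next
  case (fac_free n \<gamma> \<delta> t)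
  then show ?case using mod_homD(1)[OF assms(2)]
    by (intro fac.fac_free[OF mod_hom_comp[OF assms(2) fac_free(1)] mod_hom_comp[OF fac_free(2) assms(3)]]) auto
next
  case (fac_add s t u)
  show ?case
  proof (rule fac.fac_add[OF fac_add(2,4)])
    fix x assume "x \<in> carrier U"
    then show "\<beta> (u (\<alpha> x)) = \<beta> (s (\<alpha> x)) \<oplus>\<^bsub>U\<^esub> \<beta> (t (\<alpha> x))"
      using mod_homD(1)[OF assms(2)] mod_homD(2)[OF assms(3)] fac_add(5)
        mod_homD(1)[OF fac_hom[OF fac_add(1) assms(4)]] mod_homD(1)[OF fac_hom[OF fac_add(3) assms(4)]] by simp
  qed
qed

lemma fac_trans:
  assumes "fac R U V t" "stable_summand R V W" "module R U" "module R V" "module R W"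
  shows "fac R U W t"
  using assms(1)
proof induct
  case (fac_thru \<alpha> \<beta> t)
  have "fac R U W (\<lambda>x. \<beta> (\<alpha> x))"
    using fac_comp[OF _ fac_thru(1,2)] assms(2-4) by (auto simp: stable_summand_def)
  then show ?case using fac_cong fac_thru(3) assms by blast
next
  case (fac_free n \<alpha> \<beta> t)
  then show ?case by (intro fac.fac_free) auto
next
  case (fac_add s t u)
  then show ?case by (intro fac.fac_add[OF fac_add(2,4)]) auto
qed

lemma stable_summand_trans:
  "stable_summand R U V \<Longrightarrow> stable_summand R V W \<Longrightarrow> module R U \<Longrightarrow> module R V \<Longrightarrow> module R W \<Longrightarrow> stable_summand R U W"
  using fac_trans stable_summand_def by metis

lemma stable_summand_refl: "stable_summand R U U"
  unfolding stable_summand_def by (rule fac_thru[OF mod_hom_id mod_hom_id]) auto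

lemma hom_inv:
  assumes f: "lin U V f" "bij_betw f (carrier U) (carrier V)" and m: "module R U" "module R V"
  shows "lin V U (inv_into (carrier U) f)"
proof -
  let ?g = "inv_into (carrier U) f"
  have fg: "f (?g y) = y" "?g y \<in> carrier U" if "y \<in> carrier V" for y
    using that f(2) by (auto simp: bij_betw_def inv_into_into f_inv_into_f)
  have gf: "?g (f x) = x" if "x \<in> carrier U" for x
    using that f(2) by (simp add: bij_betw_def)
  show ?thesis
  proof (rule mod_homI)
    fix x y assume xy: "x \<in> carrier V" "y \<in> carrier V"
    show "?g x \<in> carrier U" using fg xy by simp
    have "?g (x \<oplus>\<^bsub>V\<^esub> y) = ?g (f (?g x \<oplus>\<^bsub>U\<^esub> ?g y))"
      using fg xy mod_homD(2)[OF f(1)] by simp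
    then show "?g (x \<oplus>\<^bsub>V\<^esub> y) = ?g x \<oplus>\<^bsub>U\<^esub> ?g y" using gf fg xy m by simp
    fix a assume a: "a \<in> carrier R"
    have "?g (a \<odot>\<^bsub>V\<^esub> x) = ?g (f (a \<odot>\<^bsub>U\<^esub> ?g x))"
      using fg xy mod_homD(3)[OF f(1)] a by simp
    then show "?g (a \<odot>\<^bsub>V\<^esub> x) = a \<odot>\<^bsub>U\<^esub> ?g x" using gf fg xy m a by simp
  qed
qed

lemma stable_summand_iso:
  assumes "mod_iso R U V" "module R U" "module R V"
  shows "stable_summand R U V" "stable_summand R V U"
proof -
  obtain f where f: "lin U V f" "bij_betw f (carrier U) (carrier V)" using assms by (auto simp: mod_iso_def)
  note g = hom_inv[OF f assms(2,3)]
  show "stable_summand R U V" unfolding stable_summand_def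
    by (rule fac_thru[OF f(1) g]) (use f(2) in \<open>simp add: bij_betw_def\<close>)
  show "stable_summand R V U" unfolding stable_summand_def
    by (rule fac_thru[OF g f(1)]) (use f(2) in \<open>simp add: bij_betw_def f_inv_into_f\<close>)
qed

lemma stable_summand_dsum_pow:
  assumes V: "module R V"
  shows "stable_summand R (dsum_pow R V a) V"
    and "a > 0 \<Longrightarrow> stable_summand R V (dsum_pow R V a)"
proof -
  let ?D = "dsum_pow R V a"
  have c: "x i \<in> carrier V" if "x \<in> carrier ?D" "i < a" for x i using that by (auto simp: dsum_pow_simps)
  \<comment> \<open>Truncation to the first k coordinates. Each further coordinate adds one map
    through V, so for k = a the identity of the power is a sum of a such maps.\<close>
  have "k \<le> a \<Longrightarrow> fac R ?D V (\<lambda>x. \<lambda>i\<in>{..<a}. if i < k then x i else \<zero>\<^bsub>V\<^esub>)" for k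
  proof (induct k)
    case 0
    then show ?case using V by (intro fac_cong[OF fac_zero[of ?D V]]) (auto simp: dsum_pow_simps fun_eq_iff)
  next
    case (Suc k)
    have "lin ?D V (\<lambda>x. x k)" using Suc.prems
      by (intro mod_homI) (simp_all add: c dsum_pow_simps(3,4))
    moreover have "lin V ?D (\<lambda>x. \<lambda>i\<in>{..<a}. if i = k then x else \<zero>\<^bsub>V\<^esub>)"
      using V by (intro mod_homI) (auto simp: dsum_pow_simps fun_eq_iff)
    ultimately have f: "fac R ?D V (\<lambda>x. \<lambda>i\<in>{..<a}. if i = k then x k else \<zero>\<^bsub>V\<^esub>)"
      by (rule fac_thru) auto
    have "fac R ?D V (\<lambda>x. \<lambda>i\<in>{..<a}. if i < k then x i else \<zero>\<^bsub>V\<^esub>)"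
      using Suc.prems by (intro Suc.hyps) linarith
    then show ?case
    proof (rule fac_add[OF _ f])
      fix x assume "x \<in> carrier ?D"
      then show "(\<lambda>i\<in>{..<a}. if i < Suc k then x i else \<zero>\<^bsub>V\<^esub>) =
         (\<lambda>i\<in>{..<a}. if i < k then x i else \<zero>\<^bsub>V\<^esub>) \<oplus>\<^bsub>?D\<^esub> (\<lambda>i\<in>{..<a}. if i = k then x k else \<zero>\<^bsub>V\<^esub>)"
        using c V by (auto simp: dsum_pow_simps(3) fun_eq_iff less_Suc_eq)
    qed
  qed
  from this[of a] show "stable_summand R ?D V" unfolding stable_summand_def
    using V by (rule_tac fac_cong) (auto simp: dsum_pow_simps fun_eq_iff PiE_iff extensional_def)
  assume a: "a > 0"
  have "lin V ?D (\<lambda>x. \<lambda>i\<in>{..<a}. x)"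
    using V by (intro mod_homI) (auto simp: dsum_pow_simps fun_eq_iff)
  moreover have "lin ?D V (\<lambda>x. x 0)"
    using a by (intro mod_homI) (simp_all add: c dsum_pow_simps(3,4))
  ultimately show "stable_summand R V ?D"
    unfolding stable_summand_def by (rule fac_thru) (simp add: a)
qed

text \<open>Maps between modules lift to maps between their covers and restrict to the kernels. The
  last conjunct moves an extension problem from the cover of U to that of V, which is what Ext^1
  needs. The conjuncts are proved together because they must hold for one and the same lift
  \<open>\<tau>\<close>.\<close>

lemma fac_lift:
  assumes "fac R U V t" and U: "module R U" and V: "module R V"
    and cU: "free_cover R U p e" and cV: "free_cover R V q h"
  shows "\<exists>\<tau>. lin (free p) (free p) \<tau> \<and> (\<forall>v\<in>carrier (free p). e (\<tau> v) = t (e v)) \<and>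
    fac R (ker p U e) (ker q V h) \<tau> \<and>
    (homs_extend R (ker q V h) (free q) (\<lambda>v. v) \<longrightarrow>
      (\<forall>f. lin (ker p U e) (self) f \<longrightarrow>
        (\<exists>g. lin (free p) (self) g \<and> (\<forall>v\<in>carrier (ker p U e). g v = f (\<tau> v)))))"
  (is "\<exists>\<tau>. ?A \<tau> \<and> ?B t \<tau> \<and> ?C \<tau> \<and> ?D \<tau>")
  using assms(1)
proof induct
  let ?K = "ker p U e" and ?L = "ker q V h"
  have e: "lin (free p) U e" "e ` carrier (free p) = carrier U" using cU by (auto simp: free_cover_def)
  have h: "lin (free q) V h" "h ` carrier (free q) = carrier V" using cV by (auto simp: free_cover_def)
  have mK: "module R ?K" and mL: "module R ?L" using e h U V by auto
  {
    case (fac_thru \<alpha> \<beta> t)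
    obtain \<phi> where \<phi>: "lin (free p) (free q) \<phi>" "\<And>v. v \<in> carrier (free p) \<Longrightarrow> h (\<phi> v) = \<alpha> (e v)"
      using free_lift_cover[OF mod_hom_comp[OF e(1) fac_thru(1)] h V module_free] by blast
    obtain \<psi> where \<psi>: "lin (free q) (free p) \<psi>" "\<And>v. v \<in> carrier (free q) \<Longrightarrow> e (\<psi> v) = \<beta> (h v)"
      using free_lift_cover[OF mod_hom_comp[OF h(1) fac_thru(2)] e U module_free] by blast
    have \<phi>K: "lin ?K ?L \<phi>"
      using \<phi> hom_zero[OF fac_thru(1) U V] by (auto simp: hom_ker_iff ker_mod_simps intro: hom_from_ker)
    have \<psi>L: "lin ?L ?K \<psi>"
      using \<psi> hom_zero[OF fac_thru(2) V U] by (auto simp: hom_ker_iff ker_mod_simps intro: hom_from_ker)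
    have "?A (\<lambda>v. \<psi> (\<phi> v))" by (rule mod_hom_comp[OF \<phi>(1) \<psi>(1)])
    moreover have "?B t (\<lambda>v. \<psi> (\<phi> v))"
      using \<phi> \<psi> fac_thru(3) mod_homD(1)[OF \<phi>(1)] mod_homD(1)[OF e(1)] by simp
    moreover have "?C (\<lambda>v. \<psi> (\<phi> v))" by (rule fac.fac_thru[OF \<phi>K \<psi>L]) simp
    moreover have "?D (\<lambda>v. \<psi> (\<phi> v))"
    proof (intro impI allI)
      fix f assume ext: "homs_extend R ?L (free q) (\<lambda>v. v)" and f: "lin ?K (self) f"
      obtain g where g: "lin (free q) (self) g" "\<And>v. v \<in> carrier ?L \<Longrightarrow> g v = f (\<psi> v)"
        using ext mod_hom_comp[OF \<psi>L f] unfolding homs_extend_def by blast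
      show "\<exists>g. lin (free p) (self) g \<and> (\<forall>v\<in>carrier ?K. g v = f (\<psi> (\<phi> v)))"
        using mod_hom_comp[OF \<phi>(1) g(1)] g(2) mod_homD(1)[OF \<phi>K] by blast
    qed
    ultimately show ?case by blast
  next
    case (fac_free n \<alpha> \<beta> t)
    obtain \<chi> where \<chi>: "lin (free n) (free p) \<chi>" "\<And>v. v \<in> carrier (free n) \<Longrightarrow> e (\<chi> v) = \<beta> v"
      using free_lift_cover[OF fac_free(2) e U module_free] by blast
    \<comment> \<open>A lift that starts with \<open>e\<close> kills the kernel of \<open>e\<close>,
      so a factorization through a free module becomes zero on syzygies.\<close>
    let ?\<tau> = "\<lambda>v. \<chi> (\<alpha> (e v))"
    have z: "?\<tau> v = \<zero>\<^bsub>?K\<^esub>" if "v \<in> carrier ?K" for v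
      using that hom_zero[OF fac_free(1) U] hom_zero[OF \<chi>(1)] by (simp add: ker_mod_simps)
    have "?A ?\<tau>" by (rule mod_hom_comp[OF e(1) mod_hom_comp[OF fac_free(1) \<chi>(1)]])
    moreover have "?B t ?\<tau>" using \<chi> fac_free(3) mod_homD(1)[OF fac_free(1)] mod_homD(1)[OF e(1)] by simp
    moreover have "?C ?\<tau>" by (rule fac_cong[OF fac_zero[OF mK mL] mK mL z])
    moreover have "?D ?\<tau>"
    proof (intro impI allI)
      fix f assume f: "lin ?K (self) f"
      show "\<exists>g. lin (free p) (self) g \<and> (\<forall>v\<in>carrier ?K. g v = f (?\<tau> v))"
        using hom_zero[OF f mK] z by (intro exI[of _ "\<lambda>x. \<zero>\<^bsub>self\<^esub>"]) (simp del: self_mod_simps add: hom_const0)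
    qed
    ultimately show ?case by blast
  next
    case (fac_add s t u)
    obtain \<sigma> where \<sigma>: "?A \<sigma>" "?B s \<sigma>" "?C \<sigma>" "?D \<sigma>" using fac_add(2) by blast
    obtain \<tau> where \<tau>: "?A \<tau>" "?B t \<tau>" "?C \<tau>" "?D \<tau>" using fac_add(4) by blast
    let ?\<upsilon> = "\<lambda>v. \<sigma> v \<oplus>\<^bsub>free p\<^esub> \<tau> v"
    have "?A ?\<upsilon>" by (rule hom_add[OF \<sigma>(1) \<tau>(1) module_free])
    moreover have "?B u ?\<upsilon>"
      using \<sigma>(2) \<tau>(2) fac_add(5) mod_homD(1)[OF \<sigma>(1)] mod_homD(1)[OF \<tau>(1)] mod_homD[OF e(1)] by simp
    moreover have "?C ?\<upsilon>" by (rule fac.fac_add[OF \<sigma>(3) \<tau>(3)]) (simp add: ker_mod_simps)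
    moreover have "?D ?\<upsilon>"
    proof (intro impI allI)
      fix f assume ext: "homs_extend R ?L (free q) (\<lambda>v. v)" and f: "lin ?K (self) f"
      obtain g1 where g1: "lin (free p) (self) g1" "\<And>v. v \<in> carrier ?K \<Longrightarrow> g1 v = f (\<sigma> v)"
        using \<sigma>(4) ext f by blast
      obtain g2 where g2: "lin (free p) (self) g2" "\<And>v. v \<in> carrier ?K \<Longrightarrow> g2 v = f (\<tau> v)"
        using \<tau>(4) ext f by blast
      have "f (?\<upsilon> v) = g1 v \<oplus>\<^bsub>self\<^esub> g2 v" if "v \<in> carrier ?K" for v
        using g1(2) g2(2) that mod_homD(1)[OF fac_hom[OF \<sigma>(3) mK] that] mod_homD(1)[OF fac_hom[OF \<tau>(3) mK] that]
          mod_homD(2)[OF f] by (simp add: ker_mod_simps(3))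
      then show "\<exists>g. lin (free p) (self) g \<and> (\<forall>v\<in>carrier ?K. g v = f (?\<upsilon> v))"
        using hom_add[OF g1(1) g2(1) module_self] by (intro exI conjI) auto
    qed
    ultimately show ?case by blast
  }
qed

text \<open>A substitute for Schanuel's lemma. The lift \<open>\<tau>\<close> of the identity need
  not be the identity, but v minus \<open>\<tau> v\<close> lies in the kernel; on the kernel the
  identity is therefore \<open>\<tau>\<close> plus a map through the ambient free module. That
  correction \<open>\<kappa>\<close> is defined on the whole free module, so functionals composed
  with it extend by themselves.\<close>

lemma stable_summand_ker:
  assumes s: "stable_summand R U V" and U: "module R U" and V: "module R V"
    and cU: "free_cover R U p e" and cV: "free_cover R V q h"
  shows "stable_summand R (ker p U e) (ker q V h)"
    and "homs_extend R (ker q V h) (free q) (\<lambda>v. v) \<Longrightarrow>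
         homs_extend R (ker p U e) (free p) (\<lambda>v. v)"
proof -
  let ?K = "ker p U e" and ?L = "ker q V h"
  have e: "lin (free p) U e" "e ` carrier (free p) = carrier U" using cU by (auto simp: free_cover_def)
  have mK: "module R ?K" using e U by auto
  obtain \<tau> where \<tau>: "lin (free p) (free p) \<tau>" "\<And>v. v \<in> carrier (free p) \<Longrightarrow> e (\<tau> v) = e v"
    "fac R ?K ?L \<tau>"
    "\<And>f. homs_extend R ?L (free q) (\<lambda>v. v) \<Longrightarrow> lin ?K (self) f \<Longrightarrow>
        (\<exists>g. lin (free p) (self) g \<and> (\<forall>v\<in>carrier ?K. g v = f (\<tau> v)))"
    using fac_lift[OF s[unfolded stable_summand_def] U V cU cV] by blast
  define \<kappa> where "\<kappa> = (\<lambda>v. v \<oplus>\<^bsub>free p\<^esub> (\<ominus>\<^bsub>free p\<^esub> \<tau> v))"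
  have \<kappa>: "lin (free p) ?K \<kappa>"
    unfolding hom_ker_iff
  proof (intro conjI ballI)
    show "lin (free p) (free p) \<kappa>" unfolding \<kappa>_def by (rule hom_sub[OF mod_hom_id \<tau>(1) module_free])
    fix v assume v: "v \<in> carrier (free p)"
    then show "e (\<kappa> v) = \<zero>\<^bsub>U\<^esub>"
      using \<tau>(2)[OF v] U mod_homD(1)[OF e(1) v] mod_homD(1)[OF \<tau>(1) v] by (simp add: \<kappa>_def hom_diff[OF e(1)])
  qed
  have dec: "v = \<tau> v \<oplus>\<^bsub>?K\<^esub> \<kappa> v" if "v \<in> carrier ?K" for v
    using that mod_homD(1)[OF \<tau>(1)] by (simp add: \<kappa>_def ker_mod_simps madd_cancel)
  show "stable_summand R ?K ?L" unfolding stable_summand_def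
  proof (rule fac_add[OF \<tau>(3) fac_free])
    show "lin ?K (free p) (\<lambda>v. v)" by (rule hom_incl)
  qed (use \<kappa> dec in auto)
  assume ext: "homs_extend R ?L (free q) (\<lambda>v. v)"
  show "homs_extend R ?K (free p) (\<lambda>v. v)" unfolding homs_extend_def
  proof (intro allI impI)
    fix f assume f: "lin ?K (self) f"
    obtain g where g: "lin (free p) (self) g" "\<And>v. v \<in> carrier ?K \<Longrightarrow> g v = f (\<tau> v)"
      using \<tau>(4)[OF ext f] by blast
    have "g v \<oplus>\<^bsub>self\<^esub> f (\<kappa> v) = f v" if v: "v \<in> carrier ?K" for v
    proof -
      have "\<tau> v \<in> carrier ?K" using mod_homD(1)[OF fac_hom[OF \<tau>(3) mK] v] .
      moreover have "\<kappa> v \<in> carrier ?K" using mod_homD(1)[OF \<kappa>] v by (simp add: ker_mod_simps)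
      ultimately have "f (\<tau> v \<oplus>\<^bsub>?K\<^esub> \<kappa> v) = f (\<tau> v) \<oplus> f (\<kappa> v)" using mod_homD(2)[OF f] by simp
      then show ?thesis using dec[OF v] g(2)[OF v] by simp
    qed
    then show "\<exists>g. lin (free p) (self) g \<and> (\<forall>v\<in>carrier ?K. g v = f v)"
      using hom_add[OF g(1) mod_hom_comp[OF \<kappa> f] module_self] by blast
  qed
qed

text \<open>U is a stable summand of itself, so extendability passes between any two of its
  covers.\<close>

lemma ext_nonzero_1_iff:
  assumes "module R U" "free_cover R U n e"
  shows "ext U (Suc 0) \<longleftrightarrow> \<not> homs_extend R (ker n U e) (free n) (\<lambda>v. v)"
  using ext_nonzero_1[OF assms(1)] stable_summand_ker(2)[OF stable_summand_refl assms(1,1) _ assms(2)] assms(2) by blast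

text \<open>The induction replaces both modules by kernels of covers and so has to stay in their
  carrier type. \<open>ext_nonzero_stable_summand\<close> reaches this case from arbitrary types by
  a first pair of kernels.\<close>

lemma ext_nonzero_stable_summand_aux:
  fixes U V :: "('a, nat \<Rightarrow> 'a) module"
  assumes "stable_summand R U V" "module R U" "module R V" "fin_gen R V" "ext U (Suc i)"
  shows "ext V (Suc i)"
  using assms
proof (induct i arbitrary: U V)
  case 0
  obtain n e where c: "free_cover R U n e" "\<not> homs_extend R (ker n U e) (free n) (\<lambda>v. v)"
    using 0 ext_nonzero_1 by blast
  obtain q h where "free_cover R V q h" by (rule free_coverE[OF 0(4,3)])
  then show ?case using ext_nonzero_1_iff[OF 0(3)] stable_summand_ker(2)[OF 0(1-3) c(1)] c(2) by blast
next
  case (Suc i)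
  obtain n e where c: "free_cover R U n e" "ext (ker n U e) (Suc i)"
    using Suc.prems ext_nonzero_Suc by blast
  obtain q h where d: "free_cover R V q h" by (rule free_coverE[OF Suc.prems(4,3)])
  have "ext (ker q V h) (Suc i)"
    using c d Suc.prems stable_summand_ker(1)[OF Suc.prems(1-3) c(1) d]
    by (intro Suc.hyps[OF _ _ _ _ c(2)]) (auto simp: free_cover_def)
  then show ?case using d ext_nonzero_Suc by blast
qed

text \<open>The kernels of any two covers of U are stable summands of each other, which turns the
  existential statement of \<open>ext_nonzero_Suc\<close> into one about a given cover.\<close>

lemma ext_nonzero_cover:
  assumes "module R U" "free_cover R U n e"
  shows "ext U (Suc (Suc i)) \<longleftrightarrow> ext (ker n U e) (Suc i)"
proof
  assume "ext U (Suc (Suc i))"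
  then obtain m h where h: "free_cover R U m h" "ext (ker m U h) (Suc i)"
    using ext_nonzero_Suc by blast
  show "ext (ker n U e) (Suc i)"
    using assms h stable_summand_ker(1)[OF stable_summand_refl assms(1,1) h(1) assms(2)]
    by (intro ext_nonzero_stable_summand_aux[OF _ _ _ _ h(2)]) (auto simp: free_cover_def)
qed (use assms ext_nonzero_Suc in blast)

lemma ext_nonzero_stable_summand:
  assumes "stable_summand R U V" "module R U" "module R V" "fin_gen R V" "ext U (Suc i)"
  shows "ext V (Suc i)"
proof (cases i)
  case 0
  obtain n e where c: "free_cover R U n e" "\<not> homs_extend R (ker n U e) (free n) (\<lambda>v. v)"
    using assms 0 ext_nonzero_1 by blast
  obtain q h where "free_cover R V q h" by (rule free_coverE[OF assms(4,3)])
  then show ?thesis using 0 ext_nonzero_1_iff[OF assms(3)] stable_summand_ker(2)[OF assms(1-3) c(1)] c(2) by blast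
next
  case (Suc j)
  obtain n e where c: "free_cover R U n e" "ext (ker n U e) (Suc j)"
    using assms Suc ext_nonzero_Suc by blast
  obtain q h where d: "free_cover R V q h" by (rule free_coverE[OF assms(4,3)])
  have "ext (ker q V h) (Suc j)"
    using c d assms stable_summand_ker(1)[OF assms(1-3) c(1) d]
    by (intro ext_nonzero_stable_summand_aux[OF _ _ _ _ c(2)]) (auto simp: free_cover_def)
  then show ?thesis using d Suc ext_nonzero_Suc by blast
qed

lemma ext_free: "\<not> ext (free n) (Suc i)"
proof (induct i arbitrary: n)
  case 0
  have c: "free_cover R (free n) n (\<lambda>v. v)" by (simp add: free_cover_def mod_hom_id)
  have "homs_extend R (ker n (free n) (\<lambda>v. v)) (free n) (\<lambda>v. v)"
    unfolding homs_extend_def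
  proof (intro allI impI)
    fix f assume f: "lin (ker n (free n) (\<lambda>v. v)) (self) f"
    have "f v = \<zero>\<^bsub>self\<^esub>" if "v \<in> carrier (ker n (free n) (\<lambda>v. v))" for v
      using that hom_zero[OF f] by (simp add: ker_mod_simps mod_hom_id)
    then show "\<exists>g. lin (free n) (self) g \<and> (\<forall>x\<in>carrier (ker n (free n) (\<lambda>v. v)). g x = f x)"
      by (intro exI[of _ "\<lambda>x. \<zero>\<^bsub>self\<^esub>"]) (simp del: self_mod_simps add: hom_const0)
  qed
  then show ?case using ext_nonzero_1_iff[OF module_free c] by blast
next
  case (Suc i)
  have c: "free_cover R (free n) n (\<lambda>v. v)" by (simp add: free_cover_def mod_hom_id)
  \<comment> \<open>The kernel of the identity cover is zero, so its identity map is the zero map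
    and factors through anything.\<close>
  have "stable_summand R (ker n (free n) (\<lambda>v. v)) (free n)"
    unfolding stable_summand_def using mod_homD(1)[OF hom_incl]
    by (intro fac_thru[OF hom_incl hom_const0]) (auto simp: ker_mod_simps mod_hom_id)
  then show ?case
    using Suc ext_nonzero_stable_summand[of _ "free n"] ext_nonzero_cover[OF module_free c]
    by (metis fin_gen_free module_free module_ker mod_hom_id)
qed

end

section \<open>Short exact sequences and Ext\<close>

definition fg_module :: "'a ring \<Rightarrow> ('a,'b) module \<Rightarrow> bool" where
  "fg_module R M \<longleftrightarrow> module R M \<and> fin_gen R M"

lemma sesD:
  assumes "ses R A B C i p"
  shows "mod_hom R A B i" "mod_hom R B C p" "inj_on i (carrier A)" "p ` carrier B = carrier C"
    and "x \<in> carrier A \<Longrightarrow> p (i x) = \<zero>\<^bsub>C\<^esub>"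
    and "y \<in> carrier B \<Longrightarrow> p y = \<zero>\<^bsub>C\<^esub> \<Longrightarrow> \<exists>x\<in>carrier A. y = i x"
  using assms unfolding ses_def exact_at_def by blast+

context noeth_cring
begin

abbreviation "fg M \<equiv> fg_module R M"

lemma fgD: "fg M \<Longrightarrow> module R M" "fg M \<Longrightarrow> fin_gen R M"
  by (simp_all add: fg_module_def)

lemma fg_free [simp]: "fg (free n)"
  by (simp add: fg_module_def)

lemma fg_ker: "module R M \<Longrightarrow> free_cover R M n e \<Longrightarrow> fg (ker n M e)"
  by (simp add: fg_module_def free_cover_def)

lemma fg_dual: "fg M \<Longrightarrow> fg (dual M)"
  by (simp add: fg_module_def)

lemma fg_coverE:
  assumes "fg M"
  obtains n e where "free_cover R M n e"
  using assms free_coverE unfolding fg_module_def by metis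

lemma hom_thru_inj:
  assumes s: "lin U B s" and i: "lin A B i" "inj_on i (carrier A)"
    and m: "module R U" "module R A"
    and im: "\<And>x. x \<in> carrier U \<Longrightarrow> s x \<in> i ` carrier A"
  obtains \<sigma> where "lin U A \<sigma>" "\<And>x. x \<in> carrier U \<Longrightarrow> i (\<sigma> x) = s x"
proof -
  define \<sigma> where "\<sigma> = (\<lambda>x. inv_into (carrier A) i (s x))"
  have \<sigma>: "\<sigma> x \<in> carrier A" "i (\<sigma> x) = s x" if "x \<in> carrier U" for x
    using im[OF that] by (auto simp: \<sigma>_def inv_into_into f_inv_into_f)
  have "lin U A \<sigma>"
  proof (rule mod_homI)
    fix x y assume xy: "x \<in> carrier U" "y \<in> carrier U"
    show "\<sigma> x \<in> carrier A" using \<sigma> xy by simp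
    have "i (\<sigma> (x \<oplus>\<^bsub>U\<^esub> y)) = i (\<sigma> x \<oplus>\<^bsub>A\<^esub> \<sigma> y)"
      using \<sigma> xy m mod_homD(2)[OF s] mod_homD(2)[OF i(1)] by simp
    then show "\<sigma> (x \<oplus>\<^bsub>U\<^esub> y) = \<sigma> x \<oplus>\<^bsub>A\<^esub> \<sigma> y"
      using inj_onD[OF i(2)] \<sigma> xy m by simp
    fix a assume a: "a \<in> carrier R"
    have "i (\<sigma> (a \<odot>\<^bsub>U\<^esub> x)) = i (a \<odot>\<^bsub>A\<^esub> \<sigma> x)"
      using \<sigma> xy m a mod_homD(3)[OF s] mod_homD(3)[OF i(1)] by simp
    then show "\<sigma> (a \<odot>\<^bsub>U\<^esub> x) = a \<odot>\<^bsub>A\<^esub> \<sigma> x"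
      using inj_onD[OF i(2)] \<sigma> xy m a by simp
  qed
  with \<sigma> that show ?thesis by blast
qed

text \<open>A free cover of the middle term also covers the right-hand term; this rotates a short exact
  sequence \<open>A \<rightarrow> B \<rightarrow> C\<close> into \<open>\<Omega>B \<rightarrow> \<Omega>C \<rightarrow> A\<close>.\<close>

lemma ses_rotate:
  assumes s: "ses R A B C i p" and m: "module R A" "module R B" "module R C" and c: "free_cover R B n e"
  obtains \<sigma> where "free_cover R C n (\<lambda>v. p (e v))"
    "ses R (ker n B e) (ker n C (\<lambda>v. p (e v))) A (\<lambda>v. v) \<sigma>"
    "\<forall>k\<in>carrier (ker n C (\<lambda>v. p (e v))). i (\<sigma> k) = e k"
proof -
  note i = sesD(1)[OF s] and p = sesD(2)[OF s]
  have e: "lin (free n) B e" "e ` carrier (free n) = carrier B" using c by (auto simp: free_cover_def)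
  let ?pe = "\<lambda>v. p (e v)"
  have pe: "lin (free n) C ?pe" by (rule mod_hom_comp[OF e(1) p])
  have cC: "free_cover R C n ?pe"
    using pe e(2) sesD(4)[OF s] by (simp add: free_cover_def image_image[symmetric])
  let ?K = "ker n B e" and ?L = "ker n C ?pe"
  have mL: "module R ?L" using pe m by simp
  have "e k \<in> i ` carrier A" if "k \<in> carrier ?L" for k
    using that sesD(6)[OF s, of "e k"] mod_homD(1)[OF e(1)] by (auto simp: ker_mod_simps)
  then obtain \<sigma> where \<sigma>: "lin ?L A \<sigma>" "\<And>k. k \<in> carrier ?L \<Longrightarrow> i (\<sigma> k) = e k"
    using hom_thru_inj[OF hom_from_ker[OF e(1)] i sesD(3)[OF s] mL m(1)] by blast
  \<comment> \<open>Since \<open>i\<close> is injective, \<open>\<sigma>\<close> vanishes exactly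
    where \<open>e\<close> does, so its kernel is the syzygy of B.\<close>
  have K0: "k \<in> carrier ?K \<longleftrightarrow> k \<in> carrier ?L \<and> \<sigma> k = \<zero>\<^bsub>A\<^esub>" for k
  proof
    assume k: "k \<in> carrier ?K"
    then have kL: "k \<in> carrier ?L" using hom_zero[OF p] m by (simp add: ker_mod_simps)
    have "i (\<sigma> k) = i \<zero>\<^bsub>A\<^esub>" using \<sigma>(2)[OF kL] k hom_zero[OF i] m by (simp add: ker_mod_simps)
    then show "k \<in> carrier ?L \<and> \<sigma> k = \<zero>\<^bsub>A\<^esub>"
      using inj_onD[OF sesD(3)[OF s]] mod_homD(1)[OF \<sigma>(1) kL] m kL by simp
  next
    assume k: "k \<in> carrier ?L \<and> \<sigma> k = \<zero>\<^bsub>A\<^esub>"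
    then have "e k = \<zero>\<^bsub>B\<^esub>" using \<sigma>(2)[of k] hom_zero[OF i] m by simp
    then show "k \<in> carrier ?K" using k by (simp add: ker_mod_simps)
  qed
  have "a \<in> \<sigma> ` carrier ?L" if a: "a \<in> carrier A" for a
  proof -
    have ia: "i a \<in> carrier B" using mod_homD(1)[OF i a] .
    then obtain v where v: "v \<in> carrier (free n)" "i a = e v" using e(2) by (metis imageE)
    have vL: "v \<in> carrier ?L" using v sesD(5)[OF s a] by (simp add: ker_mod_simps)
    have "\<sigma> v = a" using \<sigma>(2)[OF vL] v inj_onD[OF sesD(3)[OF s]] mod_homD(1)[OF \<sigma>(1) vL] a by simp
    then show ?thesis using vL by blast
  qed
  then have im: "\<sigma> ` carrier ?L = carrier A" using mod_homD(1)[OF \<sigma>(1)] by auto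
  have "lin ?K ?L (\<lambda>v. v)" using K0 hom_incl[of n B e] by (auto simp: hom_ker_iff ker_mod_simps)
  moreover have "exact_at ?K ?L A (\<lambda>v. v) \<sigma>" using K0 by (auto simp: exact_at_def)
  ultimately have "ses R ?K ?L A (\<lambda>v. v) \<sigma>" using \<sigma>(1) im by (simp add: ses_def)
  with cC \<sigma>(2) that show ?thesis by blast
qed

text \<open>Exactness of Hom(B,R) -> Hom(A,R) -> Ext^1(C,R). A functional on A is pulled back along
  \<open>\<sigma>\<close> to the syzygy of C and extended to the free module; the extension vanishes
  on the kernel of \<open>e\<close> and therefore descends to B.\<close>

lemma ext1_homs_extend:
  assumes s: "ses R A B C i p" and m: "fg A" "fg B" "fg C"
    and x: "\<not> ext C (Suc 0)"
  shows "homs_extend R A B i"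
  unfolding homs_extend_def
proof (intro allI impI)
  note mm = fgD(1)[OF m(1)] fgD(1)[OF m(2)] fgD(1)[OF m(3)]
  obtain n e where c: "free_cover R B n e" by (rule fg_coverE[OF m(2)])
  then have e: "lin (free n) B e" "e ` carrier (free n) = carrier B" by (auto simp: free_cover_def)
  obtain \<sigma> where cC: "free_cover R C n (\<lambda>v. p (e v))" and
    sK: "ses R (ker n B e) (ker n C (\<lambda>v. p (e v))) A (\<lambda>v. v) \<sigma>"
    and \<sigma>: "\<forall>k\<in>carrier (ker n C (\<lambda>v. p (e v))). i (\<sigma> k) = e k"
    by (rule ses_rotate[OF s mm c])
  let ?L = "ker n C (\<lambda>v. p (e v))"
  fix f assume f: "lin A (self) f"
  have "homs_extend R ?L (free n) (\<lambda>v. v)" using x ext_nonzero_1_iff[OF mm(3) cC] by blast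
  then obtain G where G: "lin (free n) (self) G" "\<And>k. k \<in> carrier ?L \<Longrightarrow> G k = f (\<sigma> k)"
    using mod_hom_comp[OF sesD(2)[OF sK] f] unfolding homs_extend_def by blast
  have "G v = \<zero>\<^bsub>self\<^esub>" if "v \<in> carrier (free n)" "e v = \<zero>\<^bsub>B\<^esub>" for v
  proof -
    have v: "v \<in> carrier (ker n B e)" using that by (simp add: ker_mod_simps)
    then have "v \<in> carrier ?L" "\<sigma> v = \<zero>\<^bsub>A\<^esub>" using mod_homD(1)[OF sesD(1)[OF sK]] sesD(5)[OF sK] by auto
    then show ?thesis using G(2) hom_zero[OF f] mm by simp
  qed
  then obtain g where g: "lin B (self) g" "\<And>v. v \<in> carrier (free n) \<Longrightarrow> g (e v) = G v"
    using hom_factor[OF e G(1) module_free module_self mm(2)] by blast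
  have "g (i a) = f a" if a: "a \<in> carrier A" for a
  proof -
    obtain k where k: "k \<in> carrier ?L" "a = \<sigma> k" using a unfolding sesD(4)[OF sK, symmetric] by blast
    then have "k \<in> carrier (free n)" by (simp add: ker_mod_simps)
    then have "g (e k) = G k" by (rule g(2))
    then show ?thesis using bspec[OF \<sigma> k(1)] G(2)[OF k(1)] k(2) by simp
  qed
  then show "\<exists>g. lin B (self) g \<and> (\<forall>x\<in>carrier A. g (i x) = f x)" using g(1) by blast
qed

text \<open>Exactness of Hom(B,R) -> Hom(A,R) -> Ext^1(C,R) -> Ext^1(B,R). Given a functional on the
  syzygy of C, its restriction to the syzygy of B extends to the free module. The difference from
  this extension comes from a functional on A, which extends to B and so, through \<open>e\<close>,
  to the free module.\<close>

lemma homs_extend_ext1: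
  assumes s: "ses R A B C i p" and m: "fg A" "fg B" "fg C"
    and x: "homs_extend R A B i" and xB: "\<not> ext B (Suc 0)"
  shows "\<not> ext C (Suc 0)"
proof -
  note mm = fgD(1)[OF m(1)] fgD(1)[OF m(2)] fgD(1)[OF m(3)]
  obtain n e where c: "free_cover R B n e" by (rule fg_coverE[OF m(2)])
  then have e: "lin (free n) B e" "e ` carrier (free n) = carrier B" by (auto simp: free_cover_def)
  obtain \<sigma> where cC: "free_cover R C n (\<lambda>v. p (e v))" and
    sK: "ses R (ker n B e) (ker n C (\<lambda>v. p (e v))) A (\<lambda>v. v) \<sigma>"
    and \<sigma>: "\<forall>k\<in>carrier (ker n C (\<lambda>v. p (e v))). i (\<sigma> k) = e k"
    by (rule ses_rotate[OF s mm c])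
  let ?K = "ker n B e" and ?L = "ker n C (\<lambda>v. p (e v))"
  have mL: "module R ?L" using fg_ker[OF mm(3) cC] by (simp add: fg_module_def)
  have hK: "homs_extend R ?K (free n) (\<lambda>v. v)" using xB ext_nonzero_1_iff[OF mm(2) c] by blast
  have "homs_extend R ?L (free n) (\<lambda>v. v)" unfolding homs_extend_def
  proof (intro allI impI)
    fix f assume f: "lin ?L (self) f"
    obtain G where G: "lin (free n) (self) G" "\<And>k. k \<in> carrier ?K \<Longrightarrow> G k = f k"
      using hK mod_hom_comp[OF sesD(1)[OF sK] f] unfolding homs_extend_def by blast
    have D: "lin ?L (self) (\<lambda>k. f k \<oplus>\<^bsub>self\<^esub> (\<ominus>\<^bsub>self\<^esub> G k))"
      by (rule hom_sub[OF f hom_from_ker[OF G(1)] module_self])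
    have Gc: "k \<in> carrier ?L \<Longrightarrow> G k \<in> carrier (self)" for k
      using mod_homD(1)[OF hom_from_ker[OF G(1)]] by blast
    have "f k \<oplus>\<^bsub>self\<^esub> (\<ominus>\<^bsub>self\<^esub> G k) = \<zero>\<^bsub>self\<^esub>" if k: "k \<in> carrier ?L" "\<sigma> k = \<zero>\<^bsub>A\<^esub>" for k
    proof -
      obtain k' where "k' \<in> carrier ?K" "k = k'" using sesD(6)[OF sK, OF k] by blast
      then have "G k = f k" using G(2) by simp
      then show ?thesis using madd_neg[OF module_self mod_homD(1)[OF f k(1)]] by (simp del: self_mod_simps)
    qed
    then obtain a where a: "lin A (self) a" "\<And>k. k \<in> carrier ?L \<Longrightarrow> a (\<sigma> k) = f k \<oplus>\<^bsub>self\<^esub> (\<ominus>\<^bsub>self\<^esub> G k)"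
      using hom_factor[OF sesD(2)[OF sK] sesD(4)[OF sK] D mL module_self mm(1)] by blast
    obtain b where b: "lin B (self) b" "\<And>x. x \<in> carrier A \<Longrightarrow> b (i x) = a x"
      using x a(1) unfolding homs_extend_def by blast
    have "b (e k) \<oplus>\<^bsub>self\<^esub> G k = f k" if k: "k \<in> carrier ?L" for k
    proof -
      have "b (e k) = f k \<oplus>\<^bsub>self\<^esub> (\<ominus>\<^bsub>self\<^esub> G k)"
        using bspec[OF \<sigma> k] b(2) a(2)[OF k] mod_homD(1)[OF sesD(2)[OF sK] k] by metis
      then show ?thesis using madd_cancel(2)[OF module_self mod_homD(1)[OF f k] Gc[OF k]] by simp
    qed
    then show "\<exists>g. lin (free n) (self) g \<and> (\<forall>x\<in>carrier ?L. g x = f x)"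
      using hom_add[OF mod_hom_comp[OF e(1) b(1)] G(1) module_self] by blast
  qed
  then show ?thesis using ext_nonzero_1_iff[OF mm(3) cC] by blast
qed

lemma homs_extend_trans:
  assumes "homs_extend R A B i" "homs_extend R B C j" and that: "lin A B i"
  shows "homs_extend R A C (\<lambda>x. j (i x))"
  unfolding homs_extend_def
proof (intro allI impI)
  fix f assume "lin A (self) f"
  then obtain g where g: "lin B (self) g" "\<And>x. x \<in> carrier A \<Longrightarrow> g (i x) = f x"
    using assms(1) unfolding homs_extend_def by blast
  obtain h where h: "lin C (self) h" "\<And>x. x \<in> carrier B \<Longrightarrow> h (j x) = g x"
    using assms(2) g(1) unfolding homs_extend_def by blast
  show "\<exists>g. lin C (self) g \<and> (\<forall>x\<in>carrier A. g (j (i x)) = f x)"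
    using g h mod_homD(1)[OF that] by auto
qed

lemma homs_extend_left:
  assumes "homs_extend R A C (\<lambda>x. j (i x))" "lin B C j" shows "homs_extend R A B i"
  unfolding homs_extend_def
proof (intro allI impI)
  fix f assume "lin A (self) f"
  then obtain g where "lin C (self) g" "\<forall>x\<in>carrier A. g (j (i x)) = f x"
    using assms(1) unfolding homs_extend_def by blast
  then show "\<exists>g. lin B (self) g \<and> (\<forall>x\<in>carrier A. g (i x) = f x)"
    using mod_hom_comp[OF assms(2)] by (intro exI[of _ "\<lambda>x. g (j x)"]) auto
qed

text \<open>Rotation turns both claims into ones about the inclusions of the syzygy of B in that of
  C and of the latter in the free module. Extendability along the composite is Ext^1(B,R) = 0; along
  the first it is controlled by Ext^1(A,R), along the second by Ext^1(C,R).\<close>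

lemma ses_ext1:
  assumes s: "ses R A B C i p" and m: "fg A" "fg B" "fg C"
  shows "\<not> ext A (Suc 0) \<Longrightarrow> \<not> ext C (Suc 0) \<Longrightarrow> \<not> ext B (Suc 0)"
    and "\<not> ext B (Suc 0) \<Longrightarrow> \<not> ext C (Suc (Suc 0)) \<Longrightarrow> \<not> ext A (Suc 0)"
proof -
  note mm = fgD(1)[OF m(1)] fgD(1)[OF m(2)] fgD(1)[OF m(3)]
  obtain n e where c: "free_cover R B n e" by (rule fg_coverE[OF m(2)])
  obtain \<sigma> where cC: "free_cover R C n (\<lambda>v. p (e v))" and
    sK: "ses R (ker n B e) (ker n C (\<lambda>v. p (e v))) A (\<lambda>v. v) \<sigma>"
    and "\<forall>k\<in>carrier (ker n C (\<lambda>v. p (e v))). i (\<sigma> k) = e k"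
    by (rule ses_rotate[OF s mm c])
  let ?K = "ker n B e" and ?L = "ker n C (\<lambda>v. p (e v))"
  note mK = fg_ker[OF mm(2) c] and mL = fg_ker[OF mm(3) cC]
  show "\<not> ext A (Suc 0) \<Longrightarrow> \<not> ext C (Suc 0) \<Longrightarrow> \<not> ext B (Suc 0)"
    using ext1_homs_extend[OF sK mK mL m(1)] ext_nonzero_1_iff[OF mm(2) c] ext_nonzero_1_iff[OF mm(3) cC]
      homs_extend_trans[of ?K ?L "\<lambda>v. v" "free n" "\<lambda>v. v", OF _ _ sesD(1)[OF sK]] by blast
  show "\<not> ext A (Suc 0)" if "\<not> ext B (Suc 0)" "\<not> ext C (Suc (Suc 0))"
  proof (rule homs_extend_ext1[OF sK mK mL m(1)])
    show "homs_extend R ?K ?L (\<lambda>v. v)"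
      using that(1) ext_nonzero_1_iff[OF mm(2) c] homs_extend_left[OF _ hom_incl] by blast
    show "\<not> ext ?L (Suc 0)" using that(2) ext_nonzero_cover[OF mm(3) cC] by blast
  qed
qed

text \<open>The first claim of \<open>ses_ext1\<close> for the rotated sequence, whose middle term
  is the syzygy of C.\<close>

lemma ses_ext2:
  assumes s: "ses R A B C i p" and m: "fg A" "fg B" "fg C"
    and "\<not> ext A (Suc 0)" "\<not> ext B (Suc (Suc 0))"
  shows "\<not> ext C (Suc (Suc 0))"
proof -
  note mm = fgD(1)[OF m(1)] fgD(1)[OF m(2)] fgD(1)[OF m(3)]
  obtain n e where c: "free_cover R B n e" by (rule fg_coverE[OF m(2)])
  obtain \<sigma> where cC: "free_cover R C n (\<lambda>v. p (e v))" and
    sK: "ses R (ker n B e) (ker n C (\<lambda>v. p (e v))) A (\<lambda>v. v) \<sigma>"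
    and "\<forall>k\<in>carrier (ker n C (\<lambda>v. p (e v))). i (\<sigma> k) = e k"
    by (rule ses_rotate[OF s mm c])
  show ?thesis
    using ses_ext1(1)[OF sK fg_ker[OF mm(2) c] fg_ker[OF mm(3) cC] m(1)] assms(5,6)
      ext_nonzero_cover[OF mm(2) c] ext_nonzero_cover[OF mm(3) cC] by blast
qed

lemma horseshoe:
  assumes s: "ses R A B C i p" and m: "module R A" "module R B" "module R C"
    and cA: "free_cover R A n e" and cC: "free_cover R C q h"
  obtains H where "free_cover R B (n + q) H"
    "ses R (ker n A e) (ker (n + q) B H) (ker q C h)
       (\<lambda>u. join n q u \<zero>\<^bsub>free q\<^esub>) (snd_part n q)"
proof -
  note i = sesD(1)[OF s] and p = sesD(2)[OF s]
  have e: "lin (free n) A e" "e ` carrier (free n) = carrier A" using cA by (auto simp: free_cover_def)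
  have h: "lin (free q) C h" "h ` carrier (free q) = carrier C" using cC by (auto simp: free_cover_def)
  obtain r where r: "lin (free q) B r" "\<And>v. v \<in> carrier (free q) \<Longrightarrow> p (r v) = h v"
    using free_lift_cover[OF h(1) p sesD(4)[OF s] m(3,2)] by blast
  define H where "H = (\<lambda>w. i (e (fst_part n q w)) \<oplus>\<^bsub>B\<^esub> r (snd_part n q w))"
  have H: "lin (free (n + q)) B H" unfolding H_def
    by (intro hom_add mod_hom_comp[OF hom_fst_part mod_hom_comp[OF e(1) i]] mod_hom_comp[OF hom_snd_part r(1)] m)
  have Hj: "H (join n q u v) = i (e u) \<oplus>\<^bsub>B\<^esub> r v" if "u \<in> carrier (free n)" "v \<in> carrier (free q)" for u v
    using that by (simp add: H_def)
  have ie: "i (e u) \<in> carrier B" if "u \<in> carrier (free n)" for u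
    using that mod_homD(1)[OF i] mod_homD(1)[OF e(1)] by simp
  have pH: "p (H w) = h (snd_part n q w)" if "w \<in> carrier (free (n + q))" for w
  proof -
    have "fst_part n q w \<in> carrier (free n)" "snd_part n q w \<in> carrier (free q)"
      using that mod_homD(1)[OF hom_fst_part] mod_homD(1)[OF hom_snd_part] by auto
    then show ?thesis using ie r mod_homD(1)[OF r(1)] mod_homD(1)[OF h(1)] mod_homD(2)[OF p] m
        sesD(5)[OF s] mod_homD(1)[OF e(1)] by (simp add: H_def)
  qed
  \<comment> \<open>If b and v have the same image in C, then b minus \<open>r v\<close> comes from
    A. Arbitrary b gives surjectivity of \<open>H\<close>, and b = 0 gives surjectivity between the
    kernels.\<close>
  have lift: "\<exists>u\<in>carrier (free n). H (join n q u v) = b" if b: "b \<in> carrier B" and v: "v \<in> carrier (free q)" "p b = h v" for b v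
  proof -
    have "p (b \<oplus>\<^bsub>B\<^esub> (\<ominus>\<^bsub>B\<^esub> r v)) = \<zero>\<^bsub>C\<^esub>"
      using b v r mod_homD(1)[OF r(1)] mod_homD(1)[OF h(1)] m by (simp add: hom_diff[OF p])
    then obtain a where a: "a \<in> carrier A" "b \<oplus>\<^bsub>B\<^esub> (\<ominus>\<^bsub>B\<^esub> r v) = i a"
      using sesD(6)[OF s, of "b \<oplus>\<^bsub>B\<^esub> (\<ominus>\<^bsub>B\<^esub> r v)"] b v mod_homD(1)[OF r(1)] m by auto
    obtain u where u: "u \<in> carrier (free n)" "a = e u" using a e(2) by (metis imageE)
    have "H (join n q u v) = b"
      using Hj[OF u(1) v(1)] a u madd_cancel(2)[OF m(2) b mod_homD(1)[OF r(1) v(1)]] by simp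
    then show ?thesis using u by blast
  qed
  have "b \<in> H ` carrier (free (n + q))" if b: "b \<in> carrier B" for b
  proof -
    obtain v where v: "v \<in> carrier (free q)" "p b = h v" using h(2) mod_homD(1)[OF p b] by (metis imageE)
    then obtain u where "u \<in> carrier (free n)" "H (join n q u v) = b" using lift b by blast
    then show ?thesis using v by (intro image_eqI[of _ _ "join n q u v"]) auto
  qed
  then have cB: "free_cover R B (n + q) H" using H mod_homD(1)[OF H] by (auto simp: free_cover_def)
  let ?A = "ker n A e" and ?B = "ker (n + q) B H" and ?C = "ker q C h"
  let ?j = "\<lambda>u. join n q u \<zero>\<^bsub>free q\<^esub>"
  have Hj0: "H (?j u) = i (e u)" if "u \<in> carrier (free n)" for u
    using Hj[OF that mzero[OF module_free]] hom_zero[OF r(1)] m ie[OF that] by simp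
  have i0: "i a = \<zero>\<^bsub>B\<^esub> \<longleftrightarrow> a = \<zero>\<^bsub>A\<^esub>" if "a \<in> carrier A" for a
    using that hom_zero[OF i] m inj_onD[OF sesD(3)[OF s], of a "\<zero>\<^bsub>A\<^esub>"] by auto
  have "lin ?A ?B ?j" unfolding hom_ker_iff
  proof (intro conjI ballI)
    show "lin ?A (free (n + q)) ?j" by (intro hom_join hom_incl hom_const0 module_free)
    show "H (?j u) = \<zero>\<^bsub>B\<^esub>" if "u \<in> carrier ?A" for u using that Hj0 hom_zero[OF i] m by (simp add: ker_mod_simps)
  qed
  moreover have "lin ?B ?C (snd_part n q)" unfolding hom_ker_iff
  proof (intro conjI ballI)
    show "lin ?B (free q) (snd_part n q)" by (intro hom_from_ker hom_snd_part)
    show "h (snd_part n q w) = \<zero>\<^bsub>C\<^esub>" if "w \<in> carrier ?B" for w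
      using that pH[of w] hom_zero[OF p] m by (simp add: ker_mod_simps)
  qed
  moreover have "inj_on ?j (carrier ?A)"
    by (rule inj_on_inverseI[of _ "fst_part n q"]) (simp add: ker_mod_simps)
  moreover have "snd_part n q ` carrier ?B = carrier ?C"
  proof
    show "snd_part n q ` carrier ?B \<subseteq> carrier ?C" using mod_homD(1)[OF \<open>lin ?B ?C (snd_part n q)\<close>] by blast
    show "carrier ?C \<subseteq> snd_part n q ` carrier ?B"
    proof
      fix v assume v: "v \<in> carrier ?C"
      then obtain u where "u \<in> carrier (free n)" "H (join n q u v) = \<zero>\<^bsub>B\<^esub>"
        using lift[of "\<zero>\<^bsub>B\<^esub>" v] hom_zero[OF p] m by (auto simp: ker_mod_simps)
      then show "v \<in> snd_part n q ` carrier ?B"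
        using v by (intro image_eqI[of _ _ "join n q u v"]) (auto simp: ker_mod_simps)
    qed
  qed
  moreover have "exact_at ?A ?B ?C ?j (snd_part n q)" unfolding exact_at_def
  proof (intro equalityI subsetI)
    fix w assume "w \<in> {y \<in> carrier ?B. snd_part n q y = \<zero>\<^bsub>?C\<^esub>}"
    then have w: "w \<in> carrier (free (n + q))" "H w = \<zero>\<^bsub>B\<^esub>" "snd_part n q w = \<zero>\<^bsub>free q\<^esub>"
      by (auto simp: ker_mod_simps)
    then have jw: "w = ?j (fst_part n q w)" using join_parts[OF w(1)] by simp
    have f: "fst_part n q w \<in> carrier (free n)" using mod_homD(1)[OF hom_fst_part w(1)] .
    then have "i (e (fst_part n q w)) = \<zero>\<^bsub>B\<^esub>" using w(2) jw Hj0 by metis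
    then have "e (fst_part n q w) = \<zero>\<^bsub>A\<^esub>" using i0 mod_homD(1)[OF e(1) f] by blast
    then show "w \<in> ?j ` carrier ?A" using jw f by (intro image_eqI[of _ _ "fst_part n q w"]) (simp_all add: ker_mod_simps)
  next
    fix w assume "w \<in> ?j ` carrier ?A"
    then show "w \<in> {y \<in> carrier ?B. snd_part n q y = \<zero>\<^bsub>?C\<^esub>}"
      using Hj0 hom_zero[OF i] m by (auto simp: ker_mod_simps)
  qed
  ultimately have "ses R ?A ?B ?C ?j (snd_part n q)" by (simp add: ses_def)
  with cB that show ?thesis by blast
qed

text \<open>Exactness of the long sequence at Ext(B), Ext(A) and Ext(C), read as vanishing. The
  horseshoe replaces all three terms by syzygies at once, which lowers the degree; the carrier type
  is fixed for the induction, and \<open>ses_ext\<close> enters it by one application of the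
  horseshoe.\<close>

lemma ses_ext_aux:
  fixes A B C :: "('a, nat \<Rightarrow> 'a) module"
  assumes "ses R A B C i p" "fg A" "fg B" "fg C"
  shows "(\<not> ext A (Suc k) \<longrightarrow> \<not> ext C (Suc k) \<longrightarrow> \<not> ext B (Suc k)) \<and>
    (\<not> ext B (Suc k) \<longrightarrow> \<not> ext C (Suc (Suc k)) \<longrightarrow> \<not> ext A (Suc k)) \<and>
    (\<not> ext A (Suc k) \<longrightarrow> \<not> ext B (Suc (Suc k)) \<longrightarrow> \<not> ext C (Suc (Suc k)))"
  using assms
proof (induct k arbitrary: A B C i p)
  case 0
  then show ?case using ses_ext1 ses_ext2 by blast
next
  case (Suc k)
  note mm = fgD(1)[OF Suc.prems(2)] fgD(1)[OF Suc.prems(3)] fgD(1)[OF Suc.prems(4)]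
  obtain n e where cA: "free_cover R A n e" by (rule fg_coverE[OF Suc.prems(2)])
  obtain q h where cC: "free_cover R C q h" by (rule fg_coverE[OF Suc.prems(4)])
  obtain H where cB: "free_cover R B (n + q) H" and
    s: "ses R (ker n A e) (ker (n + q) B H) (ker q C h)
       (\<lambda>u. join n q u \<zero>\<^bsub>free q\<^esub>) (snd_part n q)"
    by (rule horseshoe[OF Suc.prems(1) mm cA cC])
  show ?case
    using Suc.hyps[OF s fg_ker[OF mm(1) cA] fg_ker[OF mm(2) cB] fg_ker[OF mm(3) cC]]
    by (simp only: ext_nonzero_cover[OF mm(1) cA] ext_nonzero_cover[OF mm(2) cB] ext_nonzero_cover[OF mm(3) cC])
qed

lemma ses_ext:
  assumes "ses R A B C i p" "fg A" "fg B" "fg C"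
  shows "(\<not> ext A (Suc k) \<longrightarrow> \<not> ext C (Suc k) \<longrightarrow> \<not> ext B (Suc k)) \<and>
    (\<not> ext B (Suc k) \<longrightarrow> \<not> ext C (Suc (Suc k)) \<longrightarrow> \<not> ext A (Suc k)) \<and>
    (\<not> ext A (Suc k) \<longrightarrow> \<not> ext B (Suc (Suc k)) \<longrightarrow> \<not> ext C (Suc (Suc k)))"
proof -
  note mm = fgD(1)[OF assms(2)] fgD(1)[OF assms(3)] fgD(1)[OF assms(4)]
  obtain n e where cA: "free_cover R A n e" by (rule fg_coverE[OF assms(2)])
  obtain q h where cC: "free_cover R C q h" by (rule fg_coverE[OF assms(4)])
  obtain H where cB: "free_cover R B (n + q) H" and
    s: "ses R (ker n A e) (ker (n + q) B H) (ker q C h)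
       (\<lambda>u. join n q u \<zero>\<^bsub>free q\<^esub>) (snd_part n q)"
    by (rule horseshoe[OF assms(1) mm cA cC])
  show ?thesis
  proof (cases k)
    case 0
    then show ?thesis using ses_ext1[OF assms] ses_ext2[OF assms] by blast
  next
    case (Suc j)
    show ?thesis
      using ses_ext_aux[OF s fg_ker[OF mm(1) cA] fg_ker[OF mm(2) cB] fg_ker[OF mm(3) cC], of j]
      unfolding Suc
      by (simp only: ext_nonzero_cover[OF mm(1) cA] ext_nonzero_cover[OF mm(2) cB] ext_nonzero_cover[OF mm(3) cC])
  qed
qed

lemmas ses_ext_mid = ses_ext[THEN conjunct1, rule_format]
lemmas ses_ext_left = ses_ext[THEN conjunct2, THEN conjunct1, rule_format]
lemmas ses_ext_right = ses_ext[THEN conjunct2, THEN conjunct2, rule_format]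

end

section \<open>Duality and totally reflexive modules\<close>

text \<open>Injectivity of the natural map from M to its bidual.\<close>

definition torsionless :: "'a ring \<Rightarrow> ('a,'b) module \<Rightarrow> bool" where
  "torsionless R M \<longleftrightarrow>
     (\<forall>x\<in>carrier M. (\<forall>f\<in>carrier (dual_mod R M). f x = \<zero>\<^bsub>R\<^esub>) \<longrightarrow> x = \<zero>\<^bsub>M\<^esub>)"

definition bidual_onto :: "'a ring \<Rightarrow> ('a,'b) module \<Rightarrow> bool" where
  "bidual_onto R M \<longleftrightarrow> (\<forall>\<xi>. mod_hom R (dual_mod R M) (self_mod R) \<xi> \<longrightarrow>
     (\<exists>x\<in>carrier M. \<forall>f\<in>carrier (dual_mod R M). \<xi> f = f x))"

text \<open>The transpose of \<open>t\<close>, restricted to the carrier because the elements of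
  \<open>dual_mod\<close> are extensional.\<close>

definition dual_map :: "('a,'b) module \<Rightarrow> ('b \<Rightarrow> 'c) \<Rightarrow> ('c \<Rightarrow> 'a) \<Rightarrow> 'b \<Rightarrow> 'a" where
  "dual_map A t f = (\<lambda>x\<in>carrier A. f (t x))"

context noeth_cring
begin

lemma dual_map_mem:
  assumes "lin A B t" "module R A" "f \<in> carrier (dual B)"
  shows "dual_map A t f \<in> carrier (dual A)"
  unfolding dual_map_def by (intro dual_memI mod_hom_comp[OF assms(1) dual_memD[OF assms(3)]] assms(2))

lemma hom_dual_map:
  assumes "lin A B t" "module R A"
  shows "lin (dual B) (dual A) (dual_map A t)"
proof (rule mod_homI)
  fix f g assume fg: "f \<in> carrier (dual B)" "g \<in> carrier (dual B)"
  show "dual_map A t f \<in> carrier (dual A)" by (rule dual_map_mem[OF assms fg(1)])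
  show "dual_map A t (f \<oplus>\<^bsub>dual B\<^esub> g) = dual_map A t f \<oplus>\<^bsub>dual A\<^esub> dual_map A t g"
    using mod_homD(1)[OF assms(1)] by (auto simp: dual_map_def dual_simps(3) fun_eq_iff)
  fix a show "dual_map A t (a \<odot>\<^bsub>dual B\<^esub> f) = a \<odot>\<^bsub>dual A\<^esub> dual_map A t f"
    using mod_homD(1)[OF assms(1)] by (auto simp: dual_map_def dual_simps(4) fun_eq_iff)
qed

lemma dual_map_apply [simp]: "x \<in> carrier A \<Longrightarrow> dual_map A t f x = f (t x)"
  by (simp add: dual_map_def)

lemma hom_eval:
  "module R M \<Longrightarrow> x \<in> carrier M \<Longrightarrow> lin (dual M) (self) (\<lambda>f. f x)"
  by (rule mod_homI) (auto simp: dual_simps(3,4) intro: dual_val)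

lemma homs_zeroD:
  assumes "\<forall>f\<in>carrier (dual M). f x = \<zero>" "module R M" "x \<in> carrier M" "lin M (self) h"
  shows "h x = \<zero>"
  using bspec[OF assms(1) dual_memI[OF assms(4,2)]] assms(3) by simp

lemma reflexive_iff:
  assumes M: "module R M"
  shows "bij_betw (\<lambda>x. \<lambda>f\<in>carrier (dual M). f x) (carrier M) (carrier (dual (dual M)))
     \<longleftrightarrow> torsionless R M \<and> bidual_onto R M"
proof -
  let ?\<delta> = "\<lambda>x. \<lambda>f\<in>carrier (dual M). f x"
  have mem: "?\<delta> x \<in> carrier (dual (dual M))" if "x \<in> carrier M" for x
    using hom_eval[OF M that] M by (intro dual_memI) auto
  have sub: "f (x \<oplus>\<^bsub>M\<^esub> (\<ominus>\<^bsub>M\<^esub> y)) = f x \<oplus>\<^bsub>self\<^esub> (\<ominus>\<^bsub>self\<^esub> f y)"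
    if "f \<in> carrier (dual M)" "x \<in> carrier M" "y \<in> carrier M" for f x y
    using hom_diff[OF dual_memD[OF that(1)] M module_self that(2,3)] .
  have fc: "f x \<in> carrier (self)" if "f \<in> carrier (dual M)" "x \<in> carrier M" for f x
    using dual_val[OF that] by simp
  have "inj_on ?\<delta> (carrier M) \<longleftrightarrow> torsionless R M"
  proof
    assume inj: "inj_on ?\<delta> (carrier M)"
    show "torsionless R M" unfolding torsionless_def
    proof (intro ballI impI)
      fix x assume x: "x \<in> carrier M" "\<forall>f\<in>carrier (dual M). f x = \<zero>"
      have "f x = f \<zero>\<^bsub>M\<^esub>" if "f \<in> carrier (dual M)" for f
        using hom_zero[OF dual_memD[OF that] M module_self] bspec[OF x(2) that] by simp
      then have "?\<delta> x = ?\<delta> \<zero>\<^bsub>M\<^esub>" by (rule restrict_ext)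
      then show "x = \<zero>\<^bsub>M\<^esub>" using inj_onD[OF inj] x M by simp
    qed
  next
    assume t: "torsionless R M"
    show "inj_on ?\<delta> (carrier M)"
    proof (rule inj_onI)
      fix x y assume xy: "x \<in> carrier M" "y \<in> carrier M" "?\<delta> x = ?\<delta> y"
      have "f (x \<oplus>\<^bsub>M\<^esub> (\<ominus>\<^bsub>M\<^esub> y)) = \<zero>" if f: "f \<in> carrier (dual M)" for f
      proof -
        have "f x = f y" using fun_cong[OF xy(3), of f] f by simp
        then show ?thesis using sub[OF f xy(1,2)] madd_neg[OF module_self fc[OF f xy(2)]] by simp
      qed
      then have "x \<oplus>\<^bsub>M\<^esub> (\<ominus>\<^bsub>M\<^esub> y) = \<zero>\<^bsub>M\<^esub>"
        using t madd[OF M xy(1) mneg[OF M xy(2)]] unfolding torsionless_def by blast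
      then show "x = y" by (rule mcancel[OF M xy(1,2)])
    qed
  qed
  moreover have "?\<delta> ` carrier M = carrier (dual (dual M)) \<longleftrightarrow> bidual_onto R M"
  proof
    assume im: "?\<delta> ` carrier M = carrier (dual (dual M))"
    show "bidual_onto R M" unfolding bidual_onto_def
    proof (intro allI impI)
      fix \<xi> assume "lin (dual M) (self) \<xi>"
      then have "restrict \<xi> (carrier (dual M)) \<in> ?\<delta> ` carrier M" unfolding im using M by (intro dual_memI) auto
      then obtain x where x: "x \<in> carrier M" "restrict \<xi> (carrier (dual M)) = ?\<delta> x" by blast
      have "\<xi> f = f x" if "f \<in> carrier (dual M)" for f using fun_cong[OF x(2), of f] that by simp
      then show "\<exists>x\<in>carrier M. \<forall>f\<in>carrier (dual M). \<xi> f = f x" using x(1) by blast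
    qed
  next
    assume o: "bidual_onto R M"
    have "\<xi> \<in> ?\<delta> ` carrier M" if \<xi>: "\<xi> \<in> carrier (dual (dual M))" for \<xi>
    proof -
      obtain x where x: "x \<in> carrier M" "\<forall>f\<in>carrier (dual M). \<xi> f = f x"
        using o dual_memD[OF \<xi>] unfolding bidual_onto_def by blast
      have "\<xi> = ?\<delta> x" using x by (intro dual_eqI[OF \<xi> mem]) auto
      then show ?thesis using x(1) by blast
    qed
    then show "?\<delta> ` carrier M = carrier (dual (dual M))" using mem by blast
  qed
  ultimately show ?thesis by (simp add: bij_betw_def)
qed

text \<open>Hom(-,R) is left exact, and extendability of functionals along \<open>i\<close> is
  exactly surjectivity at the remaining end.\<close>

lemma ses_dual:
  assumes s: "ses R A B C i p" and m: "module R A" "module R B" "module R C" and x: "homs_extend R A B i"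
  shows "ses R (dual C) (dual B) (dual A) (dual_map B p) (dual_map A i)"
  unfolding ses_def
proof (intro conjI)
  note i = sesD(1)[OF s] and p = sesD(2)[OF s]
  show hp: "lin (dual C) (dual B) (dual_map B p)" by (rule hom_dual_map[OF p m(2)])
  show hi: "lin (dual B) (dual A) (dual_map A i)" by (rule hom_dual_map[OF i m(1)])
  show "inj_on (dual_map B p) (carrier (dual C))"
  proof (rule inj_onI, rule dual_eqI)
    fix f g c assume e: "dual_map B p f = dual_map B p g" and c: "c \<in> carrier C"
    obtain b where "b \<in> carrier B" "c = p b" using c unfolding sesD(4)[OF s, symmetric] by blast
    then show "f c = g c" using fun_cong[OF e, of b] by simp
  qed
  show "dual_map A i ` carrier (dual B) = carrier (dual A)"
  proof
    show "dual_map A i ` carrier (dual B) \<subseteq> carrier (dual A)" using mod_homD(1)[OF hi] by blast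
    show "carrier (dual A) \<subseteq> dual_map A i ` carrier (dual B)"
    proof
      fix f assume f: "f \<in> carrier (dual A)"
      obtain g where g: "lin B (self) g" "\<And>x. x \<in> carrier A \<Longrightarrow> g (i x) = f x"
        using x dual_memD[OF f] unfolding homs_extend_def by blast
      have g': "restrict g (carrier B) \<in> carrier (dual B)" by (rule dual_memI[OF g(1) m(2)])
      have "f = dual_map A i (restrict g (carrier B))"
        using g(2) mod_homD(1)[OF i] by (intro dual_eqI[OF f mod_homD(1)[OF hi g']]) auto
      then show "f \<in> dual_map A i ` carrier (dual B)" using g' by blast
    qed
  qed
  show "exact_at (dual C) (dual B) (dual A) (dual_map B p) (dual_map A i)"
    unfolding exact_at_def
  proof (intro equalityI subsetI)
    fix g assume "g \<in> {y \<in> carrier (dual B). dual_map A i y = \<zero>\<^bsub>dual A\<^esub>}"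
    then have g: "g \<in> carrier (dual B)" "dual_map A i g = \<zero>\<^bsub>dual A\<^esub>" by auto
    have "g b = \<zero>\<^bsub>self\<^esub>" if b: "b \<in> carrier B" "p b = \<zero>\<^bsub>C\<^esub>" for b
    proof -
      obtain a where a: "a \<in> carrier A" "b = i a" using sesD(6)[OF s, OF b] by blast
      then show ?thesis using fun_cong[OF g(2), of a] by (simp add: dual_simps(2))
    qed
    then obtain h where h: "lin C (self) h" "\<And>b. b \<in> carrier B \<Longrightarrow> h (p b) = g b"
      using hom_factor[OF p sesD(4)[OF s] dual_memD[OF g(1)] m(2) module_self m(3)] by blast
    have h': "restrict h (carrier C) \<in> carrier (dual C)" by (rule dual_memI[OF h(1) m(3)])
    have "g = dual_map B p (restrict h (carrier C))"
      using h(2) mod_homD(1)[OF p] by (intro dual_eqI[OF g(1) mod_homD(1)[OF hp h']]) auto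
    then show "g \<in> dual_map B p ` carrier (dual C)" using h' by blast
  next
    fix g assume "g \<in> dual_map B p ` carrier (dual C)"
    then obtain f where f: "f \<in> carrier (dual C)" "g = dual_map B p f" by blast
    have "dual_map A i g = \<zero>\<^bsub>dual A\<^esub>"
      using f sesD(5)[OF s] mod_homD(1)[OF i] hom_zero[OF dual_memD[OF f(1)] m(3) module_self]
      by (auto simp: dual_map_def dual_simps(2) fun_eq_iff)
    then show "g \<in> {y \<in> carrier (dual B). dual_map A i y = \<zero>\<^bsub>dual A\<^esub>}"
      using f mod_homD(1)[OF hp] by blast
  qed
qed

text \<open>The dual basis: \<open>\<Phi>\<close> collects the values of a functional on the unit
  vectors, and \<open>\<Psi>\<close> sends the i-th unit vector to the i-th coordinate
  function.\<close>

lemma free_dual_coords: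
  obtains \<Phi> \<Psi> where "lin (dual (free n)) (free n) \<Phi>"
    "lin (free n) (dual (free n)) \<Psi>"
    "\<And>f. f \<in> carrier (dual (free n)) \<Longrightarrow> \<Psi> (\<Phi> f) = f"
    "\<And>i v. i < n \<Longrightarrow> v \<in> carrier (free n) \<Longrightarrow> \<Psi> (unit_vec R n i) v = v i"
proof -
  let ?F = "free n" and ?D = "dual (free n)"
  define \<Phi> where "\<Phi> = (\<lambda>f :: (nat \<Rightarrow> 'a) \<Rightarrow> 'a. \<lambda>i\<in>{..<n}. f (unit_vec R n i))"
  have "\<Phi> f \<in> carrier ?F" if f: "f \<in> carrier ?D" for f
    unfolding \<Phi>_def free_mod_simps(1) using dual_val[OF f unit_vec_carrier] by auto
  then have \<Phi>: "lin ?D ?F \<Phi>"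
    by (intro mod_homI) (auto simp: \<Phi>_def free_mod_simps(3,4) dual_simps(3,4) fun_eq_iff)
  have coord: "lin ?F (self) (\<lambda>v. v i)" if "i < n" for i
    using that by (intro mod_homI) (auto simp: free_mod_simps)
  obtain \<Psi> where \<Psi>: "lin ?F ?D \<Psi>" "\<And>i. i < n \<Longrightarrow> \<Psi> (unit_vec R n i) = restrict (\<lambda>v. v i) (carrier ?F)"
    using free_hom_ex[of ?D n "\<lambda>i. restrict (\<lambda>v. v i) (carrier ?F)"] dual_memI[OF coord] by auto
  have \<Psi>c: "\<Psi> w (unit_vec R n j) = w j" if j: "j < n" and w: "w \<in> carrier ?F" for w j
  proof (rule free_hom_eqI[OF mod_hom_comp[OF \<Psi>(1) hom_eval[OF module_free unit_vec_carrier]] coord[OF j] module_self _ w])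
    fix i assume "i < n"
    then show "\<Psi> (unit_vec R n i) (unit_vec R n j) = unit_vec R n i j"
      using \<Psi>(2) j by (simp add: unit_vec_def free_mod_simps)
  qed
  have "\<Psi> (\<Phi> f) = f" if f: "f \<in> carrier ?D" for f
  proof (rule dual_eqI[OF _ f])
    have Pf: "\<Phi> f \<in> carrier ?F" using mod_homD(1)[OF \<Phi> f] .
    show m: "\<Psi> (\<Phi> f) \<in> carrier ?D" using mod_homD(1)[OF \<Psi>(1) Pf] .
    fix v assume v: "v \<in> carrier ?F"
    show "\<Psi> (\<Phi> f) v = f v"
      by (rule free_hom_eqI[OF dual_memD[OF m] dual_memD[OF f] module_self _ v]) (simp add: \<Psi>c[OF _ Pf], simp add: \<Phi>_def)
  qed
  moreover have "\<Psi> (unit_vec R n i) v = v i" if "i < n" "v \<in> carrier ?F" for i v using \<Psi>(2) that by simp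
  ultimately show ?thesis using that[OF \<Phi> \<Psi>(1)] by blast
qed

lemma torsionless_free: "torsionless R (free n)"
  unfolding torsionless_def
proof (intro ballI impI)
  fix v assume v: "v \<in> carrier (free n)" "\<forall>f\<in>carrier (dual (free n)). f v = \<zero>"
  have "v i = \<zero>" if "i < n" for i
    by (rule homs_zeroD[OF v(2) module_free v(1)])
       (use that in \<open>intro mod_homI; auto simp: free_mod_simps\<close>)
  then show "v = \<zero>\<^bsub>free n\<^esub>"
    using v(1) by (auto simp: free_mod_simps fun_eq_iff PiE_iff extensional_def)
qed

lemma bidual_onto_free: "bidual_onto R (free n)"
  unfolding bidual_onto_def
proof (intro allI impI)
  let ?F = "free n" and ?D = "dual (free n)"
  fix \<xi> assume \<xi>: "lin ?D (self) \<xi>"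
  obtain \<Phi> \<Psi> where \<Phi>: "lin ?D ?F \<Phi>" and \<Psi>: "lin ?F ?D \<Psi>"
    and PP: "\<And>f. f \<in> carrier ?D \<Longrightarrow> \<Psi> (\<Phi> f) = f"
    and Pe: "\<And>i v. i < n \<Longrightarrow> v \<in> carrier ?F \<Longrightarrow> \<Psi> (unit_vec R n i) v = v i"
    using free_dual_coords[of n] by metis
  \<comment> \<open>The coordinates of the element that represents \<open>\<xi>\<close> are its
    values on the dual basis.\<close>
  define x where "x = (\<lambda>i\<in>{..<n}. \<xi> (\<Psi> (unit_vec R n i)))"
  have x: "x \<in> carrier ?F"
    using mod_homD(1)[OF mod_hom_comp[OF \<Psi> \<xi>] unit_vec_carrier] by (auto simp: x_def free_mod_simps(1) simp flip: self_mod_simps(1))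
  have "\<xi> f = f x" if f: "f \<in> carrier ?D" for f
  proof -
    have "\<xi> (\<Psi> (\<Phi> f)) = \<Psi> (\<Phi> f) x"
      by (rule free_hom_eqI[OF mod_hom_comp[OF \<Psi> \<xi>] mod_hom_comp[OF \<Psi> hom_eval[OF module_free x]] module_self _ mod_homD(1)[OF \<Phi> f]])
         (simp add: Pe x, simp add: x_def)
    then show ?thesis by (simp add: PP f)
  qed
  then show "\<exists>x\<in>carrier ?F. \<forall>f\<in>carrier ?D. \<xi> f = f x" using x by blast
qed

lemma stable_summand_dual_free: "stable_summand R (dual (free n)) (free n)"
proof -
  obtain \<Phi> \<Psi> where "lin (dual (free n)) (free n) \<Phi>"
    "lin (free n) (dual (free n)) \<Psi>"
    "\<And>f. f \<in> carrier (dual (free n)) \<Longrightarrow> \<Psi> (\<Phi> f) = f"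
    using free_dual_coords[of n] by metis
  then show ?thesis unfolding stable_summand_def by (intro fac_thru) auto
qed

lemma ext_dual_free: "\<not> ext (dual (free n)) (Suc i)"
  using ext_nonzero_stable_summand[OF stable_summand_dual_free module_dual[OF module_free] module_free fin_gen_free]
    ext_free by blast

text \<open>Transposition reverses a factorization; the dual of a free module which then appears in
  the middle is moved back to a free module by the dual basis.\<close>

lemma fac_dual:
  assumes "fac R U V t" and U: "module R U" and V: "module R V"
  shows "fac R (dual U) (dual V) (dual_map U t)"
  using assms(1)
proof induct
  case (fac_thru \<alpha> \<beta> t)
  show ?case
    by (rule fac.fac_thru[OF hom_dual_map[OF fac_thru(2) V] hom_dual_map[OF fac_thru(1) U]])
       (use fac_thru(3) mod_homD(1)[OF fac_thru(1)] in \<open>auto simp: dual_map_def fun_eq_iff\<close>)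
next
  case (fac_free n \<alpha> \<beta> t)
  obtain \<Phi> \<Psi> where P: "lin (dual (free n)) (free n) \<Phi>"
    "lin (free n) (dual (free n)) \<Psi>"
    "\<And>f. f \<in> carrier (dual (free n)) \<Longrightarrow> \<Psi> (\<Phi> f) = f"
    using free_dual_coords[of n] by metis
  note b = hom_dual_map[OF fac_free(2) module_free]
  show ?case
  proof (rule fac.fac_free[OF mod_hom_comp[OF b P(1)] mod_hom_comp[OF P(2) hom_dual_map[OF fac_free(1) U]]])
    fix f assume "f \<in> carrier (dual U)"
    then have "\<Psi> (\<Phi> (dual_map (free n) \<beta> f)) = dual_map (free n) \<beta> f" using P(3) mod_homD(1)[OF b] by blast
    then show "dual_map U t f = dual_map U \<alpha> (\<Psi> (\<Phi> (dual_map (free n) \<beta> f)))"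
      using fac_free(3) mod_homD(1)[OF fac_free(1)] by (auto simp: dual_map_def fun_eq_iff)
  qed
next
  case (fac_add s t u)
  show ?case
  proof (rule fac.fac_add[OF fac_add(2,4)])
    fix f assume f: "f \<in> carrier (dual U)"
    show "dual_map U u f = dual_map U s f \<oplus>\<^bsub>dual U\<^esub> dual_map U t f"
      using fac_add(5) mod_homD(2)[OF dual_memD[OF f]] mod_homD(1)[OF fac_hom[OF fac_add(1) U]]
        mod_homD(1)[OF fac_hom[OF fac_add(3) U]]
      by (auto simp: dual_map_def dual_simps(3) fun_eq_iff)
  qed
qed

lemma stable_summand_dual:
  assumes "stable_summand R U V" "module R U" "module R V"
  shows "stable_summand R (dual U) (dual V)"
  unfolding stable_summand_def
  by (rule fac_cong[OF fac_dual[OF assms(1)[unfolded stable_summand_def] assms(2,3)]])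
     (use assms in \<open>auto simp: dual_map_def fun_eq_iff dual_simps(1) extensional_def\<close>)

lemma torsionless_hom:
  assumes "torsionless R V" "module R U" "module R V" "lin U V t" "x \<in> carrier U"
    and "\<forall>f\<in>carrier (dual U). f x = \<zero>"
  shows "t x = \<zero>\<^bsub>V\<^esub>"
proof -
  have "f (t x) = \<zero>" if "f \<in> carrier (dual V)" for f
    using bspec[OF assms(6) dual_map_mem[OF assms(4,2) that]] assms(5) by simp
  then show ?thesis using assms(1) mod_homD(1)[OF assms(4,5)] unfolding torsionless_def by blast
qed

text \<open>An element killed by all functionals is killed by every map into a torsionless module,
  hence by each summand of the identity.\<close>

lemma torsionless_stable_summand:
  assumes s: "stable_summand R U V" and t: "torsionless R V" and U: "module R U" and V: "module R V"
  shows "torsionless R U"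
proof -
  have "t x = \<zero>\<^bsub>U\<^esub>" if "fac R U V t" "x \<in> carrier U" "\<forall>f\<in>carrier (dual U). f x = \<zero>" for t x
    using that(1)
  proof induct
    case (fac_thru \<alpha> \<beta> t)
    then show ?case using torsionless_hom[OF t U V fac_thru(1) that(2,3)] that(2) hom_zero[OF fac_thru(2) V U] by simp
  next
    case (fac_free n \<alpha> \<beta> t)
    then show ?case using torsionless_hom[OF torsionless_free U module_free fac_free(1) that(2,3)] that(2)
        hom_zero[OF fac_free(2) module_free U] by simp
  next
    case (fac_add s t u)
    then show ?case using that(2) U by simp
  qed
  then show ?thesis using s unfolding stable_summand_def torsionless_def by blast
qed

text \<open>For each \<open>t\<close> in the family, \<open>\<xi>\<close> composed with the
  transpose of \<open>t\<close> is evaluation at some element of U: for a factorization it is the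
  image of a representing element of the middle module, and for a sum the representing elements add
  up. For the identity this represents \<open>\<xi>\<close> itself.\<close>

lemma bidual_onto_stable_summand:
  assumes s: "stable_summand R U V" and o: "bidual_onto R V" and U: "module R U" and V: "module R V"
  shows "bidual_onto R U"
proof -
  let ?P = "\<lambda>\<xi> t. \<exists>x\<in>carrier U. \<forall>f\<in>carrier (dual U). \<xi> (dual_map U t f) = f x"
  have thru: "?P \<xi> t"
    if \<xi>: "lin (dual U) (self) \<xi>" and W: "bidual_onto R W" "module R W"
      and \<alpha>: "lin U W \<alpha>" and \<beta>: "lin W U \<beta>" and t: "\<And>x. x \<in> carrier U \<Longrightarrow> t x = \<beta> (\<alpha> x)"
    for \<xi> t \<alpha> \<beta> and W :: "('a, 'z) module"
  proof -
    obtain y where y: "y \<in> carrier W" "\<forall>f\<in>carrier (dual W). \<xi> (dual_map U \<alpha> f) = f y"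
      using W(1) mod_hom_comp[OF hom_dual_map[OF \<alpha> U] \<xi>] unfolding bidual_onto_def by blast
    have "\<xi> (dual_map U t f) = f (\<beta> y)" if f: "f \<in> carrier (dual U)" for f
    proof -
      have "dual_map U t f = dual_map U \<alpha> (dual_map W \<beta> f)"
        using t mod_homD(1)[OF \<alpha>] by (auto simp: dual_map_def fun_eq_iff)
      then show ?thesis using bspec[OF y(2) dual_map_mem[OF \<beta> W(2) f]] y(1) by simp
    qed
    then show ?thesis using mod_homD(1)[OF \<beta> y(1)] by blast
  qed
  have "?P \<xi> t" if "fac R U V t" and \<xi>: "lin (dual U) (self) \<xi>" for \<xi> t
    using that(1)
  proof induct
    case (fac_thru \<alpha> \<beta> t)
    show ?case by (rule thru[OF \<xi> o V fac_thru(1,2)]) (rule fac_thru(3))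
  next
    case (fac_free n \<alpha> \<beta> t)
    show ?case by (rule thru[OF \<xi> bidual_onto_free module_free fac_free(1,2)]) (rule fac_free(3))
  next
    case (fac_add s t u)
    obtain x where x: "x \<in> carrier U" "\<forall>f\<in>carrier (dual U). \<xi> (dual_map U s f) = f x" using fac_add(2) by blast
    obtain y where y: "y \<in> carrier U" "\<forall>f\<in>carrier (dual U). \<xi> (dual_map U t f) = f y" using fac_add(4) by blast
    have "\<xi> (dual_map U u f) = f (x \<oplus>\<^bsub>U\<^esub> y)" if f: "f \<in> carrier (dual U)" for f
    proof -
      note sh = fac_hom[OF fac_add(1) U] and th = fac_hom[OF fac_add(3) U]
      have "dual_map U u f = dual_map U s f \<oplus>\<^bsub>dual U\<^esub> dual_map U t f"
        using fac_add(5) mod_homD(2)[OF dual_memD[OF f]] mod_homD(1)[OF sh] mod_homD(1)[OF th]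
        by (auto simp: dual_map_def dual_simps(3) fun_eq_iff)
      then show ?thesis using mod_homD(2)[OF \<xi> dual_map_mem[OF sh U f] dual_map_mem[OF th U f]]
        x y f mod_homD(2)[OF dual_memD[OF f] x(1) y(1)] by simp
    qed
    then show ?case using x(1) y(1) U by (intro bexI[of _ "x \<oplus>\<^bsub>U\<^esub> y"]) auto
  qed
  note P = this[OF s[unfolded stable_summand_def]]
  have d: "dual_map U (\<lambda>x. x) f = f" if "f \<in> carrier (dual U)" for f
    using that by (auto simp: dual_map_def dual_simps(1) intro: extensional_restrict)
  show ?thesis unfolding bidual_onto_def
  proof (intro allI impI)
    fix \<xi> assume "lin (dual U) (self) \<xi>"
    from P[OF this] show "\<exists>x\<in>carrier U. \<forall>f\<in>carrier (dual U). \<xi> f = f x" by (simp add: d)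
  qed
qed

lemma torsionless_sub:
  assumes s: "ses R A B C i p" and m: "module R A" "module R B" and t: "torsionless R B"
  shows "torsionless R A"
  unfolding torsionless_def
proof (intro ballI impI)
  fix x assume x: "x \<in> carrier A" "\<forall>f\<in>carrier (dual A). f x = \<zero>"
  have "i x = i \<zero>\<^bsub>A\<^esub>"
    using torsionless_hom[OF t m sesD(1)[OF s] x] hom_zero[OF sesD(1)[OF s] m] by simp
  then show "x = \<zero>\<^bsub>A\<^esub>" using inj_onD[OF sesD(3)[OF s]] x(1) m by simp
qed

text \<open>Pulled back to the dual of B, a functional on the dual of A is evaluation at some b. It
  vanishes on functionals coming from C, so all functionals on C kill \<open>p b\<close>;
  torsionlessness of C then places b in the image of A.\<close>

lemma bidual_onto_sub:
  assumes s: "ses R A B C i p" and m: "module R A" "module R B" "module R C"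
    and x: "homs_extend R A B i" and o: "bidual_onto R B" and t: "torsionless R C"
  shows "bidual_onto R A"
  unfolding bidual_onto_def
proof (intro allI impI)
  note d = ses_dual[OF s m x]
  fix \<nu> assume \<nu>: "lin (dual A) (self) \<nu>"
  obtain b where b: "b \<in> carrier B" "\<forall>g\<in>carrier (dual B). \<nu> (dual_map A i g) = g b"
    using o mod_hom_comp[OF sesD(2)[OF d] \<nu>] unfolding bidual_onto_def by blast
  have "g (p b) = \<zero>" if g: "g \<in> carrier (dual C)" for g
  proof -
    have "dual_map B p g b = \<nu> (dual_map A i (dual_map B p g))"
      using b(2) mod_homD(1)[OF sesD(1)[OF d] g] by simp
    also have "\<dots> = \<zero>" using sesD(5)[OF d g] hom_zero[OF \<nu>] m by simp
    finally show ?thesis using b(1) by simp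
  qed
  then have "p b = \<zero>\<^bsub>C\<^esub>" using t mod_homD(1)[OF sesD(2)[OF s] b(1)] unfolding torsionless_def by blast
  then obtain a where a: "a \<in> carrier A" "b = i a" using sesD(6)[OF s b(1)] by blast
  have "\<nu> f = f a" if f: "f \<in> carrier (dual A)" for f
  proof -
    obtain g where "g \<in> carrier (dual B)" "f = dual_map A i g" using f unfolding sesD(4)[OF d, symmetric] by blast
    then show ?thesis using b(2) a by simp
  qed
  then show "\<exists>x\<in>carrier A. \<forall>f\<in>carrier (dual A). \<nu> f = f x" using a(1) by blast
qed

text \<open>A functional on the dual of C is evaluation at some c, and evaluation at a preimage of c
  in B extends it.\<close>

lemma homs_extend_dual:
  assumes s: "ses R A B C i p" and m: "module R B" and o: "bidual_onto R C"
  shows "homs_extend R (dual C) (dual B) (dual_map B p)"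
  unfolding homs_extend_def
proof (intro allI impI)
  fix \<xi> assume "lin (dual C) (self) \<xi>"
  then obtain c where c: "c \<in> carrier C" "\<forall>f\<in>carrier (dual C). \<xi> f = f c" using o unfolding bidual_onto_def by blast
  obtain b where b: "b \<in> carrier B" "c = p b" using c(1) unfolding sesD(4)[OF s, symmetric] by blast
  show "\<exists>g. lin (dual B) (self) g \<and> (\<forall>x\<in>carrier (dual C). g (dual_map B p x) = \<xi> x)"
    using hom_eval[OF m b(1)] b c by (intro exI[of _ "\<lambda>g. g b"]) auto
qed

text \<open>The five lemma for the map from the sequence to its bidual. For injectivity: if all
  functionals kill \<open>p b\<close>, evaluation at b descends to the dual of A, so it is
  evaluation at some a; as B is torsionless, b equals \<open>i a\<close>.\<close>

lemma reflexive_quot: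
  assumes s: "ses R A B C i p" and m: "module R A" "module R B" "module R C"
    and x: "homs_extend R A B i" and xd: "homs_extend R (dual C) (dual B) (dual_map B p)"
    and A: "bidual_onto R A" and B: "torsionless R B" "bidual_onto R B"
  shows "torsionless R C" "bidual_onto R C"
proof -
  note d = ses_dual[OF s m x]
  show "bidual_onto R C" unfolding bidual_onto_def
  proof (intro allI impI)
    fix \<xi> assume "lin (dual C) (self) \<xi>"
    then obtain \<eta> where \<eta>: "lin (dual B) (self) \<eta>" "\<forall>f\<in>carrier (dual C). \<eta> (dual_map B p f) = \<xi> f"
      using xd unfolding homs_extend_def by blast
    obtain b where b: "b \<in> carrier B" "\<forall>g\<in>carrier (dual B). \<eta> g = g b" using B(2) \<eta>(1) unfolding bidual_onto_def by blast
    have "\<xi> f = f (p b)" if f: "f \<in> carrier (dual C)" for f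
    proof -
      have "\<xi> f = \<eta> (dual_map B p f)" using \<eta>(2) f by simp
      also have "\<dots> = dual_map B p f b" using b(2) mod_homD(1)[OF sesD(1)[OF d] f] by blast
      finally show ?thesis using b(1) by simp
    qed
    then show "\<exists>x\<in>carrier C. \<forall>f\<in>carrier (dual C). \<xi> f = f x" using mod_homD(1)[OF sesD(2)[OF s] b(1)] by blast
  qed
  show "torsionless R C" unfolding torsionless_def
  proof (intro ballI impI)
    fix c assume c: "c \<in> carrier C" "\<forall>f\<in>carrier (dual C). f c = \<zero>"
    obtain b where b: "b \<in> carrier B" "c = p b" using c(1) unfolding sesD(4)[OF s, symmetric] by blast
    have "g b = \<zero>\<^bsub>self\<^esub>" if g: "g \<in> carrier (dual B)" "dual_map A i g = \<zero>\<^bsub>dual A\<^esub>" for g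
    proof -
      obtain f where "f \<in> carrier (dual C)" "g = dual_map B p f" using sesD(6)[OF d, OF g] by blast
      then show ?thesis using c b by simp
    qed
    then obtain h where h: "lin (dual A) (self) h" "\<And>g. g \<in> carrier (dual B) \<Longrightarrow> h (dual_map A i g) = g b"
      using hom_factor[OF sesD(2)[OF d] sesD(4)[OF d] hom_eval[OF m(2) b(1)]] m by auto
    obtain a where a: "a \<in> carrier A" "\<forall>f\<in>carrier (dual A). h f = f a" using A h(1) unfolding bidual_onto_def by blast
    have ia: "i a \<in> carrier B" using mod_homD(1)[OF sesD(1)[OF s] a(1)] .
    have "g (b \<oplus>\<^bsub>B\<^esub> (\<ominus>\<^bsub>B\<^esub> i a)) = \<zero>" if g: "g \<in> carrier (dual B)" for g
    proof -
      have "g b = g (i a)" using h(2)[OF g] a(2) mod_homD(1)[OF sesD(2)[OF d] g] a(1) by simp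
      then have "g (b \<oplus>\<^bsub>B\<^esub> (\<ominus>\<^bsub>B\<^esub> i a)) = g b \<oplus>\<^bsub>self\<^esub> (\<ominus>\<^bsub>self\<^esub> g b)"
        using hom_diff[OF dual_memD[OF g] m(2) module_self b(1) ia] by simp
      then show ?thesis using madd_neg[OF module_self mod_homD(1)[OF dual_memD[OF g] b(1)]] by simp
    qed
    then have "b \<oplus>\<^bsub>B\<^esub> (\<ominus>\<^bsub>B\<^esub> i a) = \<zero>\<^bsub>B\<^esub>"
      using B(1) madd[OF m(2) b(1) mneg[OF m(2) ia]] unfolding torsionless_def by blast
    then have "b = i a" by (rule mcancel[OF m(2) b(1) ia])
    then show "c = \<zero>\<^bsub>C\<^esub>" using b sesD(5)[OF s a(1)] by simp
  qed
qed

section \<open>Totally reflexive modules in short exact sequences\<close>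

lemma tot_refl_iff:
  "tot_refl R G \<longleftrightarrow> fg G \<and> torsionless R G \<and> bidual_onto R G \<and>
     (\<forall>k. \<not> ext G (Suc k)) \<and> (\<forall>k. \<not> ext (dual G) (Suc k))"
proof -
  have *: "(\<forall>i>0. P i) \<longleftrightarrow> (\<forall>k. P (Suc k))" for P :: "nat \<Rightarrow> bool" using gr0_conv_Suc by auto
  show ?thesis unfolding tot_refl_def fg_module_def * using reflexive_iff[of G] by blast
qed

lemma tot_refl_fg: "tot_refl R G \<Longrightarrow> fg G"
  by (simp add: tot_refl_iff)

lemma tot_refl_free: "tot_refl R (free n)"
  by (simp add: tot_refl_iff torsionless_free bidual_onto_free ext_free ext_dual_free)

lemma tot_refl_stable_summand:
  assumes G: "tot_refl R G" and H: "fg H" and s: "stable_summand R H G"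
  shows "tot_refl R H"
proof -
  note g = G[unfolded tot_refl_iff]
  have m: "module R H" "module R G" "fin_gen R G" using H g by (auto simp: fg_module_def)
  have "\<not> ext H (Suc k)" for k using ext_nonzero_stable_summand[OF s m] g by blast
  moreover have "\<not> ext (dual H) (Suc k)" for k
    using ext_nonzero_stable_summand[OF stable_summand_dual[OF s m(1,2)] module_dual[OF m(1)] module_dual[OF m(2)]
      fin_gen_dual[OF m(3,2)]] g by blast
  ultimately show ?thesis
    using H g torsionless_stable_summand[OF s _ m(1,2)] bidual_onto_stable_summand[OF s _ m(1,2)]
    by (simp add: tot_refl_iff)
qed

text \<open>In the dual sequence the term coming from A is on the right. Its Ext^1 vanishes because
  functionals on the dual of C are evaluations and extend; its higher Ext is caught between those of
  the duals of B and C.\<close>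

lemma tot_refl_left:
  assumes s: "ses R A B C i p" and A: "fg A" and B: "tot_refl R B" and C: "tot_refl R C"
  shows "tot_refl R A"
proof -
  note b = B[unfolded tot_refl_iff] and c = C[unfolded tot_refl_iff]
  have fB: "fg B" and fC: "fg C" using b c by auto
  note m = fgD(1)[OF A] fgD(1)[OF fB] fgD(1)[OF fC]
  have x: "homs_extend R A B i" using ext1_homs_extend[OF s A fB fC] c by blast
  note d = ses_dual[OF s m x] and fd = fg_dual[OF fC] fg_dual[OF fB] fg_dual[OF A]
  have xd: "homs_extend R (dual C) (dual B) (dual_map B p)" using homs_extend_dual[OF s m(2)] c by blast
  have "\<not> ext A (Suc k)" for k using ses_ext_left[OF s A fB fC] b c by blast
  moreover have "\<not> ext (dual A) (Suc k)" for k
    using homs_extend_ext1[OF d fd xd] ses_ext_right[OF d fd] b c by (cases k) auto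
  moreover have "torsionless R A" using torsionless_sub[OF s m(1,2)] b by blast
  moreover have "bidual_onto R A" using bidual_onto_sub[OF s m x] b c by blast
  ultimately show ?thesis using A by (simp add: tot_refl_iff)
qed

text \<open>In general such a quotient only has Gorenstein dimension at most 1. Vanishing of
  Ext^1(C,R) makes the dual sequence exact, and vanishing of Ext^1 for the dual of A makes its
  second dual exact.\<close>

lemma tot_refl_right:
  assumes s: "ses R A B C i p" and A: "tot_refl R A" and B: "tot_refl R B" and C: "fg C"
    and c: "\<not> ext C (Suc 0)"
  shows "tot_refl R C"
proof -
  note a = A[unfolded tot_refl_iff] and b = B[unfolded tot_refl_iff]
  have fA: "fg A" and fB: "fg B" using a b by auto
  note m = fgD(1)[OF fA] fgD(1)[OF fB] fgD(1)[OF C]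
  have x: "homs_extend R A B i" using ext1_homs_extend[OF s fA fB C] c by blast
  note d = ses_dual[OF s m x] and fd = fg_dual[OF C] fg_dual[OF fB] fg_dual[OF fA]
  have xd: "homs_extend R (dual C) (dual B) (dual_map B p)" using ext1_homs_extend[OF d fd] a by blast
  have "\<not> ext C (Suc k)" for k
    using c ses_ext_right[OF s fA fB C] a b by (cases k) auto
  moreover have "\<not> ext (dual C) (Suc k)" for k using ses_ext_left[OF d fd] a b by blast
  moreover have "torsionless R C" "bidual_onto R C" using reflexive_quot[OF s m x xd] a b by blast+
  ultimately show ?thesis using C by (simp add: tot_refl_iff)
qed

end

section \<open>Syzygies and resolutions by totally reflexive modules\<close>

text \<open>The maps in the two directions need not be mutually inverse. Thus V is related to its
  positive powers, and \<open>syz\<close> and \<open>nth_syz\<close> do not distinguish a syzygy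
  from its direct powers.\<close>

definition stably_equiv :: "'a ring \<Rightarrow> ('a,'b) module \<Rightarrow> ('a,'c) module \<Rightarrow> bool" where
  "stably_equiv R U V \<longleftrightarrow> stable_summand R U V \<and> stable_summand R V U"

definition syz :: "'a ring \<Rightarrow> ('a,'b) module \<Rightarrow> ('a,'c) module \<Rightarrow> bool" where
  "syz R U N \<longleftrightarrow> fg_module R N \<and> (\<exists>n e. free_cover R U n e \<and> stably_equiv R (ker_mod R n U e) N)"

fun nth_syz :: "nat \<Rightarrow> 'a ring \<Rightarrow> ('a,'b) module \<Rightarrow> ('a, nat \<Rightarrow> 'a) module \<Rightarrow> bool" where
  "nth_syz 0 R U N = (fg_module R N \<and> stably_equiv R U N)"
| "nth_syz (Suc k) R U N = (\<exists>K. nth_syz k R U K \<and> syz R K N)"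

definition has_gres :: "'a ring \<Rightarrow> nat \<Rightarrow> ('a,'b) module \<Rightarrow> bool" where
  "has_gres R n M \<longleftrightarrow> (\<exists>G d e. gres R M n G d e)"

context noeth_cring
begin

lemma stably_equiv_refl: "stably_equiv R U U"
  by (simp add: stably_equiv_def stable_summand_refl)

lemma stably_equiv_sym: "stably_equiv R U V \<Longrightarrow> stably_equiv R V U"
  by (simp add: stably_equiv_def)

lemma stably_equiv_trans:
  "stably_equiv R U V \<Longrightarrow> stably_equiv R V W \<Longrightarrow> fg U \<Longrightarrow> fg V \<Longrightarrow> fg W \<Longrightarrow>
   stably_equiv R U W"
  using stable_summand_trans unfolding stably_equiv_def fg_module_def by metis

lemma stably_equiv_iso: "mod_iso R U V \<Longrightarrow> module R U \<Longrightarrow> module R V \<Longrightarrow> stably_equiv R U V"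
  by (simp add: stably_equiv_def stable_summand_iso)

lemma stably_equiv_ext:
  "stably_equiv R U V \<Longrightarrow> fg U \<Longrightarrow> fg V \<Longrightarrow> ext U (Suc i) \<longleftrightarrow> ext V (Suc i)"
  by (auto simp: stably_equiv_def fg_module_def intro: ext_nonzero_stable_summand)

lemma syz_unique:
  assumes e: "stably_equiv R U V" and U: "fg U" and V: "fg V" and s: "syz R U N" "syz R V N'"
  shows "stably_equiv R N N'"
proof -
  obtain n a where n: "free_cover R U n a" "stably_equiv R (ker n U a) N" using s(1) by (auto simp: syz_def)
  obtain m b where m: "free_cover R V m b" "stably_equiv R (ker m V b) N'" using s(2) by (auto simp: syz_def)
  note UV = fgD(1)[OF U] fgD(1)[OF V]
  have k: "stably_equiv R (ker n U a) (ker m V b)"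
    using e stable_summand_ker(1)[OF _ UV n(1) m(1)] stable_summand_ker(1)[OF _ UV(2,1) m(1) n(1)]
    by (simp add: stably_equiv_def)
  have N: "fg N" "fg N'" using s by (simp_all add: syz_def)
  note f = fg_ker[OF UV(1) n(1)] fg_ker[OF UV(2) m(1)]
  show ?thesis
    by (rule stably_equiv_trans[OF stably_equiv_sym[OF n(2)] stably_equiv_trans[OF k m(2) f N(2)] N(1) f(1) N(2)])
qed

lemma syz_stably_equiv:
  assumes U: "fg U" and s: "syz R U N" and e: "stably_equiv R N N'" and N': "fg N'"
  shows "syz R U N'"
proof -
  obtain n a where n: "free_cover R U n a" "stably_equiv R (ker n U a) N" and N: "fg N"
    using s by (auto simp: syz_def)
  have "stably_equiv R (ker n U a) N'"
    by (rule stably_equiv_trans[OF n(2) e fg_ker[OF fgD(1)[OF U] n(1)] N N'])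
  then show ?thesis using n(1) N' by (auto simp: syz_def)
qed

lemma syz_ker: "fg U \<Longrightarrow> free_cover R U n a \<Longrightarrow> syz R U (ker n U a)"
  using fg_ker fgD(1) stably_equiv_refl unfolding syz_def by blast

lemma syz_exists:
  assumes "fg U" obtains N :: "('a, nat \<Rightarrow> 'a) module" where "syz R U N"
  using assms fg_coverE syz_ker by metis

lemma syz_cong:
  assumes e: "stably_equiv R U V" and U: "fg U" and V: "fg V" and s: "syz R V N"
  shows "syz R U N"
proof -
  obtain N' :: "('a, nat \<Rightarrow> 'a) module" where N': "syz R U N'" by (rule syz_exists[OF U])
  show ?thesis using syz_stably_equiv[OF U N' syz_unique[OF e U V N' s]] s by (simp add: syz_def)
qed

lemma syz_ext:
  assumes U: "fg U" and s: "syz R U N"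
  shows "ext N (Suc i) \<longleftrightarrow> ext U (Suc (Suc i))"
proof -
  obtain n a where n: "free_cover R U n a" "stably_equiv R (ker n U a) N" and N: "fg N"
    using s by (auto simp: syz_def)
  show ?thesis
    using stably_equiv_ext[OF n(2) fg_ker[OF fgD(1)[OF U] n(1)] N] ext_nonzero_cover[OF fgD(1)[OF U] n(1)] by blast
qed

lemma nth_syz_fg: "nth_syz k R U N \<Longrightarrow> fg N"
  by (cases k) (auto simp: syz_def)

lemma nth_syz_stably_equiv:
  assumes "fg U" "nth_syz k R U N" "stably_equiv R N N'" "fg N'"
  shows "nth_syz k R U N'"
proof (cases k)
  case 0
  then show ?thesis using assms stably_equiv_trans[of U N N'] by auto
next
  case (Suc j)
  then obtain K where "nth_syz j R U K" "syz R K N" using assms by auto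
  then show ?thesis using Suc syz_stably_equiv[OF nth_syz_fg _ assms(3,4)] by auto
qed

lemma nth_syz_unique:
  assumes "stably_equiv R U V" "fg U" "fg V" "nth_syz k R U N" "nth_syz k R V N'"
  shows "stably_equiv R N N'"
  using assms(4,5)
proof (induct k arbitrary: N N')
  case 0
  have "stably_equiv R N U" using 0 stably_equiv_sym by auto
  moreover have "stably_equiv R U N'" using 0 assms(1-3) stably_equiv_trans[of U V N'] by auto
  ultimately show ?case using 0 assms(2) stably_equiv_trans[of N U N'] by auto
next
  case (Suc k)
  obtain K K' where "nth_syz k R U K" "syz R K N" "nth_syz k R V K'" "syz R K' N'" using Suc.prems by auto
  then show ?case using syz_unique[OF Suc.hyps] nth_syz_fg by metis
qed

lemma nth_syz_add:
  assumes U: "fg U" and K: "nth_syz k R U K"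
  shows "nth_syz l R K N \<Longrightarrow> nth_syz (k + l) R U N"
proof (induct l arbitrary: N)
  case 0
  then show ?case using nth_syz_stably_equiv[OF U K] by simp
next
  case (Suc l)
  then show ?case by auto
qed

text \<open>\<open>nth_syz\<close> appends syzygies at the end; inductions that first replace the
  module by the kernel of a cover need one at the front.\<close>

lemma nth_syz_front:
  fixes U N :: "('a, nat \<Rightarrow> 'a) module"
  assumes "fg U" "syz R U N" "nth_syz k R N N'"
  shows "nth_syz (Suc k) R U N'"
proof -
  have "nth_syz (Suc 0) R U N" using assms(1,2) stably_equiv_refl by auto
  from nth_syz_add[OF assms(1) this assms(3)] show ?thesis by simp
qed

lemma nth_syz_exists:
  fixes U :: "('a, nat \<Rightarrow> 'a) module"
  assumes "fg U" obtains N where "nth_syz k R U N"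
proof -
  have "\<exists>N. nth_syz k R U N"
  proof (induct k)
    case 0
    then show ?case using assms stably_equiv_refl by auto
  next
    case (Suc k)
    then obtain K where K: "nth_syz k R U K" by blast
    obtain N :: "('a, nat \<Rightarrow> 'a) module" where "syz R K N" by (rule syz_exists[OF nth_syz_fg[OF K]])
    then show ?case using K by auto
  qed
  then show ?thesis using that by blast
qed

lemma nth_syz_ext:
  assumes "fg U" shows "nth_syz k R U N \<Longrightarrow> ext N (Suc i) \<longleftrightarrow> ext U (Suc (i + k))"
proof (induct k arbitrary: N i)
  case 0
  then show ?case using stably_equiv_ext[OF _ assms] by auto
next
  case (Suc k)
  then obtain K where K: "nth_syz k R U K" "syz R K N" by auto
  then show ?case using syz_ext[OF nth_syz_fg[OF K(1)] K(2)] Suc.hyps[OF K(1), of "Suc i"] by simp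
qed

text \<open>The horseshoe also brings the three terms into a common carrier type, in which
  \<open>nth_syz_ses\<close> can iterate.\<close>

lemma syz_ses:
  assumes s: "ses R A B C i p" and A: "fg A" and B: "fg B" and C: "fg C"
  obtains A' B' C' :: "('a, nat \<Rightarrow> 'a) module" and i' p'
  where "syz R A A'" "syz R B B'" "syz R C C'" "ses R A' B' C' i' p'"
proof -
  note mm = fgD(1)[OF A] fgD(1)[OF B] fgD(1)[OF C]
  obtain n e where cA: "free_cover R A n e" by (rule fg_coverE[OF A])
  obtain q h where cC: "free_cover R C q h" by (rule fg_coverE[OF C])
  obtain H where cB: "free_cover R B (n + q) H" and
    s: "ses R (ker n A e) (ker (n + q) B H) (ker q C h)
       (\<lambda>u. join n q u \<zero>\<^bsub>free q\<^esub>) (snd_part n q)"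
    by (rule horseshoe[OF s mm cA cC])
  show ?thesis by (rule that[OF syz_ker[OF A cA] syz_ker[OF B cB] syz_ker[OF C cC] s])
qed

lemma nth_syz_ses:
  fixes A B C :: "('a, nat \<Rightarrow> 'a) module"
  assumes "ses R A B C i p" "fg A" "fg B" "fg C"
  shows "\<exists>A' B' C' i' p'. nth_syz k R A A' \<and> nth_syz k R B B' \<and> nth_syz k R C C' \<and> ses R A' B' C' i' p'"
proof (induct k)
  case 0
  show ?case
    by (rule exI[of _ A], rule exI[of _ B], rule exI[of _ C], rule exI[of _ i], rule exI[of _ p])
       (use assms stably_equiv_refl in auto)
next
  case (Suc k)
  then obtain A' B' C' i' p' where k: "nth_syz k R A A'" "nth_syz k R B B'" "nth_syz k R C C'" and s: "ses R A' B' C' i' p'"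
    by blast
  obtain A2 B2 C2 :: "('a, nat \<Rightarrow> 'a) module" and i2 p2
    where "syz R A' A2" "syz R B' B2" "syz R C' C2" and s2: "ses R A2 B2 C2 i2 p2"
    by (rule syz_ses[OF s nth_syz_fg[OF k(1)] nth_syz_fg[OF k(2)] nth_syz_fg[OF k(3)]])
  then have "nth_syz (Suc k) R A A2" "nth_syz (Suc k) R B B2" "nth_syz (Suc k) R C C2" using k by auto
  then show ?case using s2 by blast
qed

lemma tot_refl_syz:
  assumes U: "tot_refl R U" and s: "syz R U N" shows "tot_refl R N"
proof -
  obtain n a where n: "free_cover R U n a" "stably_equiv R (ker n U a) N" and N: "fg N"
    using s by (auto simp: syz_def)
  have "tot_refl R (ker n U a)"
    by (rule tot_refl_left[OF ses_ker[OF n(1)] fg_ker[OF fgD(1)[OF tot_refl_fg[OF U]] n(1)] tot_refl_free U])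
  then show ?thesis by (rule tot_refl_stable_summand[OF _ N]) (use n(2) in \<open>simp add: stably_equiv_def\<close>)
qed

lemma tot_refl_stably_equiv:
  "tot_refl R G \<Longrightarrow> fg H \<Longrightarrow> stably_equiv R G H \<Longrightarrow> tot_refl R H"
  using tot_refl_stable_summand unfolding stably_equiv_def by blast

lemma tot_refl_nth_syz: "tot_refl R U \<Longrightarrow> nth_syz k R U N \<Longrightarrow> tot_refl R N"
  by (induct k arbitrary: N) (auto intro: tot_refl_stably_equiv tot_refl_syz)

lemma syz_torsionless:
  assumes U: "fg U" and s: "syz R U N" shows "torsionless R N"
proof -
  obtain n a where n: "free_cover R U n a" "stably_equiv R (ker n U a) N" and N: "fg N"
    using s by (auto simp: syz_def)
  have m: "module R (ker n U a)" using fg_ker[OF fgD(1)[OF U] n(1)] by (simp add: fg_module_def)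
  have "torsionless R (ker n U a)" by (rule torsionless_sub[OF ses_ker[OF n(1)] m module_free torsionless_free])
  then show ?thesis
    using torsionless_stable_summand[OF _ _ fgD(1)[OF N] m] n(2) by (simp add: stably_equiv_def)
qed

text \<open>Dualizing the cover puts the dual of N, up to stable equivalence, on the right of a
  sequence with free middle term and the dual of U on the left. This raises the vanishing range by
  one; the new lowest degree comes from reflexivity of U.\<close>

lemma syz_bidual:
  assumes U: "fg U" and s: "syz R U N" and r: "torsionless R U" "bidual_onto R U"
    and x: "\<not> ext U (Suc 0)"
  shows "bidual_onto R N"
    and "(\<And>k. k < m \<Longrightarrow> \<not> ext (dual U) (Suc k)) \<Longrightarrow> k < Suc m \<Longrightarrow> \<not> ext (dual N) (Suc k)"
proof -
  obtain n a where n: "free_cover R U n a" "stably_equiv R (ker n U a) N" and N: "fg N"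
    using s by (auto simp: syz_def)
  let ?K = "ker n U a"
  have fK: "fg ?K" by (rule fg_ker[OF fgD(1)[OF U] n(1)])
  note m = fgD(1)[OF fK] module_free fgD(1)[OF U] and fN = fgD[OF N]
  note sk = ses_ker[OF n(1)]
  have h: "homs_extend R ?K (free n) (\<lambda>v. v)" using x ext_nonzero_1_iff[OF m(3) n(1)] by blast
  note d = ses_dual[OF sk m h] and fd = fg_dual[OF U] fg_dual[OF fg_free] fg_dual[OF fK]
  have "bidual_onto R ?K" by (rule bidual_onto_sub[OF sk m h bidual_onto_free r(1)])
  then show "bidual_onto R N"
    using bidual_onto_stable_summand[OF _ _ fN(1) m(1)] n(2) by (simp add: stably_equiv_def)
  assume E: "\<And>k. k < m \<Longrightarrow> \<not> ext (dual U) (Suc k)" and k: "k < Suc m"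
  have "\<not> ext (dual ?K) (Suc k)"
  proof (cases k)
    case 0
    then show ?thesis using homs_extend_ext1[OF d fd homs_extend_dual[OF sk module_free r(2)] ext_dual_free] by simp
  next
    case (Suc j)
    then show ?thesis using ses_ext_right[OF d fd E ext_dual_free, of j] k by simp
  qed
  moreover have "stable_summand R (dual N) (dual ?K)"
    using n(2) stable_summand_dual[OF _ fN(1) m(1)] by (simp add: stably_equiv_def)
  ultimately show "\<not> ext (dual N) (Suc k)"
    using ext_nonzero_stable_summand[OF _ module_dual[OF fN(1)] module_dual[OF m(1)] fin_gen_dual[OF fgD(2)[OF fK] m(1)]]
    by blast
qed

lemma nth_syz_bidual:
  assumes U: "fg U" and r: "torsionless R U" "bidual_onto R U" and x: "\<And>k. \<not> ext U (Suc k)"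
  shows "nth_syz k R U N \<Longrightarrow> torsionless R N \<and> bidual_onto R N \<and>
    (\<forall>m. (\<forall>j<m. \<not> ext (dual U) (Suc j)) \<longrightarrow> (\<forall>j<m. \<not> ext (dual N) (Suc j)))"
proof (induct k arbitrary: N)
  case 0
  then have N: "fg N" and e: "stable_summand R N U" by (auto simp: stably_equiv_def)
  note m = fgD(1)[OF N] fgD(1)[OF U]
  have "\<not> ext (dual N) (Suc j)" if "\<not> ext (dual U) (Suc j)" for j
    using that ext_nonzero_stable_summand[OF stable_summand_dual[OF e m] module_dual[OF m(1)] module_dual[OF m(2)]
      fin_gen_dual[OF fgD(2)[OF U] m(2)]] by blast
  then show ?case
    using torsionless_stable_summand[OF e r(1) m] bidual_onto_stable_summand[OF e r(2) m] by blast
next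
  case (Suc k)
  then obtain K where K: "nth_syz k R U K" and s: "syz R K N" by auto
  note ih = Suc.hyps[OF K] and fK = nth_syz_fg[OF K]
  have x1: "\<not> ext K (Suc 0)" using nth_syz_ext[OF U K] x by blast
  have "\<forall>j<m. \<not> ext (dual N) (Suc j)" if "\<forall>j<m. \<not> ext (dual U) (Suc j)" for m
    using syz_bidual(2)[OF fK s _ _ x1, of m] ih that by auto
  then show ?case using syz_torsionless[OF fK s] syz_bidual(1)[OF fK s _ _ x1] ih by blast
qed

text \<open>Dualizing \<open>U \<rightarrow> L \<rightarrow> C\<close> raises the vanishing range of \<open>Ext(C\<^sup>*, R)\<close> by one when passing to
  \<open>U\<^sup>*\<close>; since \<open>C\<close> is a syzygy of \<open>U\<close>, the range for \<open>U\<^sup>*\<close> is in turn inherited by \<open>C\<^sup>*\<close>, so that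
  induction on the range applies.\<close>

lemma tot_refl_reduce:
  assumes s: "ses R U L C i p" and L: "tot_refl R L" and U: "fg U" and z: "nth_syz (Suc n) R U C"
    and x: "\<And>k. \<not> ext U (Suc k)"
  shows "tot_refl R U"
proof -
  note l = L[unfolded tot_refl_iff]
  have fL: "fg L" using l by blast
  have C: "fg C" by (rule nth_syz_fg[OF z])
  note m = fgD(1)[OF U] fgD(1)[OF fL] fgD(1)[OF C]
  have xC: "\<not> ext C (Suc 0)" using nth_syz_ext[OF U z] x by blast
  have h: "homs_extend R U L i" by (rule ext1_homs_extend[OF s U fL C xC])
  \<comment> \<open>Because \<open>Suc n\<close> is positive, C is a syzygy of some module and hence
    torsionless; the reflexivity of U rests on this.\<close>
  obtain K where "nth_syz n R U K" "syz R K C" using z by auto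
  then have tC: "torsionless R C" using syz_torsionless nth_syz_fg by blast
  have tU: "torsionless R U" using torsionless_sub[OF s m(1,2)] l by blast
  have oU: "bidual_onto R U" using bidual_onto_sub[OF s m h _ tC] l by blast
  note c = nth_syz_bidual[OF U tU oU x z]
  note d = ses_dual[OF s m h] and fd = fg_dual[OF C] fg_dual[OF fL] fg_dual[OF U]
  have hd: "homs_extend R (dual C) (dual L) (dual_map L p)" using homs_extend_dual[OF s m(2)] c by blast
  have "\<forall>j<k. \<not> ext (dual U) (Suc j)" for k
  proof (induct k)
    case (Suc k)
    then have E: "\<forall>j<k. \<not> ext (dual C) (Suc j)" using c by blast
    \<comment> \<open>Degree 1 is settled by surjectivity of C onto its bidual and uses no earlier
      range, so the induction can start from the empty one. Every other degree comes from the dual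
      of C one degree lower.\<close>
    have "\<not> ext (dual U) (Suc j)" if "j < Suc k" for j
      using homs_extend_ext1[OF d fd hd] ses_ext_right[OF d fd] E l that by (cases j) auto
    then show ?case by blast
  qed simp
  then show ?thesis using U x tU oU by (auto simp: tot_refl_iff)
qed

section \<open>Resolutions by totally reflexive modules and their lengths\<close>

lemma gres_0:
  fixes M :: "('a, nat \<Rightarrow> 'a) module"
  assumes M: "fg M" shows "has_gres R 0 M \<longleftrightarrow> tot_refl R M"
proof
  assume "has_gres R 0 M"
  then obtain G d e where "gres R M 0 G d e" unfolding has_gres_def by blast
  then have G: "tot_refl R (G 0)" "mod_iso R (G 0) M" by (auto simp: gres_def mod_iso_def bij_betw_def)
  have "stably_equiv R (G 0) M"
    by (rule stably_equiv_iso[OF G(2) fgD(1)[OF tot_refl_fg[OF G(1)]] fgD(1)[OF M]])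
  then show "tot_refl R M" by (rule tot_refl_stably_equiv[OF G(1) M])
next
  assume "tot_refl R M"
  then show "has_gres R 0 M" unfolding has_gres_def gres_def
    by (intro exI[of _ "\<lambda>_. M"] exI[of _ "\<lambda>_ x. x"] exI[of _ "\<lambda>x. x"]) (auto simp: mod_hom_id)
qed

lemma gres_Suc_left:
  assumes g: "gres R M (Suc n) G d e" and M: "module R M"
  obtains Z :: "('a, nat \<Rightarrow> 'a) module" where "fg Z" "ses R Z (G 0) M (\<lambda>x. x) e" "has_gres R n Z"
proof -
  have t: "\<And>j. j \<le> Suc n \<Longrightarrow> tot_refl R (G j)" and e: "lin (G 0) M e" "e ` carrier (G 0) = carrier M"
    and d: "\<And>j. j \<in> {1..Suc n} \<Longrightarrow> lin (G j) (G (j - 1)) (d j)"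
    and x0: "exact_at (G 1) (G 0) M (d 1) e"
    and x: "\<And>j. 1 \<le> j \<Longrightarrow> j < Suc n \<Longrightarrow> exact_at (G (j + 1)) (G j) (G (j - 1)) (d (j + 1)) (d j)"
    and inj: "inj_on (d (Suc n)) (carrier (G (Suc n)))"
    using g by (auto simp: gres_def)
  define Z where "Z = G 0\<lparr>carrier := {v \<in> carrier (G 0). e v = \<zero>\<^bsub>M\<^esub>}\<rparr>"
  have f0: "fg (G 0)" using t tot_refl_fg by blast
  note m0 = fgD(1)[OF f0]
  have mZ: "module R Z" unfolding Z_def
    using mod_homD[OF e(1)] hom_zero[OF e(1) m0 M] m0 M by (intro module_sub) auto
  have iZ: "lin Z (G 0) (\<lambda>x. x)" by (auto simp: mod_hom_def Z_def)
  have fZ: "fg Z"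
    using fin_gen_sub[OF fgD(2)[OF f0] m0 mZ iZ] mZ by (auto simp: fg_module_def)
  have s: "ses R Z (G 0) M (\<lambda>x. x) e"
    using iZ e by (auto simp: ses_def exact_at_def Z_def)
  have d1: "lin (G 1) (G 0) (d 1)" using d[of 1] by simp
  have im: "d 1 ` carrier (G 1) = carrier Z" using x0 by (simp add: exact_at_def Z_def)
  have d1Z: "lin (G 1) Z (d 1)"
    using d1 im by (auto simp: mod_hom_def Z_def)
  have "gres R Z n (\<lambda>j. G (Suc j)) (\<lambda>j. d (Suc j)) (d 1)"
    unfolding gres_def
  proof (intro conjI allI impI ballI)
    show "tot_refl R (G (Suc j))" if "j \<le> n" for j using t that by simp
    show "lin (G (Suc 0)) Z (d 1)" using d1Z by simp
    show "d 1 ` carrier (G (Suc 0)) = carrier Z" using im by simp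
    show "lin (G (Suc j)) (G (Suc (j - 1))) (d (Suc j))" if "j \<in> {1..n}" for j using d[of "Suc j"] that by simp
    show "if n = 0 then inj_on (d 1) (carrier (G (Suc 0)))
      else exact_at (G (Suc 1)) (G (Suc 0)) Z (d (Suc 1)) (d 1) \<and>
           (\<forall>j. 1 \<le> j \<and> j < n \<longrightarrow> exact_at (G (Suc (j + 1))) (G (Suc j)) (G (Suc (j - 1))) (d (Suc (j + 1))) (d (Suc j))) \<and>
           inj_on (d (Suc n)) (carrier (G (Suc n)))"
    proof (cases "n = 0")
      case True
      then show ?thesis using inj by simp
    next
      case False
      have "exact_at (G (Suc 1)) (G (Suc 0)) Z (d (Suc 1)) (d 1)" using x[of 1] False by (simp add: exact_at_def Z_def)
      moreover have "exact_at (G (Suc (j + 1))) (G (Suc j)) (G (Suc (j - 1))) (d (Suc (j + 1))) (d (Suc j))"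
        if "1 \<le> j \<and> j < n" for j using x[of "Suc j"] that by simp
      ultimately show ?thesis using False inj by simp
    qed
  qed
  then show ?thesis using that[OF fZ s] by (auto simp: has_gres_def)
qed

text \<open>Splicing: P takes place 0, and the augmentation of Z followed by \<open>i\<close>
  becomes the first differential.\<close>

lemma gres_Suc_right:
  fixes P Z :: "('a, nat \<Rightarrow> 'a) module"
  assumes s: "ses R Z P M i p" and P: "tot_refl R P" and Z: "has_gres R n Z" and m: "module R Z"
  shows "has_gres R (Suc n) M"
proof -
  obtain G d e where g: "gres R Z n G d e" using Z by (auto simp: has_gres_def)
  have t: "\<And>j. j \<le> n \<Longrightarrow> tot_refl R (G j)" and e: "lin (G 0) Z e" "e ` carrier (G 0) = carrier Z"
    and d: "\<And>j. j \<in> {1..n} \<Longrightarrow> lin (G j) (G (j - 1)) (d j)"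
    and x: "if n = 0 then inj_on e (carrier (G 0))
      else exact_at (G 1) (G 0) Z (d 1) e \<and>
           (\<forall>j. 1 \<le> j \<and> j < n \<longrightarrow> exact_at (G (j + 1)) (G j) (G (j - 1)) (d (j + 1)) (d j)) \<and>
           inj_on (d n) (carrier (G n))"
    using g by (auto simp: gres_def)
  have mP: "module R P" using P tot_refl_fg fgD(1) by blast
  define D where "D = (\<lambda>j. if j = 1 then (\<lambda>v. i (e v)) else d (j - 1))"
  have ie: "lin (G 0) P (\<lambda>v. i (e v))" by (rule mod_hom_comp[OF e(1) sesD(1)[OF s]])
  have i0: "i z = \<zero>\<^bsub>P\<^esub> \<longleftrightarrow> z = \<zero>\<^bsub>Z\<^esub>" if "z \<in> carrier Z" for z
    using that hom_zero[OF sesD(1)[OF s] m mP] inj_onD[OF sesD(3)[OF s], of z "\<zero>\<^bsub>Z\<^esub>"] m by auto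
  have "gres R M (Suc n) (case_nat P G) D p"
    unfolding gres_def
  proof (intro conjI allI impI ballI)
    show "tot_refl R (case_nat P G j)" if "j \<le> Suc n" for j using P t that by (cases j) auto
    show "lin (case_nat P G 0) M p" using sesD(2)[OF s] by simp
    show "p ` carrier (case_nat P G 0) = carrier M" using sesD(4)[OF s] by simp
    show "lin (case_nat P G j) (case_nat P G (j - 1)) (D j)" if j: "j \<in> {1..Suc n}" for j
    proof (cases "j = 1")
      case True
      then show ?thesis using ie by (simp add: D_def)
    next
      case False
      then obtain k where "j = 2 + k" using le_Suc_ex[of 2 j] j by auto
      then have "j = Suc (Suc k)" by simp
      then show ?thesis using d[of "Suc k"] j by (simp add: D_def)
    qed
    have x0: "exact_at (G 0) P M (\<lambda>v. i (e v)) p"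
      using s e(2) by (simp add: ses_def exact_at_def image_image[symmetric])
    have "exact_at (case_nat P G (j + 1)) (case_nat P G j) (case_nat P G (j - 1)) (D (j + 1)) (D j)"
      if j: "1 \<le> j \<and> j < Suc n" for j
    proof (cases "j = 1")
      case True
      have "exact_at (G 1) (G 0) Z (d 1) e" using x j True by simp
      then have "exact_at (G 1) (G 0) P (d 1) (\<lambda>v. i (e v))"
        using i0 mod_homD(1)[OF e(1)] by (auto simp: exact_at_def)
      then show ?thesis using True by (simp add: D_def)
    next
      case False
      then obtain k where "j = 2 + k" using le_Suc_ex[of 2 j] j by auto
      then have k: "j = Suc (Suc k)" by simp
      then have "exact_at (G (Suc k + 1)) (G (Suc k)) (G (Suc k - 1)) (d (Suc k + 1)) (d (Suc k))" using x j by auto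
      then show ?thesis using k by (simp add: D_def)
    qed
    moreover have "inj_on (D (Suc n)) (carrier (case_nat P G (Suc n)))"
    proof (cases "n = 0")
      case True
      then have "inj_on e (carrier (G 0))" using x by simp
      then have "inj_on (i \<circ> e) (carrier (G 0))" using sesD(3)[OF s] e(2) by (simp add: comp_inj_on)
      then show ?thesis using True by (simp add: D_def comp_def)
    next
      case False
      then show ?thesis using x by (simp add: D_def)
    qed
    ultimately show "if Suc n = 0 then inj_on p (carrier (case_nat P G 0))
      else exact_at (case_nat P G 1) (case_nat P G 0) M (D 1) p \<and>
           (\<forall>j. 1 \<le> j \<and> j < Suc n \<longrightarrow> exact_at (case_nat P G (j + 1)) (case_nat P G j) (case_nat P G (j - 1)) (D (j + 1)) (D j)) \<and>
           inj_on (D (Suc n)) (carrier (case_nat P G (Suc n)))"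
      using x0 by (simp add: D_def)
  qed
  then show ?thesis by (auto simp: has_gres_def)
qed

lemma has_gres_iso:
  assumes i: "mod_iso R K M" and K: "module R K" and M: "module R M" and g: "has_gres R n K"
  shows "has_gres R n M"
proof -
  obtain f where f: "lin K M f" "bij_betw f (carrier K) (carrier M)" using i by (auto simp: mod_iso_def)
  have f0: "f x = \<zero>\<^bsub>M\<^esub> \<longleftrightarrow> x = \<zero>\<^bsub>K\<^esub>" if "x \<in> carrier K" for x
    using that f(2) hom_zero[OF f(1) K M] K inj_onD[of f "carrier K" x "\<zero>\<^bsub>K\<^esub>"] by (auto simp: bij_betw_def)
  obtain G d e where g: "gres R K n G d e" using g by (auto simp: has_gres_def)
  have e: "lin (G 0) K e" "e ` carrier (G 0) = carrier K" using g by (auto simp: gres_def)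
  have "gres R M n G d (\<lambda>v. f (e v))"
  proof -
    have 1: "lin (G 0) M (\<lambda>v. f (e v))" by (rule mod_hom_comp[OF e(1) f(1)])
    have 2: "(\<lambda>v. f (e v)) ` carrier (G 0) = carrier M"
      using f(2) e(2) by (simp add: bij_betw_def image_image[symmetric])
    have 3: "inj_on e (carrier (G 0)) \<Longrightarrow> inj_on (\<lambda>v. f (e v)) (carrier (G 0))"
      using comp_inj_on[of e "carrier (G 0)" f] f(2) e(2) by (simp add: bij_betw_def comp_def)
    have 4: "exact_at (G 1) (G 0) K (d 1) e \<Longrightarrow> exact_at (G 1) (G 0) M (d 1) (\<lambda>v. f (e v))"
      using f0 mod_homD(1)[OF e(1)] by (auto simp: exact_at_def)
    show ?thesis using g 1 2 3 4 unfolding gres_def by (simp split: if_splits)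
  qed
  then show ?thesis by (auto simp: has_gres_def)
qed

lemma has_gres_ext:
  fixes M :: "('a, nat \<Rightarrow> 'a) module"
  assumes "has_gres R n M" "fg M" "n \<le> k" shows "\<not> ext M (Suc k)"
  using assms
proof (induct n arbitrary: M k)
  case 0
  then show ?case using gres_0 by (simp add: tot_refl_iff)
next
  case (Suc n)
  obtain G d e where g: "gres R M (Suc n) G d e" using Suc.prems by (auto simp: has_gres_def)
  obtain Z :: "('a, nat \<Rightarrow> 'a) module" where Z: "fg Z" "ses R Z (G 0) M (\<lambda>x. x) e" "has_gres R n Z"
    by (rule gres_Suc_left[OF g fgD(1)[OF Suc.prems(2)]])
  have G: "tot_refl R (G 0)" using g by (auto simp: gres_def)
  obtain j where j: "k = Suc j" "n \<le> j" using Suc.prems(3) by (cases k) auto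
  show ?case
    using ses_ext_right[OF Z(2,1) tot_refl_fg[OF G] Suc.prems(2) Suc.hyps[OF Z(3,1) j(2)]] G j(1) by (simp add: tot_refl_iff)
qed

text \<open>No relation between n and s is assumed: vanishing of Ext above s alone decides where the
  syzygies become totally reflexive. In the induction the first kernel Z inherits the vanishing
  range, and s-th syzygies of Z, of the first term and of M form a short exact sequence to which
  \<open>tot_refl_right\<close> applies.\<close>

lemma has_gres_tot_refl_syz:
  fixes M :: "('a, nat \<Rightarrow> 'a) module"
  assumes "has_gres R n M" "fg M" "\<And>k. s \<le> k \<Longrightarrow> \<not> ext M (Suc k)" "nth_syz s R M N"
  shows "tot_refl R N"
  using assms
proof (induct n arbitrary: M N)
  case 0
  then show ?case using gres_0 tot_refl_nth_syz by blast
next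
  case (Suc n)
  obtain G d e where g: "gres R M (Suc n) G d e" using Suc.prems by (auto simp: has_gres_def)
  obtain Z :: "('a, nat \<Rightarrow> 'a) module" where Z: "fg Z" "ses R Z (G 0) M (\<lambda>x. x) e" "has_gres R n Z"
    by (rule gres_Suc_left[OF g fgD(1)[OF Suc.prems(2)]])
  have G: "tot_refl R (G 0)" using g by (auto simp: gres_def)
  obtain Z' G' M' i p where z: "nth_syz s R Z Z'" "nth_syz s R (G 0) G'" "nth_syz s R M M'" and ss: "ses R Z' G' M' i p"
    using nth_syz_ses[OF Z(2,1) tot_refl_fg[OF G] Suc.prems(2)] by blast
  have "\<not> ext Z (Suc k)" if "s \<le> k" for k
    using ses_ext_left[OF Z(2,1) tot_refl_fg[OF G] Suc.prems(2)] Suc.prems(3)[of "Suc k"] that G by (auto simp: tot_refl_iff)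
  then have Z': "tot_refl R Z'" using Suc.hyps[OF Z(3,1) _ z(1)] by blast
  \<comment> \<open>This is Ext in degree s + 1 for M, the lowest degree covered by the
    hypothesis.\<close>
  have "\<not> ext M' (Suc 0)" using nth_syz_ext[OF Suc.prems(2) z(3), of 0] Suc.prems(3)[of s] by simp
  then have "tot_refl R M'" by (rule tot_refl_right[OF ss Z' tot_refl_nth_syz[OF G z(2)] nth_syz_fg[OF z(3)]])
  then show ?case
    using tot_refl_stably_equiv nth_syz_fg[OF Suc.prems(4)]
      nth_syz_unique[OF stably_equiv_refl Suc.prems(2,2) z(3) Suc.prems(4)] by blast
qed

text \<open>The free covers leading to the s-th kernel form the resolution. Its last term is only
  stably equivalent to N, which suffices to make it totally reflexive.\<close>

lemma tot_refl_syz_has_gres: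
  fixes M :: "('a, nat \<Rightarrow> 'a) module"
  assumes "fg M" "nth_syz s R M N" "tot_refl R N" shows "has_gres R s M"
  using assms
proof (induct s arbitrary: M N)
  case 0
  then have "stably_equiv R N M" using stably_equiv_sym by auto
  then show ?case using gres_0[OF 0(1)] tot_refl_stably_equiv[OF 0(3,1)] by blast
next
  case (Suc s)
  obtain n e where c: "free_cover R M n e" by (rule fg_coverE[OF Suc.prems(1)])
  let ?K = "ker n M e"
  have K: "fg ?K" by (rule fg_ker[OF fgD(1)[OF Suc.prems(1)] c])
  obtain N' where N': "nth_syz s R ?K N'" by (rule nth_syz_exists[OF K])
  have "nth_syz (Suc s) R M N'" by (rule nth_syz_front[OF Suc.prems(1) syz_ker[OF Suc.prems(1) c] N'])
  then have "stably_equiv R N N'" using nth_syz_unique[OF stably_equiv_refl Suc.prems(1,1,2)] by blast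
  then have "tot_refl R N'" by (rule tot_refl_stably_equiv[OF Suc.prems(3) nth_syz_fg[OF N']])
  then have "has_gres R s ?K" by (rule Suc.hyps[OF K N'])
  then show ?case by (rule gres_Suc_right[OF ses_ker[OF c] tot_refl_free _ fgD(1)[OF K]])
qed

section \<open>Reducing sequences\<close>

lemma syz_pow_nth_syz:
  assumes K: "fg K"
  shows "syz_pow n R K Y \<Longrightarrow> nth_syz n R K Y"
proof (induct n arbitrary: Y)
  case 0
  then have Y: "module R Y" "mod_iso R K Y" by auto
  then obtain f where f: "lin K Y f" "f ` carrier K = carrier Y" by (auto simp: mod_iso_def bij_betw_def)
  have "fg Y" using fin_gen_quot[OF fgD(2,1)[OF K] Y(1) f] Y(1) by (simp add: fg_module_def)
  then show ?case using stably_equiv_iso[OF Y(2) fgD(1)[OF K] Y(1)] by simp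
next
  case (Suc n)
  then obtain K' where K': "nth_syz n R K K'" "syzygy R K' Y" by auto
  then obtain m e where Y: "module R Y" and c: "free_cover R K' m e" and i: "mod_iso R Y (ker m K' e)"
    by (auto simp: syzygy_def min_cover_def free_cover_def)
  have k: "fg (ker m K' e)" by (rule fg_ker[OF fgD(1)[OF nth_syz_fg[OF K'(1)]] c])
  obtain f where f: "lin Y (ker m K' e) f" "inj_on f (carrier Y)" using i by (auto simp: mod_iso_def bij_betw_def)
  have "fg Y" using fin_gen_sub[OF fgD(2,1)[OF k] Y f] Y by (simp add: fg_module_def)
  then have "syz R K' Y" using c stably_equiv_sym[OF stably_equiv_iso[OF i Y fgD(1)[OF k]]] by (auto simp: syz_def)
  then show ?case using K'(1) by auto
qed

lemma dsum_pow_stably_equiv: "module R V \<Longrightarrow> a > 0 \<Longrightarrow> stably_equiv R (dsum_pow R V a) V"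
  by (simp add: stably_equiv_def stable_summand_dsum_pow)

text \<open>At level c the syzygy of K has no Ext in positive degrees. The additional syzygy in
  \<open>Suc c\<close> moves the direct powers into the carrier type of kernels before syzygies are
  iterated. The length m of the resolution of L does not enter the new bound.\<close>

lemma red_step:
  fixes K L :: "('a, nat \<Rightarrow> 'a) module"
  assumes K: "fg K" and L: "fg L" and ab: "a > 0" "b > 0" and n: "n > 0" and p: "syz_pow n R K Y"
    and s: "ses R (dsum_pow R K a) L (dsum_pow R Y b) f g"
    and x: "\<And>k. c \<le> k \<Longrightarrow> \<not> ext K (Suc k)"
  shows "c \<le> k \<Longrightarrow> \<not> ext L (Suc k)"
    and "has_gres R m L \<Longrightarrow> has_gres R (Suc c) K"
proof -
  note mK = fgD(1)[OF K] and mL = fgD(1)[OF L]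
  have z: "nth_syz n R K Y" by (rule syz_pow_nth_syz[OF K p])
  have Y: "fg Y" by (rule nth_syz_fg[OF z])
  note mY = fgD(1)[OF Y]
  have eA: "stably_equiv R (dsum_pow R K a) K" and eC: "stably_equiv R (dsum_pow R Y b) Y"
    using dsum_pow_stably_equiv mK mY ab by auto
  have A: "fg (dsum_pow R K a)"
    using fin_gen_sub[OF fgD(2)[OF L] mL module_dsum_pow[OF mK] sesD(1,3)[OF s]] mK by (simp add: fg_module_def)
  have C: "fg (dsum_pow R Y b)"
    using fin_gen_quot[OF fgD(2)[OF L] mL module_dsum_pow[OF mY] sesD(2,4)[OF s]] mY by (simp add: fg_module_def)
  show xL: "\<not> ext L (Suc k)" if "c \<le> k" for k
  proof (rule ses_ext_mid[OF s A L C])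
    show "\<not> ext (dsum_pow R K a) (Suc k)" using stably_equiv_ext[OF eA A K] x[OF that] by blast
    show "\<not> ext (dsum_pow R Y b) (Suc k)"
      using stably_equiv_ext[OF eC C Y] nth_syz_ext[OF K z] x[of "k + n"] that by simp
  qed
  assume g: "has_gres R m L"
  obtain A1 L1 C1 :: "('a, nat \<Rightarrow> 'a) module" and i1 p1 where
    1: "syz R (dsum_pow R K a) A1" "syz R L L1" "syz R (dsum_pow R Y b) C1" and s1: "ses R A1 L1 C1 i1 p1"
    by (rule syz_ses[OF s A L C])
  \<comment> \<open>Here the direct powers disappear: up to stable equivalence their syzygies are
    syzygies of K and Y.\<close>
  have A1: "syz R K A1" by (rule syz_cong[OF stably_equiv_sym[OF eA] K A 1(1)])
  have C1: "syz R Y C1" by (rule syz_cong[OF stably_equiv_sym[OF eC] Y C 1(3)])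
  have f1: "fg A1" "fg L1" "fg C1" using 1 by (auto simp: syz_def)
  obtain A' L' C' i' p' where k: "nth_syz c R A1 A'" "nth_syz c R L1 L'" "nth_syz c R C1 C'" and s': "ses R A' L' C' i' p'"
    using nth_syz_ses[OF s1 f1] by blast
  have KA: "nth_syz (Suc c) R K A'" by (rule nth_syz_front[OF K A1 k(1)])
  have LL: "nth_syz (Suc c) R L L'" by (rule nth_syz_front[OF L 1(2) k(2)])
  have YC: "nth_syz (Suc c) R Y C'" by (rule nth_syz_front[OF Y C1 k(3)])
  note A' = nth_syz_fg[OF KA] and C' = nth_syz_fg[OF YC]
  have L': "tot_refl R L'" by (rule has_gres_tot_refl_syz[OF g L _ LL]) (simp add: xL)
  \<comment> \<open>\<open>C'\<close> arises from Y but is wanted as an n-th syzygy of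
    \<open>A'\<close>. It is compared with an n-th syzygy N of \<open>A'\<close>, both being
    syzygies of K of order n + c + 1.\<close>
  obtain N where N: "nth_syz n R A' N" by (rule nth_syz_exists[OF A'])
  have "nth_syz (n + Suc c) R K C'" by (rule nth_syz_add[OF K z YC])
  moreover have "nth_syz (n + Suc c) R K N" using nth_syz_add[OF K KA N] by (simp add: add.commute)
  ultimately have "stably_equiv R N C'" using nth_syz_unique[OF stably_equiv_refl K K] by blast
  then have AC: "nth_syz n R A' C'" by (rule nth_syz_stably_equiv[OF A' N _ C'])
  obtain l where l: "n = Suc l" using n by (cases n) auto
  have "tot_refl R A'"
    by (rule tot_refl_reduce[OF s' L' A' AC[unfolded l]]) (use nth_syz_ext[OF K KA] x in simp)
  then show "has_gres R (Suc c) K" by (rule tot_refl_syz_has_gres[OF K KA])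
qed

section \<open>Gorenstein dimension and the supremum of nonvanishing degrees\<close>

lemma has_gres_zero:
  assumes M: "module R M" "carrier M = {\<zero>\<^bsub>M\<^esub>}"
  shows "has_gres R 0 M"
proof -
  have c: "carrier (free 0) = {\<zero>\<^bsub>free 0\<^esub>}" by (auto simp: free_mod_simps)
  show ?thesis unfolding has_gres_def gres_def
    by (rule exI[of _ "\<lambda>_. free 0"], rule exI, rule exI[of _ "\<lambda>_. \<zero>\<^bsub>M\<^esub>"])
       (auto simp: tot_refl_free hom_const0 M c)
qed

lemma gdim_finite_iff:
  assumes M: "module R M"
  shows "gdim R M < \<infinity> \<longleftrightarrow> (\<exists>n. has_gres R n M)"
proof (cases "carrier M = {\<zero>\<^bsub>M\<^esub>}")
  case True
  then show ?thesis using has_gres_zero[OF M True] by (auto simp: gdim_def)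
next
  case False
  have "Inf {ereal (real n) |n. has_gres R n M} < \<infinity> \<longleftrightarrow> (\<exists>n. has_gres R n M)"
    unfolding Inf_less_iff by auto
  then show ?thesis using False by (simp add: gdim_def has_gres_def)
qed

text \<open>Vanishing of Ext runs up the sequence from \<open>K 0\<close> with an unchanged bound c;
  finiteness of the Gorenstein dimension then runs down from \<open>K r\<close>.\<close>

lemma red_seq_has_gres:
  assumes r: "red_seq R M r K" and x: "\<And>k. c \<le> k \<Longrightarrow> \<not> ext (K 0) (Suc k)"
  shows "\<exists>n. has_gres R n (K 0)"
proof -
  have fg: "\<And>i. i \<le> r \<Longrightarrow> fg (K i)" using r by (auto simp: red_seq_def fg_module_def)
  have st: "\<exists>a b n Y f g. a > 0 \<and> b > 0 \<and> n > 0 \<and> syz_pow n R (K i) Y \<and>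
           ses R (dsum_pow R (K i) a) (K (Suc i)) (dsum_pow R Y b) f g" if "i < r" for i
  proof -
    have "Suc i \<in> {1..r}" using that by simp
    with r have "\<exists>a b n Y f g. a > 0 \<and> b > 0 \<and> n > 0 \<and> syz_pow n R (K (Suc i - 1)) Y \<and>
           ses R (dsum_pow R (K (Suc i - 1)) a) (K (Suc i)) (dsum_pow R Y b) f g"
      unfolding red_seq_def by blast
    then show ?thesis by simp
  qed
  have ext: "i \<le> r \<Longrightarrow> \<forall>k\<ge>c. \<not> ext (K i) (Suc k)" for i
  proof (induct i)
    case 0
    then show ?case using x by blast
  next
    case (Suc i)
    then have ir: "i < r" "\<And>k. c \<le> k \<Longrightarrow> \<not> ext (K i) (Suc k)" by auto
    obtain a b n Y f g where t: "a > 0" "b > 0" "n > 0" "syz_pow n R (K i) Y"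
      "ses R (dsum_pow R (K i) a) (K (Suc i)) (dsum_pow R Y b) f g" using st[OF ir(1)] by blast
    show ?case using red_step(1)[OF fg fg t ir(2)] ir(1) by auto
  qed
  have "j \<le> r \<Longrightarrow> \<exists>n. has_gres R n (K (r - j))" for j
  proof (induct j)
    case 0
    then show ?case using r gdim_finite_iff[OF fgD(1)[OF fg]] by (simp add: red_seq_def)
  next
    case (Suc j)
    define i where "i = r - Suc j"
    have i: "i < r" "r - j = Suc i" using Suc.prems by (auto simp: i_def)
    obtain m where m: "has_gres R m (K (Suc i))" using Suc i by auto
    obtain a b n Y f g where t: "a > 0" "b > 0" "n > 0" "syz_pow n R (K i) Y"
      "ses R (dsum_pow R (K i) a) (K (Suc i)) (dsum_pow R Y b) f g" using st[OF i(1)] by blast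
    have fi: "fg (K i)" "fg (K (Suc i))" using fg i(1) by auto
    have xi: "\<And>k. c \<le> k \<Longrightarrow> \<not> ext (K i) (Suc k)" using ext[of i] i(1) by auto
    have "has_gres R (Suc c) (K i)" by (rule red_step(2)[OF fi t xi m])
    then show ?case unfolding i_def by blast
  qed
  from this[of r] show ?thesis by simp
qed

text \<open>Stable equivalence controls Ext only in positive degrees; in degree 0 functionals are
  transported along the isomorphism itself.\<close>

lemma ext_nonzero_iso:
  assumes i: "mod_iso R K M" and K: "fg K" and M: "fg M"
  shows "ext M j \<longleftrightarrow> ext K j"
proof (cases j)
  case (Suc k)
  then show ?thesis
    using stably_equiv_ext[OF stably_equiv_iso[OF i fgD(1)[OF K] fgD(1)[OF M]] K M] by simp
next
  case 0
  obtain f where f: "lin K M f" "bij_betw f (carrier K) (carrier M)" using i by (auto simp: mod_iso_def)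
  note g = hom_inv[OF f fgD(1)[OF K] fgD(1)[OF M]]
  have im: "f ` carrier K = carrier M" and inj: "inj_on f (carrier K)" using f(2) by (auto simp: bij_betw_def)
  show ?thesis
    unfolding 0 ext_nonzero_0[OF fgD(2,1)[OF K]] ext_nonzero_0[OF fgD(2,1)[OF M]]
  proof
    assume "\<exists>h. lin M (self) h \<and> (\<exists>x\<in>carrier M. h x \<noteq> \<zero>)"
    then obtain h x where h: "lin M (self) h" "x \<in> carrier M" "h x \<noteq> \<zero>" by blast
    obtain y where "y \<in> carrier K" "x = f y" using h(2) unfolding im[symmetric] by blast
    then show "\<exists>h. lin K (self) h \<and> (\<exists>x\<in>carrier K. h x \<noteq> \<zero>)"
      using mod_hom_comp[OF f(1) h(1)] h(3) by auto
  next
    assume "\<exists>h. lin K (self) h \<and> (\<exists>x\<in>carrier K. h x \<noteq> \<zero>)"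
    then obtain h x where h: "lin K (self) h" "x \<in> carrier K" "h x \<noteq> \<zero>" by blast
    have "h (inv_into (carrier K) f (f x)) \<noteq> \<zero>" "f x \<in> carrier M" using h inj im by auto
    then show "\<exists>h. lin M (self) h \<and> (\<exists>x\<in>carrier M. h x \<noteq> \<zero>)"
      using mod_hom_comp[OF g h(1)] by blast
  qed
qed

lemma tot_refl_ext_0:
  assumes G: "tot_refl R G" and n: "carrier G \<noteq> {\<zero>\<^bsub>G\<^esub>}" shows "ext G 0"
proof -
  note f = fgD[OF tot_refl_fg[OF G]]
  obtain x where x: "x \<in> carrier G" "x \<noteq> \<zero>\<^bsub>G\<^esub>" using n mzero[OF f(1)] by blast
  then obtain h where "h \<in> carrier (dual G)" "h x \<noteq> \<zero>" using G unfolding tot_refl_iff torsionless_def by blast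
  then show ?thesis unfolding ext_nonzero_0[OF f(2,1)] using x(1) dual_memD by blast
qed

lemma not_ext_nonzero_zero:
  assumes M: "fg M" "carrier M = {\<zero>\<^bsub>M\<^esub>}" shows "\<not> ext M j"
proof -
  let ?F = "free 0"
  note m = fgD(1)[OF M(1)]
  have c: "carrier ?F = {\<zero>\<^bsub>?F\<^esub>}" by (auto simp: free_mod_simps)
  have "mod_iso R ?F M" unfolding mod_iso_def
    using hom_const0[OF m] M(2) by (intro exI[of _ "\<lambda>_. \<zero>\<^bsub>M\<^esub>"] conjI) (auto simp: c bij_betw_def)
  moreover have "\<not> ext ?F j"
  proof (cases j)
    case 0
    show ?thesis unfolding 0 ext_nonzero_0[OF fin_gen_free module_free]
      using hom_zero[where A = ?F and B = "self"] by (auto simp: c)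
  next
    case (Suc k)
    then show ?thesis using ext_free by simp
  qed
  ultimately show ?thesis using ext_nonzero_iso[OF _ fg_free M(1)] by blast
qed

text \<open>Let \<open>n0\<close> be the least length of a resolution. Ext vanishes above
  \<open>n0\<close>; if it vanished in degree \<open>n0 > 0\<close> as well, the syzygy before the
  last would already be totally reflexive and yield a shorter resolution. For \<open>n0 = 0\<close>
  the nonzero class is a nonzero functional. The copy K of M has the carrier type in which the
  statements on syzygies apply.\<close>

lemma gdim_eq_ext_sup:
  fixes K :: "('a, nat \<Rightarrow> 'a) module"
  assumes i: "mod_iso R K M" and K: "fg K" and M: "fg M" and g: "has_gres R n K"
  shows "gdim R M = ext_sup R M" and "\<exists>N. \<forall>j\<ge>N. \<not> ext M j"
proof -
  note mK = fgD(1)[OF K] and mM = fgD(1)[OF M]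
  note e = ext_nonzero_iso[OF i K M]
  obtain f where f: "lin K M f" "bij_betw f (carrier K) (carrier M)" using i by (auto simp: mod_iso_def)
  have i': "mod_iso R M K" using hom_inv[OF f mK mM] bij_betw_inv_into[OF f(2)] by (auto simp: mod_iso_def)
  define n0 where "n0 = (LEAST n. has_gres R n K)"
  have g0: "has_gres R n0 K" unfolding n0_def by (rule LeastI[where P = "\<lambda>n. has_gres R n K", OF g])
  have le: "has_gres R n M \<Longrightarrow> n0 \<le> n" for n unfolding n0_def by (rule Least_le) (rule has_gres_iso[OF i' mM mK])
  have gM: "has_gres R n0 M" by (rule has_gres_iso[OF i mK mM g0])
  have van: "\<not> ext M j" if "n0 < j" for j
    using has_gres_ext[OF g0 K, of "j - 1"] that e by (cases j) auto
  then show "\<exists>N. \<forall>j\<ge>N. \<not> ext M j" by (intro exI[of _ "Suc n0"]) auto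
  show "gdim R M = ext_sup R M"
  proof (cases "carrier M = {\<zero>\<^bsub>M\<^esub>}")
    case True
    \<comment> \<open>Both sides are \<open>-\<infinity>\<close>: by the convention for the zero
      module, and as the supremum of the empty set.\<close>
    then show ?thesis using not_ext_nonzero_zero[OF M True] by (simp add: gdim_def ext_sup_def bot_ereal_def)
  next
    case False
    have "gdim R M = Inf {ereal (real n) |n. has_gres R n M}" using False by (simp add: gdim_def has_gres_def)
    also have "\<dots> = ereal (real n0)"
      by (rule Inf_eqI) (use gM le in auto)
    finally have gd: "gdim R M = ereal (real n0)" .
    have "ext M n0"
    proof (cases n0)
      case 0
      then have t: "tot_refl R K" using g0 gres_0[OF K] by simp
      have "carrier K \<noteq> {\<zero>\<^bsub>K\<^esub>}"
      proof
        assume c: "carrier K = {\<zero>\<^bsub>K\<^esub>}"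
        have "carrier M = f ` carrier K" using f(2) by (simp add: bij_betw_def)
        then show False using False c hom_zero[OF f(1) mK mM] by simp
      qed
      then show ?thesis using tot_refl_ext_0[OF t] e 0 by simp
    next
      case (Suc s)
      show ?thesis
      proof (rule ccontr)
        assume n: "\<not> ext M n0"
        have "\<not> ext K (Suc k)" if "s \<le> k" for k
          using n van[of "Suc k"] e Suc that by (cases "k = s") auto
        moreover obtain N where N: "nth_syz s R K N" by (rule nth_syz_exists[OF K])
        ultimately have "tot_refl R N" using has_gres_tot_refl_syz[OF g0 K] by blast
        then have "has_gres R s K" by (rule tot_refl_syz_has_gres[OF K N])
        then have "n0 \<le> s" unfolding n0_def by (rule Least_le)
        then show False using Suc by simp
      qed
    qed
    moreover have "j \<le> n0" if "ext M j" for j using van[of j] that not_le by blast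
    ultimately have "ext_sup R M = ereal (real n0)" unfolding ext_sup_def by (intro Sup_eqI) auto
    then show ?thesis using gd by simp
  qed
qed

end

theorem theorem1p3:
  fixes R :: "'a ring" and M :: "('a, 'b) module"
  assumes "cring R" and "noetherian_ring R" and "\<exists>!m. maximalideal m R"
    and "module R M" and "fin_gen R M"
    and "red_gdim R M < \<infinity>"
  shows "gdim R M = ext_sup R M \<and>
         (gdim R M < \<infinity> \<longleftrightarrow> (\<exists>N. \<forall>i\<ge>N. \<not> ext_nonzero R M i))"
proof -
  interpret noeth_cring R using assms(1,2) by (simp add: noeth_cring_def)
  have "{enat r |r. \<exists>K. red_seq R M r K} \<noteq> {}"
  proof
    assume e: "{enat r |r. \<exists>K. red_seq R M r K} = {}"
    have "red_gdim R M = \<infinity>" unfolding red_gdim_def e by (simp add: Inf_enat_def)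
    then show False using assms(6) by simp
  qed
  then obtain r K where r: "red_seq R M r K" by blast
  then have i: "mod_iso R (K 0) M" and K: "fg_module R (K 0)" by (auto simp: red_seq_def fg_module_def)
  have M: "fg_module R M" using assms(4,5) by (simp add: fg_module_def)
  note e = ext_nonzero_iso[OF i K M]
  \<comment> \<open>Vanishing beyond N serves as the bound c for the whole reducing
    sequence.\<close>
  have fin: "\<exists>n. has_gres R n (K 0)" if N: "\<forall>i\<ge>N. \<not> ext_nonzero R M i" for N
    by (rule red_seq_has_gres[OF r, of N]) (use N e in auto)
  show ?thesis
  proof (cases "\<exists>n. has_gres R n M")
    case True
    obtain f where f: "mod_hom R (K 0) M f" "bij_betw f (carrier (K 0)) (carrier M)" using i by (auto simp: mod_iso_def)
    have "mod_iso R M (K 0)"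
      using hom_inv[OF f fgD(1)[OF K] assms(4)] bij_betw_inv_into[OF f(2)] by (auto simp: mod_iso_def)
    then obtain n where "has_gres R n (K 0)" using True has_gres_iso[OF _ assms(4) fgD(1)[OF K]] by blast
    then show ?thesis using gdim_eq_ext_sup[OF i K M] True gdim_finite_iff[OF assms(4)] by blast
  next
    case False
    then have inf: "gdim R M = \<infinity>" using gdim_finite_iff[OF assms(4)] by auto
    \<comment> \<open>If there is no finite resolution, \<open>fin\<close> forbids vanishing beyond
      any N, so nonzero Ext occurs in arbitrarily high degrees and the supremum is infinite
      too.\<close>
    have unb: "\<exists>i\<ge>N. ext_nonzero R M i" for N
      using fin[of N] has_gres_iso[OF i fgD(1)[OF K] assms(4)] False by blast
    have "ext_sup R M = \<infinity>" unfolding ext_sup_def setcompr_eq_image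
      by (rule SUP_PInfty) (use unb in auto)
    then show ?thesis using inf unb by (auto simp: not_le)
  qed
qed

end
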